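(* Let $\hbar>0$ and $a,b>0$, and let $R$ and $S$ be the density matrices on $L^2(\mathbf R)$ given by $$R=\tfrac12\big(|a\rangle\langle a|+|-a\rangle\langle -a|\big),\qquad S=\tfrac12\big(|b\rangle\langle b|+|-b\rangle\langle -b|\big).$$ Then $$MK_2(R,S)^2=(a-b)^2=W_2\big(\tfrac12(\delta_{-a}+\delta_a),\tfrac12(\delta_{-b}+\delta_b)\big)^2.$$ Moreover, the operator $$Q=\tfrac12\big(|a\rangle\langle a|\otimes|b\rangle\langle b|+|-a\rangle\langle -a|\otimes|-b\rangle\langle -b|\big)$$ is an optimal coupling of $R$ and $S$, i.e. $Q$ is a coupling of $R$ and $S$ and $\operatorname{trace}(CQ)=MK_2(R,S)^2$.
   Context: Let $\mathfrak H=L^2(\mathbf R)$ and $\hbar>0$. For $c\in\mathbf R$, $|c\rangle\in\mathfrak H$ is the (normalized) coherent state $x\mapsto(\pi\hbar)^{-1/4}e^{-(x-c)^2/2\hbar}$, and $|c\rangle\langle c|$ is the orthogonal projection onto its span. A density matrix on a Hilbert space is a self-adjoint nonnegative operator of trace $1$. A coupling of two density matrices $R,S$ on $\mathfrak H$ is a density matrix $Q$ on $\mathfrak H\otimes\mathfrak H\cong L^2(\mathbf R^2)$ such that $\operatorname{trace}((A\otimes I)Q)=\operatorname{trace}(AR)$ and $\operatorname{trace}((I\otimes B)Q)=\operatorname{trace}(BS)$ for all bounded operators $A,B$ on $\mathfrak H$. The quantum transport cost is the self-adjoint nonnegative operator on $L^2(\mathbf R^2,dx\,dy)$ $$C=(x-y)^2-\hbar^2(\partial_x-\partial_y)^2-2\hbar,$$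 and $$MK_2(R,S)^2:=\inf_{Q\text{ coupling of }R\text{ and }S}\operatorname{trace}(CQ),\qquad MK_2\ge 0,$$ where, for $Q\ge0$, $\operatorname{trace}(CQ)\in[0,+\infty]$ is understood as $\operatorname{trace}(C^{1/2}QC^{1/2})$. An optimal coupling is a coupling attaining this infimum. For probability measures $\mu,\nu$ on $\mathbf R$, $W_2(\mu,\nu)^2=\inf_\Pi\int|x-y|^2\,\Pi(dx,dy)$, the infimum being over probability measures $\Pi$ on $\mathbf R\times\mathbf R$ with marginals $\mu$ and $\nu$. *)

theory Defs
  imports "HOL-Probability.Probability"
begin

section \<open>The complex Hilbert space $L^2$\<close>

definition square_integrable :: "('a::euclidean_space \<Rightarrow> complex) \<Rightarrow> bool" where
  "square_integrable f \<longleftrightarrow>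
     f \<in> borel_measurable lborel \<and> integrable lborel (\<lambda>x. (cmod (f x))\<^sup>2)"

lemma square_integrable_zero: "square_integrable (\<lambda>x. 0)"
  by (simp add: square_integrable_def)

lemma square_integrable_add:
  assumes "square_integrable f" "square_integrable g"
  shows "square_integrable (\<lambda>x. f x + g x)"
  unfolding square_integrable_def
proof
  have [measurable]: "f \<in> borel_measurable borel" "g \<in> borel_measurable borel"
    using assms by (auto simp: square_integrable_def)
  show "(\<lambda>x. f x + g x) \<in> borel_measurable lborel"
    by measurable
  have bnd: "(cmod (f x + g x))\<^sup>2 \<le> 2 * (cmod (f x))\<^sup>2 + 2 * (cmod (g x))\<^sup>2" for x
  proof -
    have "(cmod (f x + g x))\<^sup>2 \<le> (cmod (f x) + cmod (g x))\<^sup>2"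
      by (intro power_mono norm_triangle_ineq) auto
    also have "\<dots> \<le> 2 * (cmod (f x))\<^sup>2 + 2 * (cmod (g x))\<^sup>2"
      using sum_squares_bound[of "cmod (f x)" "cmod (g x)"] by (simp add: power2_sum)
    finally show ?thesis .
  qed
  show "integrable lborel (\<lambda>x. (cmod (f x + g x))\<^sup>2)"
    by (rule Bochner_Integration.integrable_bound
          [where f = "\<lambda>x. 2 * (cmod (f x))\<^sup>2 + 2 * (cmod (g x))\<^sup>2"])
       (use assms bnd in \<open>auto simp: square_integrable_def\<close>)
qed

lemma square_integrable_cmult:
  "square_integrable f \<Longrightarrow> square_integrable (\<lambda>x. c * f x)"
  by (auto simp: square_integrable_def norm_mult power_mult_distrib)

lemma integrable_cnj_mult:
  assumes "square_integrable f" "square_integrable g"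
  shows "integrable lborel (\<lambda>x. cnj (f x) * g x)"
proof -
  have [measurable]: "f \<in> borel_measurable borel" "g \<in> borel_measurable borel"
    using assms by (auto simp: square_integrable_def)
  have cnj [measurable]: "(\<lambda>x. cnj (f x)) \<in> borel_measurable borel"
    using borel_measurable_continuous_onI[of cnj]
    by (rule measurable_compose[rotated]) (auto intro: continuous_intros)
  have bnd: "cmod (f x) * cmod (g x) \<le> (cmod (f x))\<^sup>2 + (cmod (g x))\<^sup>2" for x
    using sum_squares_bound[of "cmod (f x)" "cmod (g x)"]
      mult_nonneg_nonneg[of "cmod (f x)" "cmod (g x)"] by (simp del: mult_nonneg_nonneg)
  show ?thesis
    by (rule Bochner_Integration.integrable_bound
          [where f = "\<lambda>x. (cmod (f x))\<^sup>2 + (cmod (g x))\<^sup>2"])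
       (use assms bnd in \<open>auto simp: square_integrable_def norm_mult\<close>)
qed

quotient_type (overloaded) 'a L2 = "'a::euclidean_space \<Rightarrow> complex" /
  partial: "\<lambda>f g. square_integrable f \<and> square_integrable g \<and> (AE x in lborel. f x = g x)"
proof (rule part_equivpI)
  show "\<exists>f::'a \<Rightarrow> complex. square_integrable f \<and> square_integrable f \<and> (AE x in lborel. f x = f x)"
    using square_integrable_zero by auto
  show "symp (\<lambda>f g::'a \<Rightarrow> complex.
          square_integrable f \<and> square_integrable g \<and> (AE x in lborel. f x = g x))"
    by (auto simp: symp_def eq_commute)
  show "transp (\<lambda>f g::'a \<Rightarrow> complex.
          square_integrable f \<and> square_integrable g \<and> (AE x in lborel. f x = g x))"
    by (intro transpI) (auto elim: AE_mp)
qed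

text \<open>The class of a square integrable function (unspecified on other functions).\<close>

definition to_L2 :: "('a::euclidean_space \<Rightarrow> complex) \<Rightarrow> 'a L2" where
  "to_L2 f = abs_L2 f"

text \<open>Antilinear in the first argument.\<close>

lift_definition cinner :: "'a::euclidean_space L2 \<Rightarrow> 'a L2 \<Rightarrow> complex" is
  "\<lambda>f g. \<integral>x. cnj (f x) * g x \<partial>lborel"
proof -
  fix f f' g g' :: "'a \<Rightarrow> complex"
  assume f: "square_integrable f \<and> square_integrable f' \<and> (AE x in lborel. f x = f' x)"
    and g: "square_integrable g \<and> square_integrable g' \<and> (AE x in lborel. g x = g' x)"
  show "(\<integral>x. cnj (f x) * g x \<partial>lborel) = (\<integral>x. cnj (f' x) * g' x \<partial>lborel)"
  proof (rule integral_cong_AE)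
    show "AE x in lborel. cnj (f x) * g x = cnj (f' x) * g' x"
      using f g by (auto elim: AE_mp)
  qed (use f g integrable_cnj_mult in \<open>blast intro: borel_measurable_integrable\<close>)+
qed

lift_definition scaleC :: "complex \<Rightarrow> 'a::euclidean_space L2 \<Rightarrow> 'a L2"  (infixr "*\<^sub>C" 75) is
  "\<lambda>c f x. c * f x"
  by (auto simp: square_integrable_cmult elim: AE_mp)

instantiation L2 :: (euclidean_space) real_inner
begin

lift_definition zero_L2 :: "'a L2" is "\<lambda>x. 0"
  by (simp add: square_integrable_zero)

lift_definition plus_L2 :: "'a L2 \<Rightarrow> 'a L2 \<Rightarrow> 'a L2" is "\<lambda>f g x. f x + g x"
  by (auto simp: square_integrable_add elim: AE_mp)

definition uminus_L2 :: "'a L2 \<Rightarrow> 'a L2" where "uminus_L2 f = (-1) *\<^sub>C f"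
definition minus_L2 :: "'a L2 \<Rightarrow> 'a L2 \<Rightarrow> 'a L2" where "minus_L2 f g = f + (-1) *\<^sub>C g"
definition scaleR_L2 :: "real \<Rightarrow> 'a L2 \<Rightarrow> 'a L2" where "scaleR_L2 r f = complex_of_real r *\<^sub>C f"
definition inner_L2 :: "'a L2 \<Rightarrow> 'a L2 \<Rightarrow> real" where "inner_L2 f g = Re (cinner f g)"
definition norm_L2 :: "'a L2 \<Rightarrow> real" where "norm_L2 f = sqrt (inner f f)"
definition sgn_L2 :: "'a L2 \<Rightarrow> 'a L2" where "sgn_L2 f = complex_of_real (inverse (norm f)) *\<^sub>C f"
definition dist_L2 :: "'a L2 \<Rightarrow> 'a L2 \<Rightarrow> real" where "dist_L2 f g = norm (f - g)"
definition uniformity_L2 :: "('a L2 \<times> 'a L2) filter" where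
  "uniformity_L2 = (INF e\<in>{0<..}. principal {(f, g). dist f g < e})"
definition open_L2 :: "'a L2 set \<Rightarrow> bool" where
  "open_L2 U \<longleftrightarrow> (\<forall>f\<in>U. \<forall>\<^sub>F (f', g) in uniformity. f' = f \<longrightarrow> g \<in> U)"

instance
proof
  fix f g h :: "'a L2" and r s :: real
  show "f + g + h = f + (g + h)"
    by transfer (auto simp: add.assoc square_integrable_add)
  show "f + g = g + f"
    by transfer (auto simp: add.commute square_integrable_add)
  show "0 + f = f"
    by transfer auto
  show "- f + f = 0"
    unfolding uminus_L2_def by transfer (auto simp: square_integrable_zero)
  show "f - g = f + - g"
    by (simp add: minus_L2_def uminus_L2_def)
  show "r *\<^sub>R (f + g) = r *\<^sub>R f + r *\<^sub>R g"
    unfolding scaleR_L2_def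
    by transfer (auto simp: distrib_left intro!: square_integrable_add square_integrable_cmult)
  show "(r + s) *\<^sub>R f = r *\<^sub>R f + s *\<^sub>R f"
    unfolding scaleR_L2_def
    by transfer
      (auto simp: distrib_right intro!: square_integrable_add square_integrable_cmult)
  show "r *\<^sub>R s *\<^sub>R f = (r * s) *\<^sub>R f"
    unfolding scaleR_L2_def
    by transfer (auto simp: mult.assoc intro!: square_integrable_cmult)
  show "1 *\<^sub>R f = f"
    unfolding scaleR_L2_def by transfer auto
  show "sgn f = inverse (norm f) *\<^sub>R f" "dist f g = norm (f - g)" "norm f = sqrt (inner f f)"
    "uniformity = (INF e\<in>{0<..}. principal {(f::'a L2, g). dist f g < e})"
    by (simp_all add: sgn_L2_def scaleR_L2_def dist_L2_def norm_L2_def uniformity_L2_def)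
  show "open U \<longleftrightarrow> (\<forall>f\<in>U. \<forall>\<^sub>F (f', g) in uniformity. f' = f \<longrightarrow> g \<in> U)" for U :: "'a L2 set"
    by (simp add: open_L2_def)
  have cinner_commute: "cinner f g = cnj (cinner g f)"
  proof transfer
    fix f g :: "'a \<Rightarrow> complex"
    have "(\<integral>x. cnj (f x) * g x \<partial>lborel) = (\<integral>x. cnj (cnj (g x) * f x) \<partial>lborel)"
      by (simp add: mult.commute)
    also have "\<dots> = cnj (\<integral>x. cnj (g x) * f x \<partial>lborel)"
      by (rule Bochner_Integration.integral_cnj)
    finally show "(\<integral>x. cnj (f x) * g x \<partial>lborel) = cnj (\<integral>x. cnj (g x) * f x \<partial>lborel)" .
  qed
  then show "inner f g = inner g f"
    by (simp add: inner_L2_def)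
  have "cinner (f + g) h = cinner f h + cinner g h"
    by transfer (auto simp: distrib_right integrable_cnj_mult)
  then show "inner (f + g) h = inner f h + inner g h"
    by (simp add: inner_L2_def)
  have "cinner (r *\<^sub>R f) g = r * cinner f g"
    unfolding scaleR_L2_def by transfer (simp add: mult.assoc)
  then show "inner (r *\<^sub>R f) g = r * inner f g"
    by (simp add: inner_L2_def)
  have nrm: "cnj z * z = complex_of_real ((cmod z)\<^sup>2)" for z
    by (metis complex_norm_square mult.commute)
  have pos: "Re (cinner f f) \<ge> 0 \<and> (Re (cinner f f) = 0 \<longleftrightarrow> f = 0)"
  proof transfer
    fix f :: "'a \<Rightarrow> complex"
    assume f: "square_integrable f \<and> square_integrable f \<and> (AE x in lborel. f x = f x)"
    have "Re (\<integral>x. cnj (f x) * f x \<partial>lborel) = (\<integral>x. (cmod (f x))\<^sup>2 \<partial>lborel)"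
      unfolding nrm by (subst integral_complex_of_real) simp
    moreover have "(\<integral>x. (cmod (f x))\<^sup>2 \<partial>lborel) = 0 \<longleftrightarrow> (AE x in lborel. (cmod (f x))\<^sup>2 = 0)"
      using f by (intro integral_nonneg_eq_0_iff_AE) (auto simp: square_integrable_def)
    ultimately show "Re (\<integral>x. cnj (f x) * f x \<partial>lborel) \<ge> 0 \<and>
       (Re (\<integral>x. cnj (f x) * f x \<partial>lborel) = 0 \<longleftrightarrow>
         square_integrable f \<and> square_integrable (\<lambda>x::'a. 0) \<and> (AE x in lborel. f x = 0))"
      using f by (auto simp: square_integrable_zero)
  qed
  show "0 \<le> inner f f" "inner f f = 0 \<longleftrightarrow> f = 0"
    using pos by (simp_all add: inner_L2_def)
qed

end

section \<open>Bounded operators, trace and density matrices\<close>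

definition bounded_op :: "('a::euclidean_space L2 \<Rightarrow> 'a L2) \<Rightarrow> bool" where
  "bounded_op T \<longleftrightarrow> bounded_linear T \<and> (\<forall>c f. T (c *\<^sub>C f) = c *\<^sub>C T f)"

definition orthonormal :: "'a::euclidean_space L2 set \<Rightarrow> bool" where
  "orthonormal B \<longleftrightarrow> (\<forall>e\<in>B. \<forall>f\<in>B. cinner e f = (if e = f then 1 else 0))"

definition orthonormal_basis :: "'a::euclidean_space L2 set \<Rightarrow> bool" where
  "orthonormal_basis B \<longleftrightarrow> orthonormal B \<and> (\<forall>f. (\<forall>e\<in>B. cinner e f = 0) \<longrightarrow> f = 0)"

text \<open>
  For trace class operators, and for nonnegative operators, the sum does not depend on the chosen
  basis. For a nonnegative operator that is not trace class it diverges, and then \<open>infsum\<close> is 0.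
\<close>

definition op_trace :: "('a::euclidean_space L2 \<Rightarrow> 'a L2) \<Rightarrow> complex" where
  "op_trace T = (\<Sum>\<^sub>\<infinity>e\<in>(SOME B. orthonormal_basis B). cinner e (T e))"

definition density_matrix :: "('a::euclidean_space L2 \<Rightarrow> 'a L2) \<Rightarrow> bool" where
  "density_matrix R \<longleftrightarrow> bounded_op R \<and>
     (\<forall>f g. cinner (R f) g = cinner f (R g)) \<and>
     (\<forall>f. 0 \<le> Re (cinner f (R f))) \<and>
     op_trace R = 1"

text \<open>\<open>ket_bra u\<close> is $|u\rangle\langle u|$.\<close>

definition ket_bra :: "'a::euclidean_space L2 \<Rightarrow> 'a L2 \<Rightarrow> 'a L2" where
  "ket_bra u f = cinner u f *\<^sub>C u"

definition coherent :: "real \<Rightarrow> real \<Rightarrow> real L2" where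
  "coherent hbar c =
     to_L2 (\<lambda>x. complex_of_real ((pi * hbar) powr (- 1 / 4) * exp (- (x - c)\<^sup>2 / (2 * hbar))))"

section \<open>Tensor products and couplings\<close>

lift_definition tensor ::
  "'a::euclidean_space L2 \<Rightarrow> 'b::euclidean_space L2 \<Rightarrow> ('a \<times> 'b) L2" is
  "\<lambda>f g (x, y). f x * g y"
proof -
  have sq: "square_integrable (\<lambda>(x, y). f x * g y)"
    if "square_integrable f" "square_integrable g"
    for f :: "'a \<Rightarrow> complex" and g :: "'b \<Rightarrow> complex"
  proof -
    have [measurable]: "f \<in> borel_measurable borel" "g \<in> borel_measurable borel"
      using that by (auto simp: square_integrable_def)
    have m: "(\<lambda>p. f (fst p) * g (snd p)) \<in> borel_measurable borel"
      unfolding borel_prod[symmetric] by measurable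
    have "integrable (lborel \<Otimes>\<^sub>M lborel) (\<lambda>(x, y). (cmod (f x))\<^sup>2 * (cmod (g y))\<^sup>2)"
      using that
      by (intro lborel_pair.Fubini_integrable) (auto simp: square_integrable_def abs_mult)
    with m show ?thesis
      by (simp add: square_integrable_def lborel_prod case_prod_beta' norm_mult power_mult_distrib)
  qed
  have ae: "AE p in lborel. (case p of (x, y) \<Rightarrow> f x * g y) = (case p of (x, y) \<Rightarrow> f' x * g' y)"
    if "square_integrable f" "square_integrable f'" "AE x in lborel. f x = f' x"
      "square_integrable g" "square_integrable g'" "AE y in lborel. g y = g' y"
    for f f' :: "'a \<Rightarrow> complex" and g g' :: "'b \<Rightarrow> complex"
  proof -
    have [measurable]: "f \<in> borel_measurable borel" "g \<in> borel_measurable borel"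
      "f' \<in> borel_measurable borel" "g' \<in> borel_measurable borel"
      using that by (auto simp: square_integrable_def)
    have "AE p in lborel \<Otimes>\<^sub>M lborel. f (fst p) * g (snd p) = f' (fst p) * g' (snd p)"
    proof (rule lborel_pair.AE_pair_measure)
      show "{p \<in> space (lborel \<Otimes>\<^sub>M lborel). f (fst p) * g (snd p) = f' (fst p) * g' (snd p)}
              \<in> sets (lborel \<Otimes>\<^sub>M lborel)"
        by measurable
      show "AE x in lborel. AE y in lborel.
              f (fst (x, y)) * g (snd (x, y)) = f' (fst (x, y)) * g' (snd (x, y))"
        using that(3)
      proof eventually_elim
        case (elim x)
        show ?case using that(6) by eventually_elim (simp add: elim)
      qed
    qed
    then show ?thesis unfolding lborel_prod by (simp add: case_prod_beta')
  qed
  fix f f' :: "'a \<Rightarrow> complex" and g g' :: "'b \<Rightarrow> complex"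
  assume "square_integrable f \<and> square_integrable f' \<and> (AE x in lborel. f x = f' x)"
    "square_integrable g \<and> square_integrable g' \<and> (AE x in lborel. g x = g' x)"
  then show "square_integrable (\<lambda>(x, y). f x * g y) \<and> square_integrable (\<lambda>(x, y). f' x * g' y) \<and>
    (AE p in lborel. (case p of (x, y) \<Rightarrow> f x * g y) = (case p of (x, y) \<Rightarrow> f' x * g' y))"
    using sq ae by blast
qed

definition tensor_op ::
  "('a::euclidean_space L2 \<Rightarrow> 'a L2) \<Rightarrow> ('b::euclidean_space L2 \<Rightarrow> 'b L2) \<Rightarrow>
   ('a \<times> 'b) L2 \<Rightarrow> ('a \<times> 'b) L2" where
  "tensor_op A B = (THE T. bounded_op T \<and> (\<forall>f g. T (tensor f g) = tensor (A f) (B g)))"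

definition coupling ::
  "(real L2 \<Rightarrow> real L2) \<Rightarrow> (real L2 \<Rightarrow> real L2) \<Rightarrow> ((real \<times> real) L2 \<Rightarrow> (real \<times> real) L2) \<Rightarrow> bool"
where
  "coupling R S Q \<longleftrightarrow> density_matrix Q \<and>
     (\<forall>A. bounded_op A \<longrightarrow> op_trace (tensor_op A id \<circ> Q) = op_trace (A \<circ> R)) \<and>
     (\<forall>B. bounded_op B \<longrightarrow> op_trace (tensor_op id B \<circ> Q) = op_trace (B \<circ> S))"

section \<open>Unbounded operators\<close>

text \<open>Unbounded operators are represented by their graphs, with natural domains for products.\<close>

type_synonym 'a unbounded_op = "('a L2 \<times> 'a L2) set"

definition op_adjoint :: "'a::euclidean_space unbounded_op \<Rightarrow> 'a unbounded_op" where
  "op_adjoint G = {(f, g). \<forall>(h, k)\<in>G. cinner f k = cinner g h}"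

definition self_adjoint :: "'a::euclidean_space unbounded_op \<Rightarrow> bool" where
  "self_adjoint G \<longleftrightarrow> closure (Domain G) = UNIV \<and> op_adjoint G = G"

definition nonneg_op :: "'a::euclidean_space unbounded_op \<Rightarrow> bool" where
  "nonneg_op G \<longleftrightarrow> (\<forall>(f, g)\<in>G. 0 \<le> Re (cinner f g))"

definition op_sqrt :: "'a::euclidean_space unbounded_op \<Rightarrow> 'a unbounded_op" where
  "op_sqrt G = (THE D. self_adjoint D \<and> nonneg_op D \<and> D O D = G)"

definition op_apply :: "'a::euclidean_space unbounded_op \<Rightarrow> 'a L2 \<Rightarrow> 'a L2" where
  "op_apply G f = (THE g. (f, g) \<in> G)"

text \<open>
  \<open>trace_conj D Q\<close> is $\mathrm{trace}(DQD)\in[0,\infty]$ for $D$ self-adjoint and $Q$ bounded and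
  nonnegative. As $DQD$ is in general only defined as the nonnegative form
  $f\mapsto\langle Df,QDf\rangle$ on the domain of $D$, the trace is the supremum over all finite
  orthonormal systems in that domain; summing over one fixed orthonormal basis would not do,
  since its span need not be a core of $D$. The supremum is $\|DQ^{1/2}\|_{HS}^2$ if $DQ^{1/2}$ is
  Hilbert-Schmidt, and $\infty$ otherwise.
\<close>

definition trace_conj ::
  "'a::euclidean_space unbounded_op \<Rightarrow> ('a L2 \<Rightarrow> 'a L2) \<Rightarrow> ennreal" where
  "trace_conj D Q = (SUP F\<in>{F. finite F \<and> orthonormal F \<and> F \<subseteq> Domain D}.
     \<Sum>e\<in>F. ennreal (Re (cinner (op_apply D e) (Q (op_apply D e)))))"

section \<open>The quantum transport cost\<close>

text \<open>Schwartz functions on the plane; \<open>fx\<close> and \<open>fy\<close> are the partial derivatives.\<close>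

coinductive schwartz :: "(real \<times> real \<Rightarrow> complex) \<Rightarrow> bool" where
  "\<lbrakk> \<And>k. bounded (range (\<lambda>p. norm p ^ k *\<^sub>R f p));
     \<And>p. (f has_derivative (\<lambda>(s, t). s *\<^sub>R fx p + t *\<^sub>R fy p)) (at p);
     schwartz fx; schwartz fy \<rbrakk> \<Longrightarrow> schwartz f"

text \<open>$\partial_x-\partial_y$\<close>

definition dx_minus_dy :: "(real \<times> real \<Rightarrow> complex) \<Rightarrow> real \<times> real \<Rightarrow> complex" where
  "dx_minus_dy f p = frechet_derivative f (at p) (1, 0) - frechet_derivative f (at p) (0, 1)"

definition cost_expr :: "real \<Rightarrow> (real \<times> real \<Rightarrow> complex) \<Rightarrow> real \<times> real \<Rightarrow> complex" where
  "cost_expr hbar f = (\<lambda>(x, y).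
     (x - y)\<^sup>2 *\<^sub>R f (x, y) - hbar\<^sup>2 *\<^sub>R dx_minus_dy (dx_minus_dy f) (x, y) - (2 * hbar) *\<^sub>R f (x, y))"

text \<open>
  The differential expression is essentially self-adjoint on Schwartz functions, so its
  self-adjoint realization is the closure of the operator with that domain.
\<close>

definition cost_op :: "real \<Rightarrow> (real \<times> real) unbounded_op" where
  "cost_op hbar = closure {(to_L2 f, to_L2 (cost_expr hbar f)) | f. schwartz f}"

definition transport_cost :: "real \<Rightarrow> ((real \<times> real) L2 \<Rightarrow> (real \<times> real) L2) \<Rightarrow> ennreal" where
  "transport_cost hbar Q = trace_conj (op_sqrt (cost_op hbar)) Q"

definition ennsqrt :: "ennreal \<Rightarrow> ennreal" where
  "ennsqrt t = (if t = \<infinity> then \<infinity> else ennreal (sqrt (enn2real t)))"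

definition MK2 :: "real \<Rightarrow> (real L2 \<Rightarrow> real L2) \<Rightarrow> (real L2 \<Rightarrow> real L2) \<Rightarrow> ennreal" where
  "MK2 hbar R S = ennsqrt (INF Q\<in>{Q. coupling R S Q}. transport_cost hbar Q)"

definition optimal_coupling ::
  "real \<Rightarrow> (real L2 \<Rightarrow> real L2) \<Rightarrow> (real L2 \<Rightarrow> real L2) \<Rightarrow>
   ((real \<times> real) L2 \<Rightarrow> (real \<times> real) L2) \<Rightarrow> bool" where
  "optimal_coupling hbar R S Q \<longleftrightarrow> coupling R S Q \<and> transport_cost hbar Q = (MK2 hbar R S)\<^sup>2"

section \<open>The classical Wasserstein distance\<close>

definition classical_coupling :: "real measure \<Rightarrow> real measure \<Rightarrow> (real \<times> real) measure \<Rightarrow> bool" where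
  "classical_coupling \<mu> \<nu> P \<longleftrightarrow> prob_space P \<and> sets P = sets borel \<and>
     distr P borel fst = \<mu> \<and> distr P borel snd = \<nu>"

definition W2 :: "real measure \<Rightarrow> real measure \<Rightarrow> ennreal" where
  "W2 \<mu> \<nu> = ennsqrt (INF P\<in>{P. classical_coupling \<mu> \<nu> P}.
     \<integral>\<^sup>+(x, y). ennreal (\<bar>x - y\<bar>\<^sup>2) \<partial>P)"

definition half_sum :: "'a measure \<Rightarrow> 'a measure \<Rightarrow> 'a measure" where
  "half_sum M N = measure_of (space M) (sets M) (\<lambda>A. (emeasure M A + emeasure N A) / 2)"

abbreviation delta :: "real \<Rightarrow> real measure" where
  "delta c \<equiv> return borel c"

end

theory Submission
  imports Defs
begin

text \<open>
  Coherent states are eigenvectors of the annihilation operators \<open>X = x + hbar \<partial>\<^sub>x\<close> and \<open>Y = y + hbar \<partial>\<^sub>y\<close>,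
  and \<open>C = (X - Y)\<^sup>* (X - Y)\<close>. In the variables \<open>x - y\<close>, \<open>x + y\<close> the operator \<open>C\<close> is \<open>4 hbar\<close> times the number
  operator of the first variable, hence diagonal in a basis of Hermite functions, which gives its
  square root explicitly.

  The marginals force every coupling \<open>Q\<close> to live on the span of the four vectors
  \<open>|\<alpha>\<rangle> \<otimes> |\<beta>\<rangle>\<close> with \<open>\<alpha> = \<plusminus> a\<close> and \<open>\<beta> = \<plusminus> b\<close>. There the inequality
  \<open>|X - Y|\<^sup>2 \<ge> (1 - b / a) |X|\<^sup>2 + (1 - a / b) |Y|\<^sup>2\<close> bounds the cost from below by an operator of the form
  \<open>A \<otimes> I + I \<otimes> B\<close> with \<open>A\<close> and \<open>B\<close> bounded, and the trace of this operator against \<open>Q\<close> depends on the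
  marginals only: it is \<open>(1 - b / a) a\<^sup>2 + (1 - a / b) b\<^sup>2 = (a - b)\<^sup>2\<close>. The product coupling attains this value,
  since \<open>X - Y\<close> acts on its two vectors as \<open>\<plusminus> (a - b)\<close>.
\<close>

section \<open>The Hilbert space structure of $L^2$\<close>

text \<open>The coefficients \<open>1 - b / a\<close> and \<open>1 - a / b\<close> come from
  completing a square. With s = \<open>sqrt (b / a)\<close> and t = \<open>sqrt (a / b)\<close> one
  has s t = 1, so |X - Y|^2 and |s X - t Y|^2 have the same cross terms, and their difference is the
  right-hand side of the inequality. Moreover s X - t Y vanishes on both vectors of the product
  coupling, so nothing is lost there; this is the quantum counterpart of a pair of Kantorovich
  potentials. The obstacle is that |X|^2 is unbounded, while a coupling controls only traces against
  bounded operators on one factor. Hence the support of \<open>Q\<close> is determined before any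
  cost is estimated: on the span of two coherent states |X|^2 can be replaced by a bounded operator
  with the same matrix elements, and \<open>Q\<close> becomes a finite matrix. One of the two
  coefficients is negative unless a = b, so the traces against the marginals are needed exactly and
  not merely as estimates. Since \<open>op_trace\<close> sums over one unspecified basis with
  default value 0 and \<open>trace_conj\<close> is a supremum, explicit traces are reduced to
  Parseval identities between finitely many vectors.\<close>

lemma L2_cases:
  fixes F :: "'a::euclidean_space L2"
  obtains f where "square_integrable f" "F = to_L2 f"
proof -
  have "square_integrable (rep_L2 F)"
    using Quotient3_rep_reflp[OF Quotient3_L2, of F] by simp
  moreover have "F = to_L2 (rep_L2 F)"
    unfolding to_L2_def using Quotient3_abs_rep[OF Quotient3_L2, of F] by simp
  ultimately show ?thesis using that by blast
qed

lemma to_L2_eq_iff: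
  "square_integrable f \<Longrightarrow> square_integrable g \<Longrightarrow> to_L2 f = to_L2 g \<longleftrightarrow> (AE x in lborel. f x = g x)"
  unfolding to_L2_def using Quotient3_rel[OF Quotient3_L2, of f g] by auto

lemma cinner_to_L2:
  "square_integrable f \<Longrightarrow> square_integrable g \<Longrightarrow>
     cinner (to_L2 f) (to_L2 g) = (\<integral>x. cnj (f x) * g x \<partial>lborel)"
  unfolding to_L2_def by (rule cinner.abs_eq) auto

lemma scaleC_to_L2: "square_integrable f \<Longrightarrow> c *\<^sub>C to_L2 f = to_L2 (\<lambda>x. c * f x)"
  unfolding to_L2_def by (rule scaleC.abs_eq) auto

lemma plus_to_L2:
  "square_integrable f \<Longrightarrow> square_integrable g \<Longrightarrow> to_L2 f + to_L2 g = to_L2 (\<lambda>x. f x + g x)"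
  unfolding to_L2_def by (rule plus_L2.abs_eq) auto

lemma zero_to_L2: "0 = to_L2 (\<lambda>x. 0)"
  unfolding to_L2_def zero_L2_def ..

lemma tensor_to_L2:
  "square_integrable f \<Longrightarrow> square_integrable g \<Longrightarrow>
     tensor (to_L2 f) (to_L2 g) = to_L2 (\<lambda>(x, y). f x * g y)"
  unfolding to_L2_def by (rule tensor.abs_eq) auto

lemma cinner_commute: "cinner f g = cnj (cinner g f)"
proof transfer
  fix f g :: "'a \<Rightarrow> complex"
  have "(\<integral>x. cnj (f x) * g x \<partial>lborel) = (\<integral>x. cnj (cnj (g x) * f x) \<partial>lborel)"
    by (simp add: mult.commute)
  also have "\<dots> = cnj (\<integral>x. cnj (g x) * f x \<partial>lborel)"
    by (rule Bochner_Integration.integral_cnj)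
  finally show "(\<integral>x. cnj (f x) * g x \<partial>lborel) = cnj (\<integral>x. cnj (g x) * f x \<partial>lborel)" .
qed

lemma cinner_add_right: "cinner f (g + h) = cinner f g + cinner f h"
  by transfer (auto simp: distrib_left integrable_cnj_mult)

lemma cinner_scaleC_right [simp]: "cinner f (c *\<^sub>C g) = c * cinner f g"
  by transfer (simp add: mult.left_commute)

lemma cinner_add_left: "cinner (f + g) h = cinner f h + cinner g h"
  by (metis cinner_add_right cinner_commute complex_cnj_add)

lemma cinner_scaleC_left [simp]: "cinner (c *\<^sub>C f) g = cnj c * cinner f g"
  by (metis cinner_commute cinner_scaleC_right complex_cnj_mult)

lemma scaleR_scaleC: "r *\<^sub>R f = complex_of_real r *\<^sub>C f"
  by (simp add: scaleR_L2_def)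

lemma cinner_scaleR_right [simp]: "cinner f (r *\<^sub>R g) = of_real r * cinner f g"
  by (simp add: scaleR_scaleC)

lemma cinner_scaleR_left [simp]: "cinner (r *\<^sub>R f) g = of_real r * cinner f g"
  by (simp add: scaleR_scaleC)

lemma cinner_diff_right: "cinner f (g - h) = cinner f g - cinner f h"
  by (simp add: minus_L2_def cinner_add_right)

lemma cinner_diff_left: "cinner (f - g) h = cinner f h - cinner g h"
  by (simp add: minus_L2_def cinner_add_left)

lemma cinner_zero [simp]: "cinner 0 f = 0" "cinner f 0 = 0"
  using cinner_scaleR_left[of 0 0 f] cinner_scaleR_right[of f 0 0] by simp_all

lemma cinner_minus [simp]: "cinner (- f) g = - cinner f g" "cinner f (- g) = - cinner f g"
  by (simp_all add: uminus_L2_def)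

lemma cinner_sum_right: "cinner f (sum g A) = (\<Sum>i\<in>A. cinner f (g i))"
  by (induction A rule: infinite_finite_induct) (simp_all add: cinner_add_right)

lemma cinner_sum_left: "cinner (sum g A) f = (\<Sum>i\<in>A. cinner (g i) f)"
  by (induction A rule: infinite_finite_induct) (simp_all add: cinner_add_left)

lemma cinner_self: "cinner f f = of_real ((norm f)\<^sup>2)"
proof -
  have "Im (cinner f f) = 0"
    using cinner_commute[of f f] by (metis Reals_cnj_iff complex_is_Real_iff)
  moreover have "Re (cinner f f) = (norm f)\<^sup>2"
    by (simp add: power2_norm_eq_inner inner_L2_def)
  ultimately show ?thesis by (simp add: complex_eq_iff)
qed

lemma scaleC_add_right: "c *\<^sub>C (f + g) = c *\<^sub>C f + c *\<^sub>C g"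
  by transfer (auto simp: distrib_left intro!: square_integrable_add square_integrable_cmult)

lemma scaleC_add_left: "(c + d) *\<^sub>C f = c *\<^sub>C f + d *\<^sub>C f"
  by transfer (auto simp: distrib_right intro!: square_integrable_add square_integrable_cmult)

lemma scaleC_scaleC [simp]: "c *\<^sub>C d *\<^sub>C f = (c * d) *\<^sub>C f"
  by transfer (auto simp: mult.assoc intro!: square_integrable_cmult)

lemma scaleC_one [simp]: "1 *\<^sub>C f = f"
  using scaleR_one[of f] by (simp add: scaleR_scaleC)

lemma scaleC_zero [simp]: "0 *\<^sub>C f = 0" "c *\<^sub>C 0 = (0::'a::euclidean_space L2)"
proof -
  show "0 *\<^sub>C f = 0" using scaleR_zero_left[of f] by (simp add: scaleR_scaleC)
  show "c *\<^sub>C 0 = (0::'a L2)"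
    using scaleC_add_right[of c 0 "0::'a L2"] by simp
qed

lemma scaleC_minus_left: "(- c) *\<^sub>C f = - (c *\<^sub>C f)"
  by (simp add: uminus_L2_def)

lemma scaleC_diff_right: "c *\<^sub>C (f - g) = c *\<^sub>C f - c *\<^sub>C g"
  by (simp add: minus_L2_def scaleC_add_right mult.commute)

lemma scaleC_sum_right: "c *\<^sub>C (sum f A) = (\<Sum>i\<in>A. c *\<^sub>C f i)"
  by (induction A rule: infinite_finite_induct) (simp_all add: scaleC_add_right)

lemma scaleR_scaleC_commute: "r *\<^sub>R c *\<^sub>C f = c *\<^sub>C r *\<^sub>R (f::'a::euclidean_space L2)"
  by (simp add: scaleR_scaleC mult.commute)

lemma norm_scaleC [simp]: "norm (c *\<^sub>C f) = cmod c * norm f"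
proof -
  have "complex_of_real ((norm (c *\<^sub>C f))\<^sup>2) = cinner (c *\<^sub>C f) (c *\<^sub>C f)"
    by (rule cinner_self[symmetric])
  also have "\<dots> = (c * cnj c) * cinner f f"
    by simp
  also have "\<dots> = of_real ((cmod c * norm f)\<^sup>2)"
    by (simp only: complex_norm_square[symmetric] cinner_self power_mult_distrib of_real_mult)
  finally show ?thesis
    by (metis mult_nonneg_nonneg norm_ge_zero of_real_eq_iff power2_eq_iff_nonneg)
qed

text \<open>The real Cauchy-Schwarz inequality is applied to \<open>f\<close> and a unimodular
  multiple of \<open>g\<close>; the phase \<open>u\<close> turns \<open>cinner f g\<close> into its
  modulus.\<close>

lemma norm_cinner_le: "cmod (cinner f g) \<le> norm f * norm g"
proof -
  define u where "u = (if cinner f g = 0 then 1 else cnj (cinner f g) / cmod (cinner f g))"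
  have u: "cmod u = 1" by (simp add: u_def norm_divide)
  have "u * cinner f g = of_real (cmod (cinner f g))"
    using complex_norm_square[of "cinner f g"]
    by (simp add: u_def field_simps power2_eq_square)
  then have "cmod (cinner f g) = inner f (u *\<^sub>C g)"
    by (simp add: inner_L2_def)
  also have "\<dots> \<le> norm f * norm (u *\<^sub>C g)" by (rule norm_cauchy_schwarz)
  finally show ?thesis by (simp add: u)
qed

lemma bounded_linear_cinner_right: "bounded_linear (cinner f)"
  by (rule bounded_linear_intro[where K = "norm f"])
     (use norm_cinner_le[of f] in \<open>simp_all add: cinner_add_right scaleR_conv_of_real mult.commute\<close>)

lemma bounded_linear_cinner_left: "bounded_linear (\<lambda>f. cinner f g)"
  by (rule bounded_linear_intro[where K = "norm g"])
     (simp_all add: cinner_add_left scaleR_conv_of_real norm_cinner_le)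

lemma bounded_linear_scaleC_right: "bounded_linear (\<lambda>f. c *\<^sub>C f)"
  by (rule bounded_linear_intro[where K = "cmod c"])
     (simp_all add: scaleC_add_right scaleR_scaleC_commute)

lemma cinner_cong_all: "(\<And>h. cinner h f = cinner h g) \<Longrightarrow> f = g"
proof -
  assume "\<And>h. cinner h f = cinner h g"
  then have "cinner (f - g) (f - g) = 0" by (simp add: cinner_diff_right)
  then show "f = g" by (simp add: cinner_self)
qed

lemma norm_to_L2:
  assumes "square_integrable f"
  shows "(norm (to_L2 f))\<^sup>2 = (\<integral>x. (cmod (f x))\<^sup>2 \<partial>lborel)"
proof -
  have "complex_of_real ((norm (to_L2 f))\<^sup>2) = (\<integral>x. cnj (f x) * f x \<partial>lborel)"
    unfolding cinner_self[symmetric] by (rule cinner_to_L2[OF assms assms])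
  also have "\<dots> = (\<integral>x. complex_of_real ((cmod (f x))\<^sup>2) \<partial>lborel)"
    by (metis complex_norm_square mult.commute)
  also have "\<dots> = of_real (\<integral>x. (cmod (f x))\<^sup>2 \<partial>lborel)"
    by (rule integral_complex_of_real)
  finally show ?thesis using of_real_eq_iff by blast
qed

lemma nn_integral_square_integrable:
  assumes "square_integrable f"
  shows "(\<integral>\<^sup>+x. ennreal ((cmod (f x))\<^sup>2) \<partial>lborel) = ennreal ((norm (to_L2 f))\<^sup>2)"
  unfolding norm_to_L2[OF assms]
  by (rule nn_integral_eq_integral) (use assms in \<open>auto simp: square_integrable_def\<close>)

lemma square_integrableI_nn:
  assumes "f \<in> borel_measurable lborel" "(\<integral>\<^sup>+x. ennreal ((cmod (f x))\<^sup>2) \<partial>lborel) < \<infinity>"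
  shows "square_integrable f"
  unfolding square_integrable_def using assms by (auto intro!: integrableI_nonneg)

lemma square_integrable_diff:
  assumes "square_integrable f" "square_integrable g"
  shows "square_integrable (\<lambda>x. f x - g x)"
  using square_integrable_add[OF assms(1) square_integrable_cmult[OF assms(2), of "-1"]] by simp

lemma minus_to_L2:
  assumes "square_integrable f" "square_integrable g"
  shows "to_L2 f - to_L2 g = to_L2 (\<lambda>x. f x - g x)"
  using plus_to_L2[OF assms(1) square_integrable_cmult[OF assms(2), of "-1"]] assms
  by (simp add: minus_L2_def scaleC_to_L2)

section \<open>Completeness of the space of square integrable functions\<close>

text \<open>Pointwise convergence is extracted from the weighted sum \<open>G\<close>. The squared
  increments have integrals at most \<open>(1/4)^n\<close>, so the weight \<open>2^n\<close> still
  leaves a summable series; working with squares throughout avoids the triangle inequality for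
  infinite sums of norms.\<close>

lemma L2_convergent_of_geometric:
  fixes X :: "nat \<Rightarrow> 'a::euclidean_space L2"
  assumes X: "\<And>m n. n \<le> m \<Longrightarrow> norm (X m - X n) \<le> (1/2)^n"
  shows "convergent X"
proof -
  obtain f where f: "\<And>n. square_integrable (f n)" and Xf: "\<And>n. X n = to_L2 (f n)"
  proof -
    have "\<forall>n. \<exists>f. square_integrable f \<and> X n = to_L2 f"
      using L2_cases by blast
    then show ?thesis using that by metis
  qed
  have [measurable]: "f n \<in> borel_measurable lborel" for n
    using f by (auto simp: square_integrable_def)
  have nrm: "(\<integral>\<^sup>+x. ennreal ((cmod (f m x - f n x))\<^sup>2) \<partial>lborel) \<le> ennreal ((1/4)^n)" if "n \<le> m" for m n
  proof -
    have "(norm (X m - X n))\<^sup>2 \<le> ((1/2)^n)\<^sup>2"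
      using X[OF that] by (intro power_mono) auto
    also have "((1/2::real)^n)\<^sup>2 = (1/4)^n"
      by (simp add: power_mult[symmetric] mult.commute power2_eq_square flip: power_mult_distrib)
    finally show ?thesis
      using nn_integral_square_integrable[OF square_integrable_diff[OF f f], of m n]
      by (simp add: Xf minus_to_L2 f ennreal_leI)
  qed
  define G where "G n x = ennreal (2^n * (cmod (f (Suc n) x - f n x))\<^sup>2)" for n x
  have [measurable]: "G n \<in> borel_measurable lborel" for n
    unfolding G_def by measurable
  have "(\<integral>\<^sup>+x. (\<Sum>n. G n x) \<partial>lborel) = (\<Sum>n. \<integral>\<^sup>+x. G n x \<partial>lborel)"
    by (rule nn_integral_suminf) measurable
  also have "\<dots> \<le> (\<Sum>n. ennreal ((1/2)^n))"
  proof (intro suminf_le)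
    fix n
    have "(\<integral>\<^sup>+x. G n x \<partial>lborel) = ennreal (2^n) * (\<integral>\<^sup>+x. ennreal ((cmod (f (Suc n) x - f n x))\<^sup>2) \<partial>lborel)"
      unfolding G_def by (simp add: ennreal_mult nn_integral_cmult)
    also have "\<dots> \<le> ennreal (2^n) * ennreal ((1/4)^n)"
      by (intro mult_left_mono nrm) auto
    also have "\<dots> = ennreal ((1/2)^n)"
      by (simp add: ennreal_mult[symmetric] power_mult_distrib[symmetric])
    finally show "(\<integral>\<^sup>+x. G n x \<partial>lborel) \<le> ennreal ((1/2)^n)" .
  qed auto
  also have "\<dots> = ennreal (\<Sum>n. (1/2)^n)"
    by (intro suminf_ennreal2) (auto intro: summable_geometric)
  also have "\<dots> < \<infinity>"
    by simp
  finally have fin: "(\<integral>\<^sup>+x. (\<Sum>n. G n x) \<partial>lborel) \<noteq> \<infinity>"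
    by (rule less_imp_neq)
  have "AE x in lborel. (\<Sum>n. G n x) \<noteq> \<infinity>"
    by (intro nn_integral_PInf_AE fin) measurable
  then have conv: "AE x in lborel. convergent (\<lambda>n. f n x)"
  proof eventually_elim
    case (elim x)
    then have s: "summable (\<lambda>n. 2^n * (cmod (f (Suc n) x - f n x))\<^sup>2)"
      unfolding G_def by (intro summable_suminf_not_top) auto
    then obtain K where K: "\<And>n. norm (2^n * (cmod (f (Suc n) x - f n x))\<^sup>2) \<le> K"
      using BseqE[OF summable_imp_Bseq[OF s]] by blast
    \<comment> \<open>The terms of a convergent series are bounded, so the weight \<open>2^n\<close>
      forces the increments to decay geometrically with ratio \<open>1 / sqrt 2\<close>.\<close>
    have "cmod (f (Suc n) x - f n x) \<le> sqrt K * (1 / sqrt 2)^n" for n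
    proof -
      have "(cmod (f (Suc n) x - f n x))\<^sup>2 \<le> K * (1/2)^n"
        using K[of n] by (simp add: field_simps)
      then have "cmod (f (Suc n) x - f n x) \<le> sqrt (K * (1/2)^n)"
        by (simp add: real_le_rsqrt)
      then show ?thesis by (simp add: real_sqrt_mult real_sqrt_power real_sqrt_divide)
    qed
    then have "summable (\<lambda>n. f (Suc n) x - f n x)"
      by (intro summable_comparison_test[OF _ summable_mult[OF summable_geometric[of "1 / sqrt 2"]]])
         auto
    then have "convergent (\<lambda>n. \<Sum>i<n. f (Suc i) x - f i x)"
      by (simp add: summable_iff_convergent)
    then have "convergent (\<lambda>n. f n x - f 0 x)"
      using sum_lessThan_telescope[of "\<lambda>n. f n x"] by simp
    then show ?case
      using convergent_add[OF _ convergent_const[of "f 0 x"], of "\<lambda>n. f n x - f 0 x"] by simp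
  qed
  define g where "g x = lim (\<lambda>n. f n x)" for x
  have [measurable]: "g \<in> borel_measurable lborel"
    unfolding g_def by measurable
  have lim: "AE x in lborel. (\<lambda>n. f n x) \<longlonglongrightarrow> g x"
    using conv unfolding g_def by eventually_elim (simp add: convergent_LIMSEQ_iff)
  \<comment> \<open>Fatou's lemma with \<open>n\<close> fixed and \<open>m\<close> tending to
    infinity. The case \<open>n = 0\<close> makes \<open>g\<close> square integrable, the general
    case gives the rate of convergence.\<close>
  have est: "(\<integral>\<^sup>+x. ennreal ((cmod (g x - f n x))\<^sup>2) \<partial>lborel) \<le> ennreal ((1/4)^n)" for n
  proof -
    have "(\<integral>\<^sup>+x. ennreal ((cmod (g x - f n x))\<^sup>2) \<partial>lborel)
        = (\<integral>\<^sup>+x. liminf (\<lambda>m. ennreal ((cmod (f m x - f n x))\<^sup>2)) \<partial>lborel)"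
    proof (rule nn_integral_cong_AE, use lim in eventually_elim)
      fix x assume "(\<lambda>m. f m x) \<longlonglongrightarrow> g x"
      then have "(\<lambda>m. ennreal ((cmod (f m x - f n x))\<^sup>2)) \<longlonglongrightarrow> ennreal ((cmod (g x - f n x))\<^sup>2)"
        by (intro tendsto_ennrealI tendsto_intros)
      then show "ennreal ((cmod (g x - f n x))\<^sup>2) = liminf (\<lambda>m. ennreal ((cmod (f m x - f n x))\<^sup>2))"
        by (rule lim_imp_Liminf[OF sequentially_bot, symmetric])
    qed
    also have "\<dots> \<le> liminf (\<lambda>m. \<integral>\<^sup>+x. ennreal ((cmod (f m x - f n x))\<^sup>2) \<partial>lborel)"
      by (intro nn_integral_liminf) measurable
    also have "\<dots> \<le> ennreal ((1/4)^n)"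
      by (intro Liminf_le) (auto intro!: eventually_mono[OF eventually_ge_at_top[of n]] nrm)
    finally show ?thesis .
  qed
  have sqd: "square_integrable (\<lambda>x. g x - f n x)" for n
    using est[of n] by (intro square_integrableI_nn) (auto simp: le_less_trans)
  have sqg: "square_integrable g"
    using square_integrable_add[OF sqd[of 0] f[of 0]] by simp
  have "norm (X n - to_L2 g) \<le> (1/2)^n" for n
  proof -
    have "ennreal ((norm (to_L2 g - X n))\<^sup>2) \<le> ennreal ((1/4)^n)"
      using est[of n] nn_integral_square_integrable[OF sqd[of n]] by (simp add: Xf minus_to_L2 sqg f)
    then have "(norm (to_L2 g - X n))\<^sup>2 \<le> ((1/2)^n)\<^sup>2"
      by (simp add: power_mult[symmetric] mult.commute power2_eq_square flip: power_mult_distrib)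
    then show ?thesis
      using power2_le_imp_le[of "norm (to_L2 g - X n)" "(1/2)^n"] by (simp add: norm_minus_commute)
  qed
  then have "(\<lambda>n. X n - to_L2 g) \<longlonglongrightarrow> 0"
    by (intro Lim_null_comparison[OF always_eventually LIMSEQ_realpow_zero]) auto
  then show ?thesis
    by (metis LIM_zero_iff convergentI)
qed

text \<open>A Cauchy sequence converges as soon as a subsequence does, and the subsequence
  \<open>r\<close> is sparse enough to have geometrically small increments.\<close>

instance L2 :: (euclidean_space) banach
proof
  fix X :: "nat \<Rightarrow> 'a L2"
  assume X: "Cauchy X"
  have "\<forall>n. \<exists>M. \<forall>i\<ge>M. \<forall>j\<ge>M. norm (X i - X j) < (1/2)^n"
    using X by (auto simp: Cauchy_iff)
  then obtain M where M: "\<And>n i j. i \<ge> M n \<Longrightarrow> j \<ge> M n \<Longrightarrow> norm (X i - X j) < (1/2)^n"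
    by metis
  \<comment> \<open>Partial sums of \<open>Suc (M k)\<close> make \<open>r\<close> strictly
    increasing and keep \<open>r n\<close> above \<open>M n\<close>.\<close>
  define r where "r n = (\<Sum>k\<le>n. Suc (M k))" for n
  have r: "strict_mono r"
    unfolding strict_mono_Suc_iff by (simp add: r_def)
  have rM: "r n \<ge> M n" for n
    unfolding r_def by (rule order_trans[OF _ member_le_sum[of n]]) auto
  have "convergent (X \<circ> r)"
  proof (rule L2_convergent_of_geometric)
    fix m n :: nat assume "n \<le> m"
    then have "r m \<ge> M n"
      using rM[of n] strict_mono_less_eq[OF r, of n m] by linarith
    then show "norm ((X \<circ> r) m - (X \<circ> r) n) \<le> (1/2)^n"
      using M[of n "r m" "r n"] rM by (simp add: less_imp_le)
  qed
  then show "convergent X"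
    using Cauchy_converges_subseq[OF X r] unfolding convergent_def by blast
qed

section \<open>Orthonormal bases\<close>

lemma bounded_bilinear_cinner: "bounded_bilinear cinner"
proof (rule bounded_bilinear.intro)
  show "\<exists>K. \<forall>a b. norm (cinner a b) \<le> norm a * norm b * K"
    by (rule exI[of _ 1]) (simp add: norm_cinner_le)
qed (simp_all add: cinner_add_left cinner_add_right scaleR_conv_of_real)

lemmas tendsto_cinner = bounded_bilinear.tendsto[OF bounded_bilinear_cinner]

text \<open>Cauchy criterion for the net of finite subsets. The hypothesis bounds norms of finite
  sums and not of single terms, because an orthogonal series is in general square summable without
  being absolutely summable.\<close>

lemma summable_on_of_norm_bound:
  fixes \<tau> :: "'i \<Rightarrow> 'b::banach" and w :: "'i \<Rightarrow> real"
  assumes bound: "\<And>F. finite F \<Longrightarrow> F \<subseteq> A \<Longrightarrow> (norm (sum \<tau> F))\<^sup>2 \<le> K * sum w F"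
    and w: "w summable_on A" "\<And>i. i \<in> A \<Longrightarrow> 0 \<le> w i" and K: "0 < K"
  shows "\<tau> summable_on A"
proof -
  have "\<exists>P. eventually P (finite_subsets_at_top A) \<and>
          (\<forall>F F'. P F \<and> P F' \<longrightarrow> dist (sum \<tau> F) (sum \<tau> F') < e)" if e: "e > 0" for e
  proof -
    \<comment> \<open>Chosen so that \<open>K * \<delta> = (e/4)\<^sup>2\<close>; two finite sums
      beyond \<open>F0\<close> then differ by at most \<open>e/2\<close>.\<close>
    define \<delta> where "\<delta> = (e/4)\<^sup>2 / K"
    have \<delta>: "\<delta> > 0" using e K by (simp add: \<delta>_def)
    obtain F0 where F0: "finite F0" "F0 \<subseteq> A" "dist (sum w F0) (infsum w A) \<le> \<delta>"
      using infsum_finite_approximation[OF w(1) \<delta>] by blast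
    have tail: "norm (sum \<tau> F - sum \<tau> F0) \<le> e/4" if F: "finite F" "F \<subseteq> A" "F0 \<subseteq> F" for F
    proof -
      have "sum w F \<le> infsum w A"
        using F w by (intro finite_sum_le_infsum) auto
      then have "sum w (F - F0) \<le> \<delta>"
        using F F0 by (simp add: sum_diff dist_real_def)
      moreover have "(norm (sum \<tau> (F - F0)))\<^sup>2 \<le> K * sum w (F - F0)"
        using F by (intro bound) auto
      ultimately have "(norm (sum \<tau> (F - F0)))\<^sup>2 \<le> K * \<delta>"
        using K by (meson mult_left_mono order_trans less_imp_le)
      also have "K * \<delta> = (e/4)\<^sup>2" using K by (simp add: \<delta>_def)
      finally show ?thesis
        using F e power2_le_imp_le[of _ "e/4"] by (simp add: sum_diff)
    qed
    have "dist (sum \<tau> F) (sum \<tau> F') < e"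
      if "finite F" "F \<subseteq> A" "F0 \<subseteq> F" "finite F'" "F' \<subseteq> A" "F0 \<subseteq> F'" for F F'
    proof -
      have "dist (sum \<tau> F) (sum \<tau> F') \<le> dist (sum \<tau> F) (sum \<tau> F0) + dist (sum \<tau> F') (sum \<tau> F0)"
        by (rule dist_triangle2)
      also have "\<dots> \<le> e/4 + e/4"
        unfolding dist_norm using that by (intro add_mono tail)
      finally show ?thesis using e by simp
    qed
    moreover have "eventually (\<lambda>F. finite F \<and> F \<subseteq> A \<and> F0 \<subseteq> F) (finite_subsets_at_top A)"
      using F0 unfolding eventually_finite_subsets_at_top by auto
    ultimately show ?thesis by (intro exI[of _ "\<lambda>F. finite F \<and> F \<subseteq> A \<and> F0 \<subseteq> F"]) blast
  qed
  then have "cauchy_filter (filtermap (sum \<tau>) (finite_subsets_at_top A))"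
    by (simp add: cauchy_filter_metric_filtermap)
  moreover have "Topological_Spaces.complete (UNIV::'b set)"
    by (meson Cauchy_convergent UNIV_I complete_def convergent_def)
  ultimately obtain L' where "(sum \<tau> \<longlongrightarrow> L') (finite_subsets_at_top A)"
    using complete_uniform[where S=UNIV] by (force simp add: filterlim_def)
  then show ?thesis
    using summable_on_def has_sum_def by blast
qed

lemma norm_sum_pythagoras:
  assumes "finite F" "\<And>i j. i \<in> F \<Longrightarrow> j \<in> F \<Longrightarrow> i \<noteq> j \<Longrightarrow> cinner (v i) (v j) = 0"
  shows "(norm (sum v F))\<^sup>2 = (\<Sum>i\<in>F. (norm (v i))\<^sup>2)"
proof -
  have "cinner (sum v F) (sum v F) = (\<Sum>i\<in>F. \<Sum>j\<in>F. cinner (v i) (v j))"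
    unfolding cinner_sum_left unfolding cinner_sum_right ..
  also have "\<dots> = (\<Sum>i\<in>F. \<Sum>j\<in>F. if i = j then cinner (v i) (v i) else 0)"
    using assms(2) by (intro sum.cong) auto
  also have "\<dots> = (\<Sum>i\<in>F. cinner (v i) (v i))"
    using assms(1) by simp
  finally have "complex_of_real ((norm (sum v F))\<^sup>2) = of_real (\<Sum>i\<in>F. (norm (v i))\<^sup>2)"
    by (simp add: cinner_self)
  then show ?thesis by (simp only: of_real_eq_iff)
qed

lemma orthonormal_norm: "orthonormal B \<Longrightarrow> e \<in> B \<Longrightarrow> norm e = 1"
proof -
  assume "orthonormal B" "e \<in> B"
  then have "complex_of_real ((norm e)\<^sup>2) = 1"
    unfolding cinner_self[symmetric] by (simp add: orthonormal_def)
  then have "(norm e)\<^sup>2 = 1" by (metis of_real_1 of_real_eq_iff)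
  then show ?thesis using norm_ge_zero[of e] by (auto simp: power2_eq_1_iff)
qed

lemma orthonormal_norm_sum:
  assumes "orthonormal B" "finite F" "F \<subseteq> B"
  shows "(norm (\<Sum>e\<in>F. c e *\<^sub>C e))\<^sup>2 = (\<Sum>e\<in>F. (cmod (c e))\<^sup>2)"
proof -
  have "(norm (\<Sum>e\<in>F. c e *\<^sub>C e))\<^sup>2 = (\<Sum>e\<in>F. (norm (c e *\<^sub>C e))\<^sup>2)"
    using assms by (intro norm_sum_pythagoras) (auto simp: orthonormal_def subset_iff)
  also have "\<dots> = (\<Sum>e\<in>F. (cmod (c e))\<^sup>2)"
    using assms by (intro sum.cong) (auto simp: orthonormal_norm subset_iff)
  finally show ?thesis .
qed

lemma orthonormal_bessel:
  assumes "orthonormal B" "finite F" "F \<subseteq> B"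
  shows "(\<Sum>e\<in>F. (cmod (cinner e f))\<^sup>2) \<le> (norm f)\<^sup>2"
proof -
  define s where "s = (\<Sum>e\<in>F. cinner e f *\<^sub>C e)"
  have "cinner s (f - s) = 0"
  proof -
    have "cinner e s = cinner e f" if "e \<in> F" for e
    proof -
      have "cinner e s = (\<Sum>e'\<in>F. cinner e' f * cinner e e')"
        by (simp add: s_def cinner_sum_right)
      also have "\<dots> = (\<Sum>e'\<in>F. if e = e' then cinner e' f else 0)"
        using assms that by (intro sum.cong) (auto simp: orthonormal_def subset_iff)
      finally show ?thesis using assms that by simp
    qed
    moreover have "cinner s g = (\<Sum>e\<in>F. cnj (cinner e f) * cinner e g)" for g
      by (simp add: s_def cinner_sum_left)
    ultimately show ?thesis by (simp add: cinner_diff_right)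
  qed
  then have sf: "cinner s f = cinner s s" by (simp add: cinner_diff_right)
  have fs: "cinner f s = cinner s s"
    using sf cinner_commute[of f s] cinner_commute[of s s] by simp
  have "cinner (f - s) (f - s) = cinner f f - cinner s s"
    by (simp add: cinner_diff_right cinner_diff_left sf fs)
  then have "(norm s)\<^sup>2 + (norm (f - s))\<^sup>2 = (norm f)\<^sup>2"
    unfolding cinner_self of_real_diff[symmetric] of_real_eq_iff by simp
  moreover have "(norm s)\<^sup>2 = (\<Sum>e\<in>F. (cmod (cinner e f))\<^sup>2)"
    unfolding s_def by (rule orthonormal_norm_sum[OF assms])
  ultimately show ?thesis using zero_le_power2[of "norm (f - s)"] by linarith
qed

lemma orthonormal_summable:
  assumes "orthonormal B"
  shows "(\<lambda>e. (cmod (cinner e f))\<^sup>2) summable_on B"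
  by (rule nonneg_bdd_above_summable_on)
     (auto intro!: bdd_aboveI[of _ "(norm f)\<^sup>2"] orthonormal_bessel[OF assms])

text \<open>Bessel's inequality makes the series converge to some \<open>s\<close>. As
  \<open>f - s\<close> is orthogonal to every basis vector, completeness, which here means a trivial
  orthogonal complement, gives \<open>f = s\<close>.\<close>

lemma onb_expansion:
  assumes "orthonormal_basis B"
  shows "((\<lambda>e. cinner e f *\<^sub>C e) has_sum f) B"
proof -
  have on: "orthonormal B" using assms by (simp add: orthonormal_basis_def)
  have "(\<lambda>e. cinner e f *\<^sub>C e) summable_on B"
    by (rule summable_on_of_norm_bound[where K = 1 and w = "\<lambda>e. (cmod (cinner e f))\<^sup>2"])
       (auto simp: orthonormal_norm_sum[OF on] orthonormal_summable[OF on])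
  then obtain s where s: "((\<lambda>e. cinner e f *\<^sub>C e) has_sum s) B"
    by (auto simp: summable_on_def)
  have "cinner e (f - s) = 0" if e: "e \<in> B" for e
  proof -
    have "((\<lambda>e'. cinner e (cinner e' f *\<^sub>C e')) has_sum cinner e s) B"
      by (rule has_sum_bounded_linear[OF bounded_linear_cinner_right s])
    moreover have "((\<lambda>e'. cinner e (cinner e' f *\<^sub>C e')) has_sum cinner e f) B"
      by (rule has_sum_finite_neutralI[of "{e}"]) (use on e in \<open>auto simp: orthonormal_def\<close>)
    ultimately show ?thesis
      by (simp add: cinner_diff_right has_sum_unique)
  qed
  then have "f - s = 0" using assms unfolding orthonormal_basis_def by blast
  then have "f = s" by simp
  with s show ?thesis by simp
qed

lemma onb_parseval:
  assumes "orthonormal_basis B"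
  shows "((\<lambda>e. cinner e f * cinner g e) has_sum cinner g f) B"
  using has_sum_bounded_linear[OF bounded_linear_cinner_right[of g] onb_expansion[OF assms, of f]]
  by simp

lemma has_sum_sum_finite:
  fixes f :: "'i \<Rightarrow> 'j \<Rightarrow> 'b::{topological_comm_monoid_add}"
  assumes "finite I" "\<And>i. i \<in> I \<Longrightarrow> (f i has_sum s i) A"
  shows "((\<lambda>j. \<Sum>i\<in>I. f i j) has_sum (\<Sum>i\<in>I. s i)) A"
  using assms by (induction I rule: finite_induct) (auto intro!: has_sum_add)

lemma onb_eqI:
  assumes B: "orthonormal_basis B"
    and T: "bounded_linear T" "\<And>c f. T (c *\<^sub>C f) = c *\<^sub>C T f"
    and T': "bounded_linear T'" "\<And>c f. T' (c *\<^sub>C f) = c *\<^sub>C T' f"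
    and eq: "\<And>e. e \<in> B \<Longrightarrow> T e = T' e"
  shows "T f = T' f"
proof -
  have "((\<lambda>e. cinner e f *\<^sub>C T e) has_sum T f) B"
    using has_sum_bounded_linear[OF T(1) onb_expansion[OF B, of f]] by (simp add: T(2))
  moreover have "((\<lambda>e. cinner e f *\<^sub>C T e) has_sum T' f) B"
    using has_sum_bounded_linear[OF T'(1) onb_expansion[OF B, of f]]
    by (subst has_sum_cong[where g = "\<lambda>e. cinner e f *\<^sub>C T' e"]) (auto simp: eq T'(2))
  ultimately show ?thesis by (rule has_sum_unique)
qed

text \<open>Source of all operators that are given only by their values on a basis. The bound on
  finite sums yields both the convergence of the coordinate series and the boundedness of
  \<open>T\<close>; domain and codomain may differ, as the flip of tensor factors requires.\<close>

lemma onb_extend: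
  fixes \<tau> :: "'a::euclidean_space L2 \<Rightarrow> 'b::euclidean_space L2"
  assumes B: "orthonormal_basis B" and K: "K > 0"
    and bound: "\<And>F c. finite F \<Longrightarrow> F \<subseteq> B \<Longrightarrow>
      (norm (\<Sum>e\<in>F. c e *\<^sub>C \<tau> e))\<^sup>2 \<le> K * (\<Sum>e\<in>F. (cmod (c e))\<^sup>2)"
  shows "\<exists>T. bounded_linear T \<and> (\<forall>c f. T (c *\<^sub>C f) = c *\<^sub>C T f) \<and> (\<forall>e\<in>B. T e = \<tau> e)"
proof -
  have on: "orthonormal B" using B by (simp add: orthonormal_basis_def)
  define T where "T f = infsum (\<lambda>e. cinner e f *\<^sub>C \<tau> e) B" for f
  have T: "((\<lambda>e. cinner e f *\<^sub>C \<tau> e) has_sum T f) B" for f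
    unfolding T_def
    by (rule has_sum_infsum,
        rule summable_on_of_norm_bound[where K = K and w = "\<lambda>e. (cmod (cinner e f))\<^sup>2"])
       (auto simp: bound orthonormal_summable[OF on] K)
  have add: "T (f + g) = T f + T g" for f g
    using has_sum_add[OF T[of f] T[of g]]
    by (intro has_sum_unique[OF T]) (simp add: cinner_add_right scaleC_add_left)
  have scale: "T (c *\<^sub>C f) = c *\<^sub>C T f" for c f
    using has_sum_bounded_linear[OF bounded_linear_scaleC_right[of c] T[of f]]
    by (intro has_sum_unique[OF T]) simp
  have nrm: "norm (T f) \<le> norm f * sqrt K" for f
  proof -
    have "((\<lambda>F. (norm (\<Sum>e\<in>F. cinner e f *\<^sub>C \<tau> e))\<^sup>2) \<longlongrightarrow> (norm (T f))\<^sup>2) (finite_subsets_at_top B)"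
      using T[of f] unfolding has_sum_def by (intro tendsto_intros)
    moreover have "\<forall>\<^sub>F F in finite_subsets_at_top B.
        (norm (\<Sum>e\<in>F. cinner e f *\<^sub>C \<tau> e))\<^sup>2 \<le> K * (norm f)\<^sup>2"
    proof (rule eventually_finite_subsets_at_top_weakI)
      fix F assume F: "finite F" "F \<subseteq> B"
      show "(norm (\<Sum>e\<in>F. cinner e f *\<^sub>C \<tau> e))\<^sup>2 \<le> K * (norm f)\<^sup>2"
        by (rule order_trans[OF bound[OF F] mult_left_mono[OF orthonormal_bessel[OF on F]]])
           (use K in simp)
    qed
    ultimately have "(norm (T f))\<^sup>2 \<le> K * (norm f)\<^sup>2"
      by (rule tendsto_upperbound) simp
    also have "\<dots> = (norm f * sqrt K)\<^sup>2"
      using K by (simp add: power_mult_distrib)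
    finally show ?thesis by (rule power2_le_imp_le) (use K in simp)
  qed
  have "bounded_linear T"
    by (rule bounded_linear_intro[where K = "sqrt K"]) (simp_all add: add scale nrm scaleR_scaleC)
  moreover have "T e = \<tau> e" if e: "e \<in> B" for e
  proof -
    have *: "cinner e' e = (if e' = e then 1 else 0)" if "e' \<in> B" for e'
      using on[unfolded orthonormal_def, rule_format, OF that e] .
    have "((\<lambda>e'. cinner e' e *\<^sub>C \<tau> e') has_sum \<tau> e) B"
      by (rule has_sum_finite_neutralI[of "{e}"]) (use e in \<open>simp_all add: *\<close>)
    with T[of e] show ?thesis by (rule has_sum_unique)
  qed
  ultimately show ?thesis using scale by (intro exI[of _ T]) simp
qed

section \<open>The trace\<close>

text \<open>Each rank-one term is summed by Parseval's identity, which holds in whichever basis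
  \<open>SOME\<close> selects, so the value is independent of that choice.\<close>

lemma op_trace_finite_rank:
  fixes u v :: "'i \<Rightarrow> 'a::euclidean_space L2"
  assumes B: "\<exists>B::'a L2 set. orthonormal_basis B" and I: "finite I"
    and T: "\<And>f. T f = (\<Sum>i\<in>I. cinner (v i) f *\<^sub>C u i)"
  shows "op_trace T = (\<Sum>i\<in>I. cinner (v i) (u i))"
proof -
  have "((\<lambda>e. \<Sum>i\<in>I. cinner e (u i) * cinner (v i) e) has_sum (\<Sum>i\<in>I. cinner (v i) (u i)))
      (SOME B. orthonormal_basis B)"
    by (intro has_sum_sum_finite I onb_parseval someI_ex[OF B])
  then show ?thesis
    unfolding op_trace_def by (intro infsumI) (simp add: T cinner_sum_right mult.commute)
qed

lemma bounded_op_simps: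
  assumes "bounded_op T"
  shows "T (f + g) = T f + T g" "T (c *\<^sub>C f) = c *\<^sub>C T f" "T (f - g) = T f - T g"
    "T (sum h A) = (\<Sum>i\<in>A. T (h i))" "T 0 = 0" "T (r *\<^sub>R f) = r *\<^sub>R T f"
proof -
  interpret bounded_linear T using assms by (simp add: bounded_op_def)
  show "T (f + g) = T f + T g" "T (f - g) = T f - T g" "T (sum h A) = (\<Sum>i\<in>A. T (h i))" "T 0 = 0"
    "T (r *\<^sub>R f) = r *\<^sub>R T f"
    by (simp_all add: add diff sum zero scaleR)
  show "T (c *\<^sub>C f) = c *\<^sub>C T f" using assms by (simp add: bounded_op_def)
qed

lemma bounded_op_intros:
  assumes "bounded_op S" "bounded_op T"
  shows "bounded_op (S \<circ> T)" "bounded_op (\<lambda>f. S f + T f)" "bounded_op (\<lambda>f. S f - T f)"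
    "bounded_op (\<lambda>f. r *\<^sub>R S f)" "bounded_op id"
  using assms unfolding bounded_op_def
  by (auto simp: o_def id_def scaleC_add_right scaleC_diff_right scaleR_scaleC_commute
      intro: bounded_linear_compose bounded_linear_add bounded_linear_sub
        bounded_linear_scaleR_right[THEN bounded_linear_compose] bounded_linear_ident)

lemma bounded_op_rank_one: "bounded_op (\<lambda>f. cinner v f *\<^sub>C u)"
  unfolding bounded_op_def
proof
  show "bounded_linear (\<lambda>f. cinner v f *\<^sub>C u)"
    by (rule bounded_linear_intro[where K = "norm v * norm u"])
       (use mult_right_mono[OF norm_cinner_le norm_ge_zero, of v _ u] in
         \<open>auto simp: cinner_add_right scaleC_add_left scaleR_scaleC mult_ac\<close>)
qed simp

lemma bounded_op_sum:
  "(\<And>i. i \<in> I \<Longrightarrow> bounded_op (T i)) \<Longrightarrow> bounded_op (\<lambda>f. \<Sum>i\<in>I. T i f)"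
  unfolding bounded_op_def
  by (auto simp: scaleC_sum_right intro!: bounded_linear_sum)

text \<open>
  The compressions of \<open>T\<close> to finitely many vectors of \<open>B\<close> have finite rank, so their traces in \<open>B'\<close>
  are computed by Parseval's identity; no square root of \<open>T\<close> is needed.
\<close>

lemma trace_le:
  assumes T: "bounded_op T" and pos: "\<And>f. 0 \<le> Re (cinner f (T f))"
    and B: "orthonormal_basis B" and B': "orthonormal_basis B'"
    and sm: "(\<lambda>e. Re (cinner e (T e))) summable_on B"
    and F: "finite F" "F \<subseteq> B'"
  shows "(\<Sum>f\<in>F. Re (cinner f (T f))) \<le> infsum (\<lambda>e. Re (cinner e (T e))) B"
proof -
  have lin: "bounded_linear T" using T by (simp add: bounded_op_def)
  have on: "orthonormal B" using B by (simp add: orthonormal_basis_def)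
  define P where "P E f = (\<Sum>e\<in>E. cinner e f *\<^sub>C e)" for E and f :: "'a L2"
  have comp: "(\<Sum>f\<in>F. Re (cinner (P E f) (T (P E f)))) \<le> infsum (\<lambda>e. Re (cinner e (T e))) B"
    if E: "finite E" "E \<subseteq> B" for E
  proof -
    have eq: "cinner (P E f) (T (P E f)) =
        (\<Sum>e\<in>E. \<Sum>e'\<in>E. cinner e (T e') * (cinner f e * cinner e' f))" for f
    proof -
      have "cinner (P E f) (T (P E f)) =
          (\<Sum>e\<in>E. cnj (cinner e f) * (\<Sum>e'\<in>E. cinner e' f * cinner e (T e')))"
        unfolding P_def bounded_op_simps[OF T] cinner_sum_left
        unfolding cinner_sum_right cinner_scaleC_left cinner_scaleC_right sum_distrib_left
        by (simp only: mult_ac)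
      then show ?thesis
        by (simp add: sum_distrib_left cinner_commute[of f] mult_ac)
    qed
    have "((\<lambda>f. cinner (P E f) (T (P E f))) has_sum
        (\<Sum>e\<in>E. \<Sum>e'\<in>E. cinner e (T e') * cinner e' e)) B'"
      unfolding eq by (intro has_sum_sum_finite E has_sum_cmult_right onb_parseval[OF B'])
    moreover have "(\<Sum>e\<in>E. \<Sum>e'\<in>E. cinner e (T e') * cinner e' e) = (\<Sum>e\<in>E. cinner e (T e))"
    proof (rule sum.cong[OF refl])
      fix e assume e: "e \<in> E"
      have "(\<Sum>e'\<in>E. cinner e (T e') * cinner e' e) = (\<Sum>e'\<in>E. if e' = e then cinner e (T e') else 0)"
        using on E e by (intro sum.cong) (auto simp: orthonormal_def subset_iff)
      then show "(\<Sum>e'\<in>E. cinner e (T e') * cinner e' e) = cinner e (T e)"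
        using E e by simp
    qed
    ultimately have "((\<lambda>f. Re (cinner (P E f) (T (P E f)))) has_sum (\<Sum>e\<in>E. Re (cinner e (T e)))) B'"
      using has_sum_Re by fastforce
    then have "(\<Sum>f\<in>F. Re (cinner (P E f) (T (P E f)))) \<le> (\<Sum>e\<in>E. Re (cinner e (T e)))"
      using pos F by (intro has_sum_mono2[OF has_sum_finite]) auto
    also have "\<dots> \<le> infsum (\<lambda>e. Re (cinner e (T e))) B"
      using E sm pos by (intro finite_sum_le_infsum) auto
    finally show ?thesis .
  qed
  \<comment> \<open>By the basis expansion the compressed vectors \<open>P E f\<close> return to
    \<open>f\<close>, and \<open>T\<close> is continuous; as \<open>F\<close> is finite, the limit
    passes through the sum.\<close>
  have "((\<lambda>E. \<Sum>f\<in>F. Re (cinner (P E f) (T (P E f)))) \<longlongrightarrow> (\<Sum>f\<in>F. Re (cinner f (T f))))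
      (finite_subsets_at_top B)"
  proof (intro tendsto_intros tendsto_cinner bounded_linear.tendsto[OF lin])
    show "((\<lambda>E. P E f) \<longlongrightarrow> f) (finite_subsets_at_top B)" for f
      using onb_expansion[OF B, of f] unfolding has_sum_def P_def by simp
    then show "((\<lambda>E. P E f) \<longlongrightarrow> f) (finite_subsets_at_top B)" for f .
  qed
  then show ?thesis
    by (rule tendsto_upperbound)
       (auto intro!: eventually_finite_subsets_at_top_weakI comp)
qed

section \<open>Nonnegative forms and projections of zero trace\<close>

text \<open>Positivity of the form at \<open>f - u *\<^sub>C g\<close>, where the phase
  \<open>u\<close> makes the cross term real and nonnegative. The additive version of Cauchy-Schwarz
  is the one that compares summable families directly.\<close>

lemma nonneg_form_bound:
  assumes T: "bounded_op T" and sym: "\<And>f g. cinner (T f) g = cinner f (T g)"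
    and pos: "\<And>f. 0 \<le> Re (cinner f (T f))"
  shows "2 * cmod (cinner f (T g)) \<le> Re (cinner f (T f)) + Re (cinner g (T g))"
proof -
  define u where "u = (if cinner f (T g) = 0 then 1 else cnj (cinner f (T g)) / cmod (cinner f (T g)))"
  have u: "cmod u = 1" by (simp add: u_def norm_divide)
  then have uu: "cnj u * u = 1"
    using complex_norm_square[of u] by (simp add: mult.commute)
  have ug: "u * cinner f (T g) = of_real (cmod (cinner f (T g)))"
    using complex_norm_square[of "cinner f (T g)"]
    by (simp add: u_def field_simps power2_eq_square)
  have gf: "cnj u * cinner g (T f) = cnj (u * cinner f (T g))"
    by (metis cinner_commute complex_cnj_mult sym)
  have "0 \<le> Re (cinner (f - u *\<^sub>C g) (T (f - u *\<^sub>C g)))" by (rule pos)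
  also have "cinner (f - u *\<^sub>C g) (T (f - u *\<^sub>C g)) =
      cinner f (T f) - u * cinner f (T g) - cnj u * cinner g (T f) + (cnj u * u) * cinner g (T g)"
    by (simp add: bounded_op_simps[OF T] cinner_diff_left cinner_diff_right algebra_simps)
  finally show ?thesis by (simp add: gf ug uu)
qed

text \<open>At \<open>t *\<^sub>R g\<close> with \<open>g = T f\<close> the form bound is linear in
  t on the left and quadratic on the right. Dividing by t and letting t tend to 0 gives
  \<open>norm g = 0\<close>, without a square root of \<open>T\<close>.\<close>

lemma nonneg_form_zero:
  assumes T: "bounded_op T" and sym: "\<And>f g. cinner (T f) g = cinner f (T g)"
    and pos: "\<And>f. 0 \<le> Re (cinner f (T f))" and 0: "Re (cinner f (T f)) = 0"
  shows "T f = 0"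
proof -
  define g where "g = T f"
  define c where "c = Re (cinner g (T g))"
  have *: "2 * (norm g)\<^sup>2 \<le> t * c" if t: "t > 0" for t
  proof -
    have "2 * cmod (cinner (t *\<^sub>R g) (T f)) \<le> t^2 * c"
      using nonneg_form_bound[OF T sym pos, of "t *\<^sub>R g" f]
      by (simp add: 0 bounded_op_simps[OF T] c_def power2_eq_square mult.assoc)
    then have "t * (2 * (norm g)\<^sup>2) \<le> t * (t * c)"
      using t by (simp add: g_def[symmetric] cinner_self norm_mult power2_eq_square mult_ac)
    then show ?thesis using t by simp
  qed
  have "((\<lambda>t. t * c) \<longlongrightarrow> 0 * c) (at_right 0)"
    by (intro tendsto_intros)
  then have "2 * (norm g)\<^sup>2 \<le> 0 * c"
    by (rule tendsto_lowerbound) (auto simp: eventually_at_filter intro!: always_eventually *)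
  then show ?thesis by (simp add: g_def)
qed

text \<open>
  With the unitary \<open>U = 1 - 2 M\<close> one has
  \<open>Re \<langle>M e, Q e\<rangle> = \<langle>M e, Q M e\<rangle> + (\<langle>e, Q e\<rangle> - \<langle>U e, Q U e\<rangle>) / 4\<close>, and the bracket sums to a
  nonnegative number by \<open>trace_le\<close>.
\<close>

lemma projection_trace_zero:
  assumes Q: "bounded_op Q" and sym: "\<And>f g. cinner (Q f) g = cinner f (Q g)"
    and pos: "\<And>f. 0 \<le> Re (cinner f (Q f))"
    and M: "bounded_op M" and symM: "\<And>f g. cinner (M f) g = cinner f (M g)"
    and idem: "\<And>f. M (M f) = M f"
    and B: "orthonormal_basis B" and sm: "(\<lambda>e. cinner e (Q e)) summable_on B"
    and zero: "infsum (\<lambda>e. cinner e (M (Q e))) B = 0"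
  shows "Q (M f) = 0"
proof -
  define q where "q f = Re (cinner f (Q f))" for f
  define U where "U f = f - 2 *\<^sub>R M f" for f
  have q0: "q f \<ge> 0" for f using pos by (simp add: q_def)
  have smq: "q summable_on B"
    unfolding q_def by (rule summable_on_Re[OF sm])
  have UU: "U (U f) = f" for f
    by (simp add: U_def bounded_op_simps[OF M] idem algebra_simps flip: scaleR_add_left)
  have symU: "cinner (U f) g = cinner f (U g)" for f g
    by (simp add: U_def cinner_diff_left cinner_diff_right symM)
  have UB: "orthonormal_basis (U ` B)"
    unfolding orthonormal_basis_def orthonormal_def
  proof safe
    fix e f assume "e \<in> B" "f \<in> B"
    moreover have "cinner (U e) (U f) = cinner e f" by (simp add: symU UU)
    moreover have "U e = U f \<longleftrightarrow> e = f" by (metis UU)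
    ultimately show "cinner (U e) (U f) = (if U e = U f then 1 else 0)"
      using B by (auto simp: orthonormal_basis_def orthonormal_def)
  next
    fix f assume "\<forall>e\<in>U ` B. cinner e f = 0"
    then have "\<forall>e\<in>B. cinner e (U f) = 0" by (simp add: symU)
    then have "U f = 0" using B by (auto simp: orthonormal_basis_def)
    then show "f = 0" by (metis UU U_def bounded_op_simps(5)[OF M] diff_zero scaleR_zero_right)
  qed
  have injU: "inj U" by (metis UU injI)
  have Uq: "(\<Sum>e\<in>F. q (U e)) \<le> infsum q B" if "finite F" "F \<subseteq> B" for F
    using trace_le[OF Q pos B UB smq[unfolded q_def], of "U ` F"] that injU
    by (simp add: q_def[abs_def] sum.reindex inj_on_def inj_def image_mono)
  have smU: "(\<lambda>e. q (U e)) summable_on B"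
    by (rule nonneg_bdd_above_summable_on) (auto simp: q0 intro!: bdd_aboveI[of _ "infsum q B"] Uq)
  have leU: "infsum (\<lambda>e. q (U e)) B \<le> infsum q B"
    by (rule infsum_le_finite_sums[OF smU Uq])
  have QM: "Re (cinner f (Q (M g))) = Re (cinner (M g) (Q f))" for f g
    by (metis cinner_commute complex_cnj(1) sym complex.sel(1) cnj.simps(1))
  have qU: "q (U e) = q e - 4 * Re (cinner (M e) (Q e)) + 4 * q (M e)" for e
    using QM[of e e]
    by (simp add: q_def U_def bounded_op_simps[OF Q] cinner_diff_left cinner_diff_right algebra_simps)
  \<comment> \<open>Since \<open>M e\<close> is half of \<open>e - U e\<close>, this is the
    parallelogram inequality for the form of \<open>Q\<close>; it transfers summability to
    \<open>q (M e)\<close>.\<close>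
  have par: "q (M e) \<le> q e + q (U e)" for e
    using nonneg_form_bound[OF Q sym pos, of "M e" e] complex_Re_le_cmod[of "cinner (M e) (Q e)"]
      qU[of e] q0[of "e - M e"] QM[of e e] q0[of e] q0[of "U e"]
    by (simp add: q_def bounded_op_simps[OF Q] cinner_diff_left cinner_diff_right)
  have smM: "(\<lambda>e. q (M e)) summable_on B"
    by (rule summable_on_comparison_test[OF summable_on_add[OF smq smU]]) (auto simp: par q0)
  \<comment> \<open>An \<open>infsum\<close> that diverges is 0 by convention, so the assumption
    \<open>zero\<close> carries information only after summability has been established.\<close>
  have "(\<lambda>e. cinner e (M (Q e))) summable_on B"
  proof (rule abs_summable_summable,
      rule summable_on_comparison_test[OF summable_on_add[OF smM smq]])
    fix e
    have "cmod (cinner e (M (Q e))) = cmod (cinner (M e) (Q e))" by (simp add: symM)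
    then show "cmod (cinner e (M (Q e))) \<le> q (M e) + q e"
      using nonneg_form_bound[OF Q sym pos, of "M e" e] norm_ge_zero[of "cinner (M e) (Q e)"]
      unfolding q_def by linarith
  qed auto
  then have "((\<lambda>e. Re (cinner e (M (Q e)))) has_sum 0) B"
    using has_sum_Re[OF has_sum_infsum] zero by fastforce
  moreover have "Re (cinner e (M (Q e))) = q (M e) + (q e - q (U e)) / 4" for e
    using qU[of e] by (simp add: symM[symmetric] field_simps)
  ultimately have "((\<lambda>e. q (M e) + (q e - q (U e)) / 4) has_sum 0) B" by simp
  moreover have "((\<lambda>e. q (M e) + (q e - q (U e)) / 4) has_sum
      (infsum (\<lambda>e. q (M e)) B + (infsum q B - infsum (\<lambda>e. q (U e)) B) / 4)) B"
    using has_sum_add[OF has_sum_infsum[OF smM] has_sum_cmult_right[of _ _ _ "1/4",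
        OF has_sum_add[OF has_sum_infsum[OF smq] has_sum_uminusI[OF has_sum_infsum[OF smU]]]]]
    by simp
  ultimately have "infsum (\<lambda>e. q (M e)) B + (infsum q B - infsum (\<lambda>e. q (U e)) B) / 4 = 0"
    by (rule has_sum_unique[symmetric])
  moreover have "x \<le> 0" if "x + (y - z) / 4 = 0" "z \<le> y" for x y z :: real
    using that by argo
  ultimately have "infsum (\<lambda>e. q (M e)) B \<le> 0" using leU by blast
  then have z: "q (M e) = 0" if "e \<in> B" for e
    using finite_sum_le_infsum[OF smM, of "{e}"] q0 that by (simp add: order_antisym)
  have "Q (M e) = 0" if "e \<in> B" for e
    using nonneg_form_zero[OF Q sym pos] z[OF that] by (simp add: q_def)
  then have "(Q \<circ> M) f = (\<lambda>f. 0) f"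
    using bounded_op_intros(1)[OF Q M]
    apply -
    apply (rule onb_eqI[OF B, of "Q \<circ> M" "\<lambda>f. 0"])
        apply (simp_all add: bounded_op_def bounded_linear_zero)
    done
  then show ?thesis by simp
qed

section \<open>Tensor products\<close>

lemma square_integrable_tensor:
  assumes "square_integrable f" "square_integrable g"
  shows "square_integrable (\<lambda>(x, y). f x * g y)"
proof -
  have [measurable]: "f \<in> borel_measurable borel" "g \<in> borel_measurable borel"
    using assms by (auto simp: square_integrable_def)
  have m: "(\<lambda>p. f (fst p) * g (snd p)) \<in> borel_measurable borel"
    unfolding borel_prod[symmetric] by measurable
  have "integrable (lborel \<Otimes>\<^sub>M lborel) (\<lambda>(x, y). (cmod (f x))\<^sup>2 * (cmod (g y))\<^sup>2)"
    using assms
    by (intro lborel_pair.Fubini_integrable) (auto simp: square_integrable_def abs_mult)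
  with m show ?thesis
    by (simp add: square_integrable_def lborel_prod case_prod_beta' norm_mult power_mult_distrib)
qed

lemma cinner_tensor: "cinner (tensor f g) (tensor f' g') = cinner f f' * cinner g g'"
proof -
  obtain a where a: "square_integrable a" "f = to_L2 a" by (rule L2_cases)
  obtain b where b: "square_integrable b" "g = to_L2 b" by (rule L2_cases)
  obtain a' where a': "square_integrable a'" "f' = to_L2 a'" by (rule L2_cases)
  obtain b' where b': "square_integrable b'" "g' = to_L2 b'" by (rule L2_cases)
  note s = square_integrable_tensor[OF a(1) b(1)] square_integrable_tensor[OF a'(1) b'(1)]
  let ?h = "\<lambda>p. cnj (case p of (x, y) \<Rightarrow> a x * b y) * (case p of (x, y) \<Rightarrow> a' x * b' y)"
  have "cinner (tensor f g) (tensor f' g') = (\<integral>p. ?h p \<partial>(lborel \<Otimes>\<^sub>M lborel))"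
    by (simp only: a(2) b(2) a'(2) b'(2) tensor_to_L2 a(1) b(1) a'(1) b'(1) cinner_to_L2 s lborel_prod)
  also have "\<dots> = (\<integral>x. \<integral>y. ?h (x, y) \<partial>lborel \<partial>lborel)"
    using integrable_cnj_mult[OF s] by (intro lborel_pair.integral_fst'[symmetric]) (simp add: lborel_prod)
  also have "\<dots> = (\<integral>x. \<integral>y. (cnj (a x) * a' x) * (cnj (b y) * b' y) \<partial>lborel \<partial>lborel)"
    by (simp add: mult_ac)
  also have "\<dots> = cinner f f' * cinner g g'"
    by (simp add: a b a' b' cinner_to_L2)
  finally show ?thesis .
qed

lemma norm_tensor: "norm (tensor f g) = norm f * norm g"
proof -
  have "complex_of_real ((norm (tensor f g))\<^sup>2) = of_real ((norm f * norm g)\<^sup>2)"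
    unfolding cinner_self[symmetric] cinner_tensor by (simp add: cinner_self power_mult_distrib)
  then have "(norm (tensor f g))\<^sup>2 = (norm f * norm g)\<^sup>2" by (simp only: of_real_eq_iff)
  then show ?thesis by (simp add: power2_eq_iff_nonneg)
qed

lemma tensor_bilinear:
  fixes f :: "'a::euclidean_space L2" and g :: "'b::euclidean_space L2"
  shows "tensor (f + f') g = tensor f g + tensor f' g"
    "tensor f (g + g') = tensor f g + tensor f g'"
    "tensor (c *\<^sub>C f) g = c *\<^sub>C tensor f g"
    "tensor f (c *\<^sub>C g) = c *\<^sub>C tensor f g"
proof -
  obtain a where a: "square_integrable a" "f = to_L2 a" by (rule L2_cases)
  obtain b where b: "square_integrable b" "g = to_L2 b" by (rule L2_cases)
  obtain a' where a': "square_integrable a'" "f' = to_L2 a'" by (rule L2_cases)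
  obtain b' where b': "square_integrable b'" "g' = to_L2 b'" by (rule L2_cases)
  show "tensor (f + f') g = tensor f g + tensor f' g"
    by (simp add: a b a' plus_to_L2 tensor_to_L2 square_integrable_add square_integrable_tensor
        case_prod_beta' distrib_right)
       (subst plus_to_L2, use square_integrable_tensor a b a' in \<open>auto simp: case_prod_beta'\<close>)
  show "tensor f (g + g') = tensor f g + tensor f g'"
    by (simp add: a b b' plus_to_L2 tensor_to_L2 square_integrable_add square_integrable_tensor
        case_prod_beta' distrib_left)
       (subst plus_to_L2, use square_integrable_tensor a b b' in \<open>auto simp: case_prod_beta'\<close>)
  show "tensor (c *\<^sub>C f) g = c *\<^sub>C tensor f g"
    by (simp add: a b scaleC_to_L2 tensor_to_L2 square_integrable_cmult case_prod_beta' mult.assoc)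
       (subst scaleC_to_L2, use square_integrable_tensor a b in \<open>auto simp: case_prod_beta'\<close>)
  show "tensor f (c *\<^sub>C g) = c *\<^sub>C tensor f g"
    by (simp add: a b scaleC_to_L2 tensor_to_L2 square_integrable_cmult case_prod_beta' mult.left_commute)
       (subst scaleC_to_L2, use square_integrable_tensor a b in \<open>auto simp: case_prod_beta'\<close>)
qed

lemma bounded_linear_tensor_left: "bounded_linear (\<lambda>f. tensor f g)"
  by (rule bounded_linear_intro[where K = "norm g"])
     (simp_all add: tensor_bilinear scaleR_scaleC norm_tensor)

lemma bounded_linear_tensor_right: "bounded_linear (\<lambda>g. tensor f g)"
  by (rule bounded_linear_intro[where K = "norm f"])
     (simp_all add: tensor_bilinear scaleR_scaleC norm_tensor)

lemma to_L2_eq_zero_iff: "square_integrable f \<Longrightarrow> to_L2 f = 0 \<longleftrightarrow> (AE x in lborel. f x = 0)"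
  unfolding zero_to_L2 by (simp add: to_L2_eq_iff square_integrable_zero)

text \<open>If \<open>F\<close> is orthogonal to all products, its partial inner product with
  \<open>e\<close> in the second variable is a square integrable function of the first variable
  orthogonal to \<open>B1\<close>, hence zero almost everywhere. Countability of \<open>B2\<close>
  merges the exceptional null sets, so almost every slice of \<open>F\<close> is orthogonal to
  \<open>B2\<close> and vanishes.\<close>

lemma orthonormal_basis_tensor:
  fixes B1 :: "'a::euclidean_space L2 set" and B2 :: "'b::euclidean_space L2 set"
  assumes B1: "orthonormal_basis B1" and B2: "orthonormal_basis B2" and count: "countable B2"
  shows "orthonormal_basis ((\<lambda>(f, g). tensor f g) ` (B1 \<times> B2))"
proof -
  let ?B = "(\<lambda>(f, g). tensor f g) ` (B1 \<times> B2)"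
  have on: "orthonormal B1" "orthonormal B2"
    using B1 B2 by (auto simp: orthonormal_basis_def)
  have *: "cinner (tensor f g) (tensor f' g') = (if f = f' \<and> g = g' then 1 else 0)"
    if "f \<in> B1" "g \<in> B2" "f' \<in> B1" "g' \<in> B2" for f g f' g'
    using that on by (simp add: cinner_tensor orthonormal_def)
  have inj: "tensor f g = tensor f' g' \<longleftrightarrow> f = f' \<and> g = g'"
    if "f \<in> B1" "g \<in> B2" "f' \<in> B1" "g' \<in> B2" for f g f' g'
    using *[OF that] *[OF that(1,2) that(1,2)] by (metis zero_neq_one)
  have "orthonormal ?B"
    unfolding orthonormal_def by (auto simp: * inj)
  moreover have "F = 0" if F: "\<forall>e\<in>?B. cinner e F = 0" for F
  proof -
    obtain f where f: "square_integrable f" and Ff: "F = to_L2 f" by (rule L2_cases)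
    have [measurable]: "f \<in> borel_measurable (lborel \<Otimes>\<^sub>M lborel)"
      using f by (simp add: square_integrable_def lborel_prod)
    define N where "N x = (\<integral>\<^sup>+y. ennreal ((cmod (f (x, y)))\<^sup>2) \<partial>lborel)" for x
    have [measurable]: "N \<in> borel_measurable lborel"
      unfolding N_def by measurable
    have iN: "(\<integral>\<^sup>+x. N x \<partial>lborel) = ennreal ((norm F)\<^sup>2)"
      unfolding N_def Ff nn_integral_square_integrable[OF f, symmetric] lborel_prod[symmetric]
      by (intro lborel.nn_integral_fst) measurable
    then have "AE x in lborel. N x \<noteq> \<infinity>"
      by (intro nn_integral_PInf_AE) auto
    then have sec: "AE x in lborel. square_integrable (\<lambda>y. f (x, y))"
    proof eventually_elim
      case (elim x)
      then show ?case unfolding N_def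
        by (intro square_integrableI_nn) (auto simp: less_top[symmetric])
    qed
    have part: "AE x in lborel. cinner e (to_L2 (\<lambda>y. f (x, y))) = 0" if e: "e \<in> B2" for e
    proof -
      obtain g where g: "square_integrable g" and eg: "e = to_L2 g" by (rule L2_cases)
      have [measurable]: "g \<in> borel_measurable lborel"
        using g by (simp add: square_integrable_def)
      have [measurable]: "(\<lambda>x. cnj (h x)) \<in> borel_measurable M" if "h \<in> borel_measurable M"
        for h :: "'z \<Rightarrow> complex" and M
        using that by (rule measurable_compose) (intro borel_measurable_continuous_onI continuous_intros)
      define \<phi> where "\<phi> x = (\<integral>y. cnj (g y) * f (x, y) \<partial>lborel)" for x
      have \<phi>m [measurable]: "\<phi> \<in> borel_measurable lborel"
        unfolding \<phi>_def by measurable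
      have \<phi>c: "AE x in lborel. \<phi> x = cinner e (to_L2 (\<lambda>y. f (x, y)))"
        using sec by eventually_elim (simp add: eg cinner_to_L2 g \<phi>_def)
      \<comment> \<open>Cauchy-Schwarz in the slice with \<open>norm e = 1\<close>; integrability of
        \<open>N\<close> then makes \<phi> square integrable.\<close>
      have bound: "AE x in lborel. ennreal ((cmod (\<phi> x))\<^sup>2) \<le> N x"
        using sec \<phi>c
      proof eventually_elim
        case (elim x)
        have "cmod (\<phi> x) \<le> norm (to_L2 (\<lambda>y. f (x, y)))"
          using norm_cinner_le[of e "to_L2 (\<lambda>y. f (x, y))"] orthonormal_norm[OF on(2) e] elim by simp
        then have "ennreal ((cmod (\<phi> x))\<^sup>2) \<le> ennreal ((norm (to_L2 (\<lambda>y. f (x, y))))\<^sup>2)"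
          by (intro ennreal_leI power_mono) auto
        then show ?case
          by (simp add: N_def nn_integral_square_integrable[OF elim(1)])
      qed
      have \<phi>: "square_integrable \<phi>"
      proof (rule square_integrableI_nn)
        have "(\<integral>\<^sup>+x. ennreal ((cmod (\<phi> x))\<^sup>2) \<partial>lborel) \<le> (\<integral>\<^sup>+x. N x \<partial>lborel)"
          by (rule nn_integral_mono_AE[OF bound])
        also have "\<dots> < \<infinity>" by (simp add: iN)
        finally show "(\<integral>\<^sup>+x. ennreal ((cmod (\<phi> x))\<^sup>2) \<partial>lborel) < \<infinity>" .
      qed simp
      have "cinner d (to_L2 \<phi>) = 0" if d: "d \<in> B1" for d
      proof -
        obtain h where h: "square_integrable h" and dh: "d = to_L2 h" by (rule L2_cases)
        note s = square_integrable_tensor[OF h g]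
        let ?k = "\<lambda>p. cnj (case p of (x, y) \<Rightarrow> h x * g y) * f p"
        have "0 = cinner (tensor d e) F" using F d e by auto
        also have "\<dots> = (\<integral>p. ?k p \<partial>(lborel \<Otimes>\<^sub>M lborel))"
          by (simp only: dh eg Ff tensor_to_L2 h g cinner_to_L2 s f lborel_prod)
        also have "\<dots> = (\<integral>x. \<integral>y. ?k (x, y) \<partial>lborel \<partial>lborel)"
          using integrable_cnj_mult[OF s f] by (intro lborel_pair.integral_fst'[symmetric]) (simp add: lborel_prod)
        also have "\<dots> = (\<integral>x. cnj (h x) * \<phi> x \<partial>lborel)"
          by (simp add: \<phi>_def mult.assoc)
        finally show ?thesis by (simp add: dh cinner_to_L2 h \<phi>)
      qed
      then have "to_L2 \<phi> = 0" using B1 by (auto simp: orthonormal_basis_def)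
      then have "AE x in lborel. \<phi> x = 0" by (simp add: to_L2_eq_zero_iff \<phi>)
      with \<phi>c show ?thesis by eventually_elim simp
    qed
    have "AE x in lborel. \<forall>e\<in>B2. cinner e (to_L2 (\<lambda>y. f (x, y))) = 0"
      using part by (simp add: AE_ball_countable[OF count])
    with sec have "AE x in lborel. N x = 0"
    proof eventually_elim
      case (elim x)
      then have "to_L2 (\<lambda>y. f (x, y)) = 0" using B2 by (auto simp: orthonormal_basis_def)
      then show ?case by (simp add: N_def nn_integral_square_integrable[OF elim(1)])
    qed
    then have "(\<integral>\<^sup>+x. N x \<partial>lborel) = 0"
      by (subst nn_integral_0_iff_AE) auto
    then show ?thesis by (simp add: iN)
  qed
  ultimately show ?thesis unfolding orthonormal_basis_def by blast
qed

section \<open>Hermite functions\<close>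

text \<open>Exponential bounds replace polynomial ones because adding the exponents serves sums and
  products alike, so the induction needs no notion of degree; a Gaussian absorbs any such
  bound.\<close>

lemma real_polynomial_function_growth:
  assumes "real_polynomial_function p"
  shows "\<exists>K c. 0 \<le> K \<and> 0 \<le> c \<and> (\<forall>z. \<bar>p z\<bar> \<le> K * exp (c * norm z))"
  using assms
proof induction
  case (linear h)
  then obtain K where K: "\<And>z. norm (h z) \<le> norm z * K" "K \<ge> 0"
    using bounded_linear.nonneg_bounded by blast
  have "\<bar>h z\<bar> \<le> K * exp (1 * norm z)" for z
  proof -
    have "norm z \<le> exp (norm z)" using exp_ge_add_one_self[of "norm z"] by linarith
    then have "norm z * K \<le> exp (norm z) * K" using K(2) by (rule mult_right_mono)
    then show ?thesis using K(1)[of z] by (simp add: mult.commute)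
  qed
  then show ?case using K(2) by (intro exI[of _ K] exI[of _ 1]) simp
next
  case (const a)
  then show ?case by (intro exI[of _ "\<bar>a\<bar>"] exI[of _ 0]) simp
next
  case (add p q)
  then obtain K c L d where *: "0 \<le> K" "0 \<le> c" "\<And>z. \<bar>p z\<bar> \<le> K * exp (c * norm z)"
    "0 \<le> L" "0 \<le> d" "\<And>z. \<bar>q z\<bar> \<le> L * exp (d * norm z)" by metis
  have "\<bar>p z + q z\<bar> \<le> (K + L) * exp ((c + d) * norm z)" for z
  proof -
    have "exp (c * norm z) \<le> exp ((c + d) * norm z)" "exp (d * norm z) \<le> exp ((c + d) * norm z)"
      using * by (auto simp: mult_right_mono)
    then have "K * exp (c * norm z) + L * exp (d * norm z) \<le> (K + L) * exp ((c + d) * norm z)"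
      using * by (simp add: distrib_right add_mono mult_left_mono)
    then show ?thesis using *(3)[of z] *(6)[of z] by linarith
  qed
  then show ?case using * by (intro exI[of _ "K + L"] exI[of _ "c + d"]) auto
next
  case (mult p q)
  then obtain K c L d where *: "0 \<le> K" "0 \<le> c" "\<And>z. \<bar>p z\<bar> \<le> K * exp (c * norm z)"
    "0 \<le> L" "0 \<le> d" "\<And>z. \<bar>q z\<bar> \<le> L * exp (d * norm z)" by metis
  have "\<bar>p z * q z\<bar> \<le> (K * L) * exp ((c + d) * norm z)" for z
  proof -
    have "\<bar>p z * q z\<bar> \<le> (K * exp (c * norm z)) * (L * exp (d * norm z))"
      unfolding abs_mult using * by (intro mult_mono) auto
    moreover have "exp ((c + d) * norm z) = exp (c * norm z) * exp (d * norm z)"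
      by (simp add: distrib_right exp_add)
    ultimately show ?thesis by (simp add: mult_ac)
  qed
  then show ?case using * by (intro exI[of _ "K * L"] exI[of _ "c + d"]) auto
qed

lemma one_plus_square_le_exp: "1 + r\<^sup>2 \<le> 2 * exp r" if "r \<ge> 0" for r :: real
  using exp_lower_Taylor_quadratic[OF that] that by (simp add: power2_eq_square)

text \<open>The factor \<open>(1 + r\<^sup>2)^n\<close> is at most \<open>(2 * exp r)^n\<close>,
  which only raises the linear rate to \<open>c + n\<close>; completing the square bounds what
  remains by \<open>exp (d\<^sup>2 / (4 * \<alpha>))\<close>.\<close>

lemma exp_linear_gaussian_bound:
  fixes c \<alpha> :: real
  assumes "\<alpha> > 0"
  shows "\<exists>K\<ge>0. \<forall>r\<ge>0. exp (c * r - \<alpha> * r\<^sup>2) \<le> (K::real) / (1 + r\<^sup>2)^n"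
proof -
  define d where "d = c + real n"
  have "exp (c * r - \<alpha> * r\<^sup>2) \<le> (2^n * exp (d\<^sup>2 / (4 * \<alpha>))) / (1 + r\<^sup>2)^n" if "r \<ge> 0" for r
  proof -
    have "(1 + r\<^sup>2)^n \<le> (2 * exp r)^n"
      using one_plus_square_le_exp[OF that] by (intro power_mono) auto
    then have "exp (c * r - \<alpha> * r\<^sup>2) * (1 + r\<^sup>2)^n \<le> exp (c * r - \<alpha> * r\<^sup>2) * (2 * exp r)^n"
      by (rule mult_left_mono) simp
    also have "\<dots> = 2^n * exp (d * r - \<alpha> * r\<^sup>2)"
      by (simp add: power_mult_distrib d_def mult_exp_exp exp_of_nat_mult[symmetric] algebra_simps)
    also have "\<dots> \<le> 2^n * exp (d\<^sup>2 / (4 * \<alpha>))"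
    proof -
      have "0 \<le> \<alpha> * (r - d / (2 * \<alpha>))\<^sup>2" using assms by simp
      also have "\<dots> = \<alpha> * r\<^sup>2 - d * r + d\<^sup>2 / (4 * \<alpha>)"
        using assms by (simp add: power2_eq_square field_simps)
      finally show ?thesis by simp
    qed
    finally show ?thesis
      by (subst pos_le_divide_eq) (auto intro!: zero_less_power add_pos_nonneg)
  qed
  then show ?thesis by (intro exI[of _ "2^n * exp (d\<^sup>2 / (4 * \<alpha>))"]) auto
qed

lemma poly_gaussian_bound:
  fixes p :: "real \<Rightarrow> real"
  assumes "real_polynomial_function p"
  shows "\<exists>K\<ge>0. \<forall>t. \<bar>p t * exp (- t\<^sup>2 / 2)\<bar> \<le> K / (1 + t\<^sup>2)"
proof -
  obtain K c where K: "0 \<le> K" "\<And>z. \<bar>p z\<bar> \<le> K * exp (c * norm z)"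
    using real_polynomial_function_growth[OF assms] by blast
  obtain L where L: "L \<ge> 0" "\<And>r. r \<ge> 0 \<Longrightarrow> exp (c * r - (1/2) * r\<^sup>2) \<le> L / (1 + r\<^sup>2)^1"
    using exp_linear_gaussian_bound[of "1/2" c 1] by auto
  have "\<bar>p t * exp (- t\<^sup>2 / 2)\<bar> \<le> (K * L) / (1 + t\<^sup>2)" for t
  proof -
    have "\<bar>p t * exp (- t\<^sup>2 / 2)\<bar> \<le> (K * exp (c * \<bar>t\<bar>)) * exp (- t\<^sup>2 / 2)"
      using K(2)[of t] by (simp add: abs_mult mult_right_mono)
    also have "\<dots> = K * exp (c * \<bar>t\<bar> - (1/2) * \<bar>t\<bar>\<^sup>2)"
      by (simp add: mult_exp_exp)
    also have "\<dots> \<le> K * (L / (1 + t\<^sup>2))"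
      using L(2)[of "\<bar>t\<bar>"] K(1) by (intro mult_left_mono) auto
    finally show ?thesis by simp
  qed
  then show ?thesis using K(1) L(1) by (intro exI[of _ "K * L"]) auto
qed

lemma integrable_Cauchy_density: "integrable lborel (\<lambda>t::real. K / (1 + t\<^sup>2))"
proof -
  have "set_integrable lborel (einterval (-\<infinity>) \<infinity>) (\<lambda>x. inverse (1 + x^2))"
    by (rule integrable_inverse_1_plus_square)
  then have "integrable lborel (\<lambda>t::real. inverse (1 + t\<^sup>2))"
    by (simp add: set_integrable_def einterval_eq)
  then show ?thesis unfolding divide_inverse by (rule integrable_mult_right)
qed

lemma integrable_of_decay:
  fixes f :: "real \<Rightarrow> 'a::{banach, second_countable_topology}"
  assumes "f \<in> borel_measurable borel" "\<And>t. norm (f t) \<le> K / (1 + t\<^sup>2)"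
  shows "integrable lborel f"
proof (rule Bochner_Integration.integrable_bound[OF integrable_Cauchy_density[of K]])
  have "norm (f t) \<le> norm (K / (1 + t\<^sup>2))" for t
    using assms(2)[of t] abs_ge_self[of "K / (1 + t\<^sup>2)"] by (simp del: abs_divide)
  then show "AE t in lborel. norm (f t) \<le> norm (K / (1 + t\<^sup>2))" by simp
qed (use assms in auto)

text \<open>The fundamental theorem on \<open>{- n..n}\<close> with boundary values tending to 0,
  and dominated convergence for the integrals.\<close>

lemma integral_derivative_zero:
  fixes F f :: "real \<Rightarrow> 'a::euclidean_space"
  assumes F: "\<And>t. (F has_vector_derivative f t) (at t)" and f: "continuous_on UNIV f"
    and FK: "\<And>t. norm (F t) \<le> K / (1 + t\<^sup>2)" and fK: "\<And>t. norm (f t) \<le> L / (1 + t\<^sup>2)"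
  shows "(\<integral>t. f t \<partial>lborel) = 0"
proof -
  have fm [measurable]: "f \<in> borel_measurable borel"
    using f by (rule borel_measurable_continuous_onI)
  have int: "integrable lborel f"
    by (rule integrable_of_decay[OF fm fK])
  have "(\<lambda>n. \<integral>t. indicator {- real n..real n} t *\<^sub>R f t \<partial>lborel) \<longlonglongrightarrow> (\<integral>t. f t \<partial>lborel)"
  proof (rule integral_dominated_convergence[where w = "\<lambda>t. norm (f t)"])
    show "AE t in lborel. (\<lambda>n. indicator {- real n..real n} t *\<^sub>R f t) \<longlonglongrightarrow> f t"
    proof (intro AE_I2 tendsto_eventually)
      fix t :: real
      show "\<forall>\<^sub>F n in sequentially. indicator {- real n..real n} t *\<^sub>R f t = f t"
        using eventually_ge_at_top[of "nat \<lceil>\<bar>t\<bar>\<rceil>"]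
        by eventually_elim (auto simp: indicator_def abs_le_iff nat_le_iff ceiling_le_iff)
    qed
  qed (use int in \<open>auto simp: indicator_def\<close>)
  moreover have "(\<integral>t. indicator {- real n..real n} t *\<^sub>R f t \<partial>lborel) = F (real n) - F (- real n)" for n
    by (rule integral_FTC_atLeastAtMost)
       (auto intro!: has_vector_derivative_at_within F continuous_on_subset[OF f])
  moreover have "(\<lambda>n. F (real n) - F (- real n)) \<longlonglongrightarrow> 0 - 0"
  proof (intro tendsto_diff)
    have lim: "(\<lambda>n. K / (1 + (real n)\<^sup>2)) \<longlonglongrightarrow> 0" by real_asymp
    show "(\<lambda>n. F (real n)) \<longlonglongrightarrow> 0"
      by (rule Lim_null_comparison[OF _ lim]) (use FK in auto)
    show "(\<lambda>n. F (- real n)) \<longlonglongrightarrow> 0"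
      by (rule Lim_null_comparison[OF _ lim]) (use FK[of "- real _"] in auto)
  qed
  ultimately show ?thesis
    using LIMSEQ_unique by fastforce
qed

lemma real_polynomial_function_arith:
  fixes p q :: "real \<Rightarrow> real"
  assumes "real_polynomial_function p" "real_polynomial_function q"
  shows "real_polynomial_function (\<lambda>t. p t * q t)" "real_polynomial_function (\<lambda>t. p t - q t)"
    "real_polynomial_function (\<lambda>t. t * p t)" "real_polynomial_function (\<lambda>t. c * p t)"
proof -
  have "real_polynomial_function (\<lambda>t::real. t)"
    by (rule real_polynomial_function.intros(1)) (rule bounded_linear_ident)
  then show "real_polynomial_function (\<lambda>t. p t * q t)" "real_polynomial_function (\<lambda>t. p t - q t)"
    "real_polynomial_function (\<lambda>t. t * p t)" "real_polynomial_function (\<lambda>t. c * p t)"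
    using assms
    by (auto intro: real_polynomial_function_diff real_polynomial_function.intros(2-4))
qed

section \<open>Hermite polynomials, the oscillator equation and orthogonality\<close>

text \<open>The physicists' normalization, orthogonal for the weight
  \<open>exp (- t\<^sup>2)\<close>, given by its three-term recurrence.\<close>

fun hermite :: "nat \<Rightarrow> real \<Rightarrow> real" where
  "hermite 0 t = 1"
| "hermite (Suc 0) t = 2 * t"
| "hermite (Suc (Suc n)) t = 2 * t * hermite (Suc n) t - 2 * (real n + 1) * hermite n t"

text \<open>For \<open>n = 0\<close> the factor \<open>real n\<close> kills the truncated index
  \<open>n - 1\<close>. The induction differentiates the recurrence and uses it once more one degree
  lower.\<close>

lemma DERIV_hermite:
  "(hermite n has_real_derivative 2 * real n * hermite (n - 1) t) (at t)"
proof (induction n arbitrary: t rule: induct_nat_012)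
  case (ge2 n)
  have "((\<lambda>t. 2 * t * hermite (Suc n) t - 2 * (real n + 1) * hermite n t) has_real_derivative
     (2 * hermite (Suc n) t + 2 * real (Suc n) * hermite (Suc n - 1) t * (2 * t)
       - 2 * (real n + 1) * (2 * real n * hermite (n - 1) t))) (at t)"
    by (auto intro!: derivative_eq_intros ge2)
  moreover have "2 * hermite (Suc n) t + 2 * real (Suc n) * hermite (Suc n - 1) t * (2 * t)
       - 2 * (real n + 1) * (2 * real n * hermite (n - 1) t)
     = 2 * real (Suc (Suc n)) * hermite (Suc (Suc n) - 1) t"
    by (cases n) (simp_all add: algebra_simps)
  ultimately show ?case by (simp add: hermite.simps(3)[abs_def])
qed (auto intro!: derivative_eq_intros simp: hermite.simps[abs_def])

lemma real_polynomial_function_hermite: "real_polynomial_function (hermite n)"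
proof (induction n rule: induct_nat_012)
  case (ge2 n)
  have "real_polynomial_function (\<lambda>t. 2 * t * hermite (Suc n) t - 2 * (real n + 1) * hermite n t)"
    using ge2 by (simp only: mult.assoc) (intro real_polynomial_function_arith)
  then show ?case by (simp add: hermite.simps(3)[abs_def])
qed (auto simp: hermite.simps[abs_def] intro!: real_polynomial_function_arith(4) real_polynomial_function.intros(1,2) bounded_linear_ident bounded_linear_mult_right)

text \<open>This is Hermite's equation H'' - 2 t H' + 2 n H = 0 with the derivatives already
  rewritten by \<open>DERIV_hermite\<close>, and amounts to the recurrence.\<close>

lemma hermite_ode:
  "2 * real n * (2 * real (n - 1) * hermite (n - 2) t) - 2 * t * (2 * real n * hermite (n - 1) t)
     + 2 * real n * hermite n t = 0"
  by (induction n rule: induct_nat_012) (simp_all add: algebra_simps numeral_2_eq_2)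

definition hermite_fun :: "nat \<Rightarrow> real \<Rightarrow> real" where
  "hermite_fun n t = hermite n t * exp (- t\<^sup>2 / 2)"

definition hermite_fun' :: "nat \<Rightarrow> real \<Rightarrow> real" where
  "hermite_fun' n t = (2 * real n * hermite (n - 1) t - t * hermite n t) * exp (- t\<^sup>2 / 2)"

lemma DERIV_hermite_fun: "(hermite_fun n has_real_derivative hermite_fun' n t) (at t)"
  unfolding hermite_fun_def[abs_def] hermite_fun'_def
  by (auto intro!: derivative_eq_intros DERIV_hermite simp: field_simps power2_eq_square)

text \<open>The eigenvalue equation of the harmonic oscillator: \<open>t\<^sup>2\<close> minus the
  second derivative has eigenvalue 2 n + 1. Both orthogonality and the spectrum of the cost rest on
  it.\<close>

lemma DERIV_hermite_fun':
  "(hermite_fun' n has_real_derivative (t\<^sup>2 - 1 - 2 * real n) * hermite_fun n t) (at t)"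
proof -
  have "(hermite_fun' n has_real_derivative
     ((2 * real n * (2 * real (n - 1) * hermite (n - 1 - 1) t)
        - (hermite n t + 2 * real n * hermite (n - 1) t * t)) * exp (- t\<^sup>2 / 2)
      + exp (- t\<^sup>2 / 2) * (- t) * (2 * real n * hermite (n - 1) t - t * hermite n t))) (at t)"
    unfolding hermite_fun'_def[abs_def]
    by (auto intro!: derivative_eq_intros DERIV_hermite simp: field_simps power2_eq_square)
  moreover have "(2 * real n * (2 * real (n - 1) * hermite (n - 1 - 1) t)
        - (hermite n t + 2 * real n * hermite (n - 1) t * t))
      + (- t) * (2 * real n * hermite (n - 1) t - t * hermite n t)
    = (t\<^sup>2 - 1 - 2 * real n) * hermite n t"
    using hermite_ode[of n t] by (simp add: algebra_simps power2_eq_square numeral_2_eq_2)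
  ultimately show ?thesis
    unfolding hermite_fun_def
    by (elim DERIV_cong) algebra
qed

lemma continuous_on_hermite_fun: "continuous_on A (hermite_fun n)"
  using DERIV_hermite_fun by (meson DERIV_isCont continuous_at_imp_continuous_on)

text \<open>One Gaussian factor absorbs the polynomials, the other is bounded by 1.\<close>

lemma gaussian_product_bound:
  fixes p q :: "real \<Rightarrow> real"
  assumes "real_polynomial_function p" "real_polynomial_function q"
  shows "\<exists>K. \<forall>t. norm (p t * exp (- t\<^sup>2 / 2) * (q t * exp (- t\<^sup>2 / 2))) \<le> K / (1 + t\<^sup>2)"
proof -
  obtain K where K: "\<And>t. \<bar>p t * q t * exp (- t\<^sup>2 / 2)\<bar> \<le> K / (1 + t\<^sup>2)"
    using poly_gaussian_bound[OF real_polynomial_function_arith(1)[OF assms]] by blast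
  have "norm (p t * exp (- t\<^sup>2 / 2) * (q t * exp (- t\<^sup>2 / 2))) \<le> K / (1 + t\<^sup>2)" for t
  proof -
    have "norm (p t * exp (- t\<^sup>2 / 2) * (q t * exp (- t\<^sup>2 / 2)))
        = \<bar>p t * q t * exp (- t\<^sup>2 / 2)\<bar> * exp (- t\<^sup>2 / 2)"
      by (simp add: abs_mult mult_ac)
    also have "\<dots> \<le> \<bar>p t * q t * exp (- t\<^sup>2 / 2)\<bar> * 1"
      by (intro mult_left_mono) auto
    finally show ?thesis using K[of t] by simp
  qed
  then show ?thesis by blast
qed

text \<open>The Wronskian \<open>?F\<close> has derivative \<open>?c\<close> times the product of
  the two functions, because the terms in \<open>t\<^sup>2 - 1\<close> of the oscillator equations
  cancel; the Wronskian decays, so the integral of its derivative is 0.\<close>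

lemma hermite_fun_orthogonal:
  assumes "m \<noteq> n"
  shows "(\<integral>t. hermite_fun m t * hermite_fun n t \<partial>lborel) = 0"
proof -
  let ?F = "\<lambda>t. hermite_fun' m t * hermite_fun n t - hermite_fun m t * hermite_fun' n t"
  let ?c = "2 * real n - 2 * real m"
  let ?f = "\<lambda>t. ?c * (hermite_fun m t * hermite_fun n t)"
  let ?p' = "\<lambda>n t. 2 * real n * hermite (n - 1) t - t * hermite n t"
  have p': "real_polynomial_function (?p' n)" for n
    using real_polynomial_function_hermite by (intro real_polynomial_function_arith)
  obtain K1 where K1: "\<And>t. norm (hermite_fun' m t * hermite_fun n t) \<le> K1 / (1 + t\<^sup>2)"
    using gaussian_product_bound[OF p'[of m] real_polynomial_function_hermite[of n]]
    unfolding hermite_fun'_def hermite_fun_def by blast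
  obtain K2 where K2: "\<And>t. norm (hermite_fun m t * hermite_fun' n t) \<le> K2 / (1 + t\<^sup>2)"
    using gaussian_product_bound[OF real_polynomial_function_hermite[of m] p'[of n]]
    unfolding hermite_fun'_def hermite_fun_def by blast
  obtain K3 where K3: "\<And>t. norm (hermite_fun m t * hermite_fun n t) \<le> K3 / (1 + t\<^sup>2)"
    using gaussian_product_bound[OF real_polynomial_function_hermite[of m] real_polynomial_function_hermite[of n]]
    unfolding hermite_fun_def by blast
  have "(\<integral>t. ?f t \<partial>lborel) = 0"
  proof (rule integral_derivative_zero[where F = ?F and K = "K1 + K2" and L = "\<bar>?c\<bar> * K3"])
    fix t
    have "(?F has_real_derivative ?f t) (at t)"
      by (auto intro!: derivative_eq_intros DERIV_hermite_fun DERIV_hermite_fun' simp: algebra_simps)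
    then show "(?F has_vector_derivative ?f t) (at t)"
      by (simp add: has_real_derivative_iff_has_vector_derivative)
    show "norm (?F t) \<le> (K1 + K2) / (1 + t\<^sup>2)"
      using norm_triangle_ineq4[of "hermite_fun' m t * hermite_fun n t" "hermite_fun m t * hermite_fun' n t"]
        K1[of t] K2[of t] by (simp add: add_divide_distrib)
    show "norm (?f t) \<le> (\<bar>?c\<bar> * K3) / (1 + t\<^sup>2)"
      using mult_left_mono[OF K3[of t], of "\<bar>?c\<bar>"] by (simp add: abs_mult)
  qed (intro continuous_intros continuous_on_hermite_fun)
  then show ?thesis using assms by simp
qed

lemma square_integrable_hermite_fun: "square_integrable (\<lambda>t. complex_of_real (hermite_fun n t))"
proof -
  obtain K where K: "\<And>t. norm (hermite_fun n t * hermite_fun n t) \<le> K / (1 + t\<^sup>2)"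
    using gaussian_product_bound[OF real_polynomial_function_hermite[of n] real_polynomial_function_hermite[of n]]
    unfolding hermite_fun_def by blast
  have m: "hermite_fun n \<in> borel_measurable borel"
    by (intro borel_measurable_continuous_onI continuous_on_hermite_fun)
  then have "integrable lborel (\<lambda>t. hermite_fun n t * hermite_fun n t)"
    by (intro integrable_of_decay[OF _ K]) measurable
  then show ?thesis
    using m by (simp add: square_integrable_def power2_eq_square flip: abs_mult)
qed

text \<open>Legitimates the normalization by the norm. A continuous function vanishing almost
  everywhere vanishes everywhere, and differentiating a zero Hermite polynomial down to degree 0
  contradicts \<open>hermite 0 t = 1\<close>.\<close>

lemma hermite_fun_nonzero: "to_L2 (\<lambda>t. complex_of_real (hermite_fun n t)) \<noteq> 0"
proof
  assume "to_L2 (\<lambda>t. complex_of_real (hermite_fun n t)) = 0"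
  then have "AE t in lborel. hermite_fun n t = 0"
    by (simp add: to_L2_eq_zero_iff square_integrable_hermite_fun)
  then have "AE t in lebesgue. hermite_fun n t = 0"
    by (rule AE_completion)
  moreover have "closed {t. hermite_fun n t = 0}"
    by (intro closed_Collect_eq continuous_on_hermite_fun continuous_on_const)
  ultimately have "hermite_fun n t = 0" for t
    using mem_closed_if_AE_lebesgue[of "{t. hermite_fun n t = 0}" t] by simp
  then have z: "hermite n t = 0" for t by (auto simp: hermite_fun_def)
  have "\<forall>t. hermite n t = 0 \<Longrightarrow> False"
  proof (induction n)
    case (Suc n)
    have "hermite (Suc n) = (\<lambda>t. 0)" using Suc.prems by auto
    then have "((\<lambda>t. 0) has_real_derivative 2 * real (Suc n) * hermite n t) (at t)" for t
      using DERIV_hermite[of "Suc n" t] by simp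
    then have "2 * real (Suc n) * hermite n t = 0" for t
      by (rule DERIV_unique) simp
    then show ?case using Suc.IH by simp
  qed simp
  then show False using z by blast
qed

section \<open>Completeness of the Hermite functions\<close>

text \<open>Fourier injectivity is obtained from Levy's uniqueness theorem: the positive and
  negative parts of \<open>g\<close> have equal mass, and after normalization they are densities of
  two distributions with the same characteristic function.\<close>

lemma fourier_zero_imp_AE_zero:
  fixes g :: "real \<Rightarrow> real"
  assumes g: "integrable lborel g"
    and zero: "\<And>\<theta>. (\<integral>t. iexp (\<theta> * t) * complex_of_real (g t) \<partial>lborel) = 0"
  shows "AE t in lborel. g t = 0"
proof -
  have [measurable]: "g \<in> borel_measurable borel"
    using g by auto
  define p where "p t = max (g t) 0" for t
  define n where "n t = max (- g t) 0" for t
  have pm [measurable]: "p \<in> borel_measurable borel" and nm [measurable]: "n \<in> borel_measurable borel"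
    unfolding p_def n_def by measurable
  have ip: "integrable lborel p" "integrable lborel n"
    using g unfolding p_def[abs_def] n_def[abs_def] by auto
  have pn: "g t = p t - n t" "p t \<ge> 0" "n t \<ge> 0" for t by (auto simp: p_def n_def)
  define m where "m = (\<integral>t. p t \<partial>lborel)"
  have eq: "(\<integral>t. iexp (\<theta> * t) * complex_of_real (p t) \<partial>lborel)
      = (\<integral>t. iexp (\<theta> * t) * complex_of_real (n t) \<partial>lborel)" for \<theta>
  proof -
    have int: "integrable lborel (\<lambda>t. iexp (\<theta> * t) * complex_of_real (q t))"
      if "integrable lborel q" for q
      by (rule Bochner_Integration.integrable_bound[OF that])
         (use that in \<open>auto simp: norm_mult\<close>)
    have "(\<integral>t. iexp (\<theta> * t) * complex_of_real (g t) \<partial>lborel)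
        = (\<integral>t. iexp (\<theta> * t) * complex_of_real (p t) - iexp (\<theta> * t) * complex_of_real (n t) \<partial>lborel)"
      by (simp only: pn(1) of_real_diff right_diff_distrib)
    then show ?thesis
      using zero[of \<theta>] Bochner_Integration.integral_diff[OF int[OF ip(1)] int[OF ip(2)]] by simp
  qed
  \<comment> \<open>The frequency 0 shows that both parts have the same mass, so one constant
    normalizes both.\<close>
  have mn: "m = (\<integral>t. n t \<partial>lborel)"
    using eq[of 0] by (simp add: m_def)
  show ?thesis
  proof (cases "m = 0")
    case True
    then have "AE t in lborel. p t = 0" "AE t in lborel. n t = 0"
      using integral_nonneg_eq_0_iff_AE[OF ip(1)] integral_nonneg_eq_0_iff_AE[OF ip(2)] mn pn
      by (simp_all add: m_def)
    then show ?thesis by eventually_elim (simp add: pn)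
  next
    case False
    moreover have "m \<ge> 0" unfolding m_def by (intro Bochner_Integration.integral_nonneg) (simp add: pn)
    ultimately have m: "m > 0" by simp
    define D where "D q = density lborel (\<lambda>t. ennreal (q t / m))" for q :: "real \<Rightarrow> real"
    have rd: "real_distribution (D q)"
      if q: "q \<in> borel_measurable borel" "integrable lborel q" "\<And>t. q t \<ge> 0" "(\<integral>t. q t \<partial>lborel) = m" for q
    proof -
      have "(\<integral>\<^sup>+t. ennreal (q t / m) \<partial>lborel) = ennreal (\<integral>t. q t / m \<partial>lborel)"
        using q m by (intro nn_integral_eq_integral) auto
      also have "\<dots> = 1" using q(4) m by simp
      finally have "prob_space (D q)"
        unfolding D_def using q(1) by (intro prob_spaceI) (simp add: emeasure_density)
      then show ?thesis
        by (simp add: real_distribution_def real_distribution_axioms_def D_def)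
    qed
    have ch: "char (D q) \<theta> = (\<integral>t. iexp (\<theta> * t) * complex_of_real (q t) \<partial>lborel) / m"
      if q: "q \<in> borel_measurable borel" "\<And>t. q t \<ge> 0" for q \<theta>
    proof -
      have "char (D q) \<theta> = (\<integral>t. (q t / m) *\<^sub>R iexp (\<theta> * t) \<partial>lborel)"
        unfolding char_def D_def using q m by (subst integral_density) auto
      also have "\<dots> = (\<integral>t. (iexp (\<theta> * t) * complex_of_real (q t)) / m \<partial>lborel)"
        by (simp add: scaleR_conv_of_real mult_ac)
      finally show ?thesis by simp
    qed
    have "D p = D n"
    proof (rule Levy_uniqueness)
      show "real_distribution (D p)" "real_distribution (D n)"
        by (rule rd; use ip pn m_def mn in simp)+
      show "char (D p) = char (D n)"
        by (rule ext) (simp only: ch[OF pm pn(2)] ch[OF nm pn(3)] eq)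
    qed
    then have "AE t in lborel. ennreal (p t / m) = ennreal (n t / m)"
      unfolding D_def by (intro sigma_finite_measure.density_unique_iff[OF lborel.sigma_finite_measure_axioms, THEN iffD1]) measurable
    then show ?thesis
    proof eventually_elim
      case (elim t)
      then have "p t / m = n t / m" using pn m by (simp add: ennreal_inj)
      then show ?case using m by (simp add: pn)
    qed
  qed
qed

lemma square_integrable_gaussian_growth:
  assumes "g \<in> borel_measurable borel" "\<And>t. \<bar>g t\<bar> \<le> K * exp (c * \<bar>t\<bar> - t\<^sup>2 / 2)" "0 \<le> K"
  shows "square_integrable (\<lambda>t. complex_of_real (g t))"
proof -
  obtain L where L: "L \<ge> 0" "\<And>r. r \<ge> 0 \<Longrightarrow> exp (2 * c * r - 1 * r\<^sup>2) \<le> L / (1 + r\<^sup>2)^1"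
    using exp_linear_gaussian_bound[of 1 "2 * c" 1] by auto
  have "norm ((g t)\<^sup>2) \<le> (K\<^sup>2 * L) / (1 + t\<^sup>2)" for t
  proof -
    have "\<bar>g t\<bar>\<^sup>2 \<le> (K * exp (c * \<bar>t\<bar> - t\<^sup>2 / 2))\<^sup>2"
      using assms(2)[of t] by (rule power_mono) simp
    also have "\<dots> = K\<^sup>2 * exp (2 * c * \<bar>t\<bar> - 1 * \<bar>t\<bar>\<^sup>2)"
      by (simp add: power_mult_distrib power2_eq_square mult_exp_exp)
    also have "\<dots> \<le> K\<^sup>2 * (L / (1 + \<bar>t\<bar>\<^sup>2)^1)"
      by (intro mult_left_mono L) auto
    finally show ?thesis by simp
  qed
  then have "integrable lborel (\<lambda>t. (g t)\<^sup>2)"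
    by (intro integrable_of_decay) (use assms in auto)
  then show ?thesis
    using assms(1) by (simp add: square_integrable_def)
qed

lemma square_integrable_poly_gaussian:
  assumes "real_polynomial_function p"
  shows "square_integrable (\<lambda>t. complex_of_real (p t * exp (- t\<^sup>2 / 2)))"
proof -
  obtain K c where K: "0 \<le> K" "\<And>z. \<bar>p z\<bar> \<le> K * exp (c * norm z)"
    using real_polynomial_function_growth[OF assms] by blast
  have "continuous_on UNIV p"
    using assms by (simp add: continuous_on_polymonial_function real_polynomial_function_eq)
  then have [measurable]: "p \<in> borel_measurable borel"
    by (rule borel_measurable_continuous_onI)
  have "\<bar>p t * exp (- t\<^sup>2 / 2)\<bar> \<le> K * exp (c * \<bar>t\<bar> - t\<^sup>2 / 2)" for t
  proof -
    have "\<bar>p t * exp (- t\<^sup>2 / 2)\<bar> \<le> (K * exp (c * \<bar>t\<bar>)) * exp (- t\<^sup>2 / 2)"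
      using K(2)[of t] by (simp add: abs_mult mult_right_mono)
    moreover have "exp (c * \<bar>t\<bar>) * exp (- t\<^sup>2 / 2) = exp (c * \<bar>t\<bar> - t\<^sup>2 / 2)"
      by (simp add: mult_exp_exp)
    ultimately show ?thesis by (simp only: mult.assoc)
  qed
  then show ?thesis
    by (intro square_integrable_gaussian_growth[OF _ _ K(1)]) auto
qed

text \<open>The recurrence expresses t times a Hermite function through its two neighbours, so
  orthogonality to all Hermite functions survives multiplication by powers of t.\<close>

lemma hermite_moment:
  fixes f :: "real \<Rightarrow> complex"
  assumes f: "square_integrable f"
    and zero: "\<And>n. (\<integral>t. complex_of_real (hermite_fun n t) * f t \<partial>lborel) = 0"
  shows "(\<integral>t. complex_of_real (t^k * hermite_fun n t) * f t \<partial>lborel) = 0"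
proof (induction k arbitrary: n)
  case (Suc k)
  have int: "integrable lborel (\<lambda>t. complex_of_real (t^k * hermite_fun n t) * f t)" for n
  proof -
    have "real_polynomial_function (\<lambda>t. t^k * hermite n t)"
      by (intro real_polynomial_function_arith real_polynomial_function_hermite real_polynomial_function_power
          real_polynomial_function.intros(1) bounded_linear_ident)
    from integrable_cnj_mult[OF square_integrable_poly_gaussian[OF this] f]
    show ?thesis by (simp add: hermite_fun_def mult.assoc)
  qed
  show ?case
  proof (cases n)
    case 0
    have eq: "complex_of_real (t ^ Suc k * hermite_fun n t) * f t
        = (1/2) * (complex_of_real (t^k * hermite_fun 1 t) * f t)" for t
      using 0 by (simp add: hermite_fun_def)
    show ?thesis unfolding eq integral_mult_right_zero Suc by simp
  next
    case (Suc l)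
    have eq: "complex_of_real (t ^ Suc k * hermite_fun n t) * f t
        = (1/2) * (complex_of_real (t^k * hermite_fun (Suc n) t) * f t)
          + (of_nat l + 1) * (complex_of_real (t^k * hermite_fun l t) * f t)" for t
      using Suc by (simp add: hermite_fun_def field_simps)
    then show ?thesis
      using Suc.IH[of "Suc n"] Suc.IH[of l] int by (simp del: of_real_mult)
  qed
qed (simp add: zero)

lemma sum_exp_le: "(\<Sum>k<N. x^k / fact k) \<le> exp x" if "x \<ge> 0" for x :: real
  unfolding exp_def using summable_exp_generic[of x] that
  by (intro order_trans[OF _ sum_le_suminf[of _ "{..<N}"]]) (auto simp: divide_inverse mult.commute)

text \<open>All moments of \<open>f\<close> times the Gaussian vanish. The Gaussian makes even
  \<open>exp (c * \<bar>t\<bar>)\<close> an admissible weight, so the exponential series may be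
  integrated term by term and the Fourier transform of the product is zero.\<close>

lemma hermite_complete:
  fixes f :: "real \<Rightarrow> complex"
  assumes f: "square_integrable f"
    and zero: "\<And>n. (\<integral>t. complex_of_real (hermite_fun n t) * f t \<partial>lborel) = 0"
  shows "AE t in lborel. f t = 0"
proof -
  have fm [measurable]: "f \<in> borel_measurable borel"
    using f by (simp add: square_integrable_def)
  define \<mu> where "\<mu> t = complex_of_real (exp (- t\<^sup>2 / 2)) * f t" for t
  have [measurable]: "\<mu> \<in> borel_measurable borel" unfolding \<mu>_def by measurable
  have dom: "integrable lborel (\<lambda>t. complex_of_real (exp (c * \<bar>t\<bar>)) * \<mu> t)" for c
  proof -
    have "square_integrable (\<lambda>t. complex_of_real (exp (c * \<bar>t\<bar> - t\<^sup>2 / 2)))"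
      by (rule square_integrable_gaussian_growth[where K = 1 and c = c]) auto
    from integrable_cnj_mult[OF this f] show ?thesis
      by (simp add: \<mu>_def mult_exp_exp flip: mult.assoc of_real_mult)
  qed
  have mom: "integrable lborel (\<lambda>t. complex_of_real (t^k) * \<mu> t)"
    "(\<integral>t. complex_of_real (t^k) * \<mu> t \<partial>lborel) = 0" for k
  proof -
    have "real_polynomial_function (\<lambda>t::real. t^k)"
      by (intro real_polynomial_function_power real_polynomial_function.intros(1) bounded_linear_ident)
    from integrable_cnj_mult[OF square_integrable_poly_gaussian[OF this] f]
    show "integrable lborel (\<lambda>t. complex_of_real (t^k) * \<mu> t)" by (simp add: \<mu>_def mult.assoc)
    show "(\<integral>t. complex_of_real (t^k) * \<mu> t \<partial>lborel) = 0"
      using hermite_moment[OF f zero, of k 0] by (simp add: hermite_fun_def \<mu>_def mult.assoc)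
  qed
  have four: "(\<integral>t. iexp (\<theta> * t) * \<mu> t \<partial>lborel) = 0" for \<theta>
  proof -
    define s where "s N t = (\<Sum>k<N. (\<i> * of_real (\<theta> * t))^k / fact k) * \<mu> t" for N t
    have s_eq: "s N t = (\<Sum>k<N. ((\<i> * of_real \<theta>)^k / fact k) * (complex_of_real (t^k) * \<mu> t))" for N t
      unfolding s_def sum_distrib_right by (rule sum.cong) (simp_all add: power_mult_distrib)
    have "(\<lambda>N. \<integral>t. s N t \<partial>lborel) \<longlonglongrightarrow> (\<integral>t. iexp (\<theta> * t) * \<mu> t \<partial>lborel)"
    proof (rule integral_dominated_convergence[where w = "\<lambda>t. norm (complex_of_real (exp (\<bar>\<theta>\<bar> * \<bar>t\<bar>)) * \<mu> t)"])
      show "integrable lborel (\<lambda>t. norm (complex_of_real (exp (\<bar>\<theta>\<bar> * \<bar>t\<bar>)) * \<mu> t))"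
        using dom by (rule integrable_norm)
      show "AE t in lborel. (\<lambda>N. s N t) \<longlonglongrightarrow> iexp (\<theta> * t) * \<mu> t"
      proof (rule AE_I2)
        fix t
        have "(\<lambda>k. (\<i> * of_real (\<theta> * t))^k /\<^sub>R fact k) sums iexp (\<theta> * t)"
          by (rule exp_converges)
        then have "(\<lambda>k. (\<i> * of_real (\<theta> * t))^k / fact k) sums iexp (\<theta> * t)"
          by (simp add: scaleR_conv_of_real field_simps)
        then show "(\<lambda>N. s N t) \<longlonglongrightarrow> iexp (\<theta> * t) * \<mu> t"
          unfolding s_def sums_def by (intro tendsto_intros)
      qed
      show "AE t in lborel. norm (s N t) \<le> norm (complex_of_real (exp (\<bar>\<theta>\<bar> * \<bar>t\<bar>)) * \<mu> t)" for N
      proof (rule AE_I2)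
        fix t
        have "norm (\<Sum>k<N. (\<i> * of_real (\<theta> * t))^k / fact k) \<le> (\<Sum>k<N. (\<bar>\<theta>\<bar> * \<bar>t\<bar>)^k / fact k)"
          by (rule sum_norm_le) (simp add: norm_divide norm_power norm_mult abs_mult)
        also have "\<dots> \<le> exp (\<bar>\<theta>\<bar> * \<bar>t\<bar>)"
          by (rule sum_exp_le) simp
        finally show "norm (s N t) \<le> norm (complex_of_real (exp (\<bar>\<theta>\<bar> * \<bar>t\<bar>)) * \<mu> t)"
          unfolding s_def norm_mult by (intro mult_right_mono) auto
      qed
    qed (auto simp: s_def)
    moreover have "(\<integral>t. s N t \<partial>lborel) = 0" for N
      unfolding s_eq by (subst Bochner_Integration.integral_sum)
        (use mom in \<open>simp_all del: of_real_power\<close>)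
    ultimately show ?thesis
      using LIMSEQ_unique[OF _ tendsto_const] by fastforce
  qed
  have \<mu>i: "integrable lborel \<mu>" using dom[of 0] by simp
  \<comment> \<open>Fourier uniqueness was proved for real functions; the conjugate is needed to
    form the real and imaginary parts of \<mu>.\<close>
  have four': "(\<integral>t. iexp (\<theta> * t) * cnj (\<mu> t) \<partial>lborel) = 0" for \<theta>
  proof -
    have "(\<integral>t. iexp (\<theta> * t) * cnj (\<mu> t) \<partial>lborel) = (\<integral>t. cnj (iexp (- \<theta> * t) * \<mu> t) \<partial>lborel)"
      by (simp add: exp_cnj)
    also have "\<dots> = cnj (\<integral>t. iexp (- \<theta> * t) * \<mu> t \<partial>lborel)"
      by (rule Bochner_Integration.integral_cnj)
    finally show ?thesis by (simp add: four[of "- \<theta>", simplified])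
  qed
  have [measurable]: "(\<lambda>t. cnj (\<mu> t)) \<in> borel_measurable borel"
    using Bochner_Integration.integrable_cnj[OF \<mu>i] borel_measurable_integrable by fastforce
  have int: "integrable lborel (\<lambda>t. iexp (\<theta> * t) * \<mu> t)" "integrable lborel (\<lambda>t. iexp (\<theta> * t) * cnj (\<mu> t))" for \<theta>
    by (rule Bochner_Integration.integrable_bound[OF \<mu>i]; use \<mu>i in \<open>auto simp: norm_mult\<close>)+
  have "AE t in lborel. Re (\<mu> t) = 0"
  proof (rule fourier_zero_imp_AE_zero)
    fix \<theta>
    have eq: "iexp (\<theta> * t) * complex_of_real (Re (\<mu> t)) = (1/2) * (iexp (\<theta> * t) * \<mu> t + iexp (\<theta> * t) * cnj (\<mu> t))" for t
      by (simp add: complex_eq_iff flip: distrib_left)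
    show "(\<integral>t. iexp (\<theta> * t) * complex_of_real (Re (\<mu> t)) \<partial>lborel) = 0"
      unfolding eq by (simp only: integral_mult_right_zero Bochner_Integration.integral_add[OF int] four four') simp
  qed (use \<mu>i in simp)
  moreover have "AE t in lborel. Im (\<mu> t) = 0"
  proof (rule fourier_zero_imp_AE_zero)
    fix \<theta>
    have eq: "iexp (\<theta> * t) * complex_of_real (Im (\<mu> t)) = (- \<i>/2) * (iexp (\<theta> * t) * \<mu> t - iexp (\<theta> * t) * cnj (\<mu> t))" for t
      by (simp add: complex_eq_iff flip: right_diff_distrib)
    show "(\<integral>t. iexp (\<theta> * t) * complex_of_real (Im (\<mu> t)) \<partial>lborel) = 0"
      unfolding eq by (simp only: integral_mult_right_zero Bochner_Integration.integral_diff[OF int] four four') simp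
  qed (use \<mu>i in simp)
  ultimately show ?thesis
    by eventually_elim (simp add: \<mu>_def complex_eq_iff)
qed

definition hermite_L2 :: "nat \<Rightarrow> real L2" where
  "hermite_L2 n = (1 / norm (to_L2 (\<lambda>t. complex_of_real (hermite_fun n t)))) *\<^sub>R
     to_L2 (\<lambda>t. complex_of_real (hermite_fun n t))"

lemma cinner_hermite_fun:
  assumes "square_integrable f"
  shows "cinner (to_L2 (\<lambda>t. complex_of_real (hermite_fun n t))) (to_L2 f)
    = (\<integral>t. complex_of_real (hermite_fun n t) * f t \<partial>lborel)"
  by (simp add: cinner_to_L2 square_integrable_hermite_fun assms)

lemma orthonormal_hermite:
  "cinner (hermite_L2 m) (hermite_L2 n) = (if m = n then 1 else 0)"
proof (cases "m = n")
  case True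
  have "norm (hermite_L2 n) = 1"
    using hermite_fun_nonzero[of n] by (simp add: hermite_L2_def)
  then show ?thesis using True by (simp add: cinner_self)
next
  case False
  have "(\<integral>t. complex_of_real (hermite_fun m t) * complex_of_real (hermite_fun n t) \<partial>lborel)
      = complex_of_real (\<integral>t. hermite_fun m t * hermite_fun n t \<partial>lborel)"
    unfolding of_real_mult[symmetric] by (rule integral_complex_of_real)
  then show ?thesis
    using False by (simp add: hermite_L2_def cinner_hermite_fun square_integrable_hermite_fun hermite_fun_orthogonal)
qed

lemma orthonormal_basis_hermite: "orthonormal_basis (range hermite_L2)"
proof -
  have inj: "hermite_L2 m = hermite_L2 n \<longleftrightarrow> m = n" for m n
    using orthonormal_hermite[of m n] orthonormal_hermite[of m m] by (metis zero_neq_one)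
  have "orthonormal (range hermite_L2)"
    by (auto simp: orthonormal_def orthonormal_hermite inj)
  moreover have "F = 0" if F: "\<forall>e\<in>range hermite_L2. cinner e F = 0" for F
  proof -
    obtain f where f: "square_integrable f" and Ff: "F = to_L2 f" by (rule L2_cases)
    have "(\<integral>t. complex_of_real (hermite_fun n t) * f t \<partial>lborel) = 0" for n
      using F hermite_fun_nonzero[of n] by (auto simp: hermite_L2_def Ff cinner_hermite_fun f)
    then show ?thesis
      using hermite_complete[OF f] by (simp add: Ff to_L2_eq_zero_iff f)
  qed
  ultimately show ?thesis unfolding orthonormal_basis_def by blast
qed

text \<open>Gives meaning to the \<open>SOME\<close> inside \<open>op_trace\<close>, which selects
  an actual basis only once one is known to exist.\<close>

lemma ex_orthonormal_basis_real: "\<exists>B::real L2 set. orthonormal_basis B"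
  using orthonormal_basis_hermite by blast

lemma ex_orthonormal_basis_plane: "\<exists>B::(real \<times> real) L2 set. orthonormal_basis B"
  using orthonormal_basis_tensor[OF orthonormal_basis_hermite orthonormal_basis_hermite] by auto

section \<open>Tensor products of operators\<close>

lemma onb_tensor_eqI:
  fixes T :: "('a::euclidean_space \<times> 'b::euclidean_space) L2 \<Rightarrow> 'c::euclidean_space L2"
  assumes B1: "orthonormal_basis B1" and B2: "orthonormal_basis B2"
    and T: "bounded_linear T" "\<And>c F. T (c *\<^sub>C F) = c *\<^sub>C T F"
    and l: "\<And>g. bounded_linear (\<lambda>f. \<beta> f g)" "\<And>c f g. \<beta> (c *\<^sub>C f) g = c *\<^sub>C \<beta> f g"
    and r: "\<And>f. bounded_linear (\<lambda>g. \<beta> f g)" "\<And>c f g. \<beta> f (c *\<^sub>C g) = c *\<^sub>C \<beta> f g"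
    and eq: "\<And>f g. f \<in> B1 \<Longrightarrow> g \<in> B2 \<Longrightarrow> T (tensor f g) = \<beta> f g"
  shows "T (tensor f g) = \<beta> f g"
proof -
  have 1: "T (tensor f g) = \<beta> f g" if "f \<in> B1" for f g
    by (rule onb_eqI[OF B2, of "\<lambda>g. T (tensor f g)" "\<beta> f"])
       (simp_all add: bounded_linear_compose[OF T(1) bounded_linear_tensor_right] T(2) tensor_bilinear r eq that)
  show ?thesis
    by (rule onb_eqI[OF B1, of "\<lambda>f. T (tensor f g)" "\<lambda>f. \<beta> f g"])
       (simp_all add: bounded_linear_compose[OF T(1) bounded_linear_tensor_left] T(2) tensor_bilinear l 1)
qed

text \<open>Uniqueness for the \<open>THE\<close> in \<open>tensor_op\<close>; identities between
  bounded operators on the plane are also checked this way, on product vectors only.\<close>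

lemma tensor_op_determined:
  fixes B1 :: "'a::euclidean_space L2 set" and B2 :: "'b::euclidean_space L2 set"
    and T :: "('a \<times> 'b) L2 \<Rightarrow> ('a \<times> 'b) L2"
  assumes B: "orthonormal_basis B1" "orthonormal_basis B2" "countable B2"
    and "bounded_op T" "bounded_op T'" and "\<And>f g. T (tensor f g) = T' (tensor f g)"
  shows "T = T'"
proof
  show "T F = T' F" for F
    by (rule onb_eqI[OF orthonormal_basis_tensor[OF B], of T T'])
       (use assms in \<open>auto simp: bounded_op_def\<close>)
qed

lemma tensor_inj_on:
  assumes "orthonormal B1" "orthonormal B2"
  shows "inj_on (\<lambda>(f, g). tensor f g) (B1 \<times> B2)"
proof (rule inj_onI, clarify)
  fix f g f' g' assume *: "f \<in> B1" "g \<in> B2" "f' \<in> B1" "g' \<in> B2" "tensor f g = tensor f' g'"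
  then have "cinner (tensor f g) (tensor f' g') = 1"
    using assms cinner_tensor[of f g f g] by (simp add: orthonormal_def)
  then have "cinner f f' * cinner g g' = 1" by (simp only: cinner_tensor)
  then show "f = f' \<and> g = g'"
    using assms * by (auto simp: orthonormal_def split: if_splits)
qed

lemma onb_tensor_extend:
  fixes B1 :: "'a::euclidean_space L2 set" and B2 :: "'b::euclidean_space L2 set"
    and \<beta> :: "'a L2 \<Rightarrow> 'b L2 \<Rightarrow> 'c::euclidean_space L2"
  assumes B: "orthonormal_basis B1" "orthonormal_basis B2" "countable B2" and K: "K > 0"
    and bound: "\<And>G c. finite G \<Longrightarrow> G \<subseteq> B1 \<times> B2 \<Longrightarrow>
      (norm (\<Sum>p\<in>G. c p *\<^sub>C \<beta> (fst p) (snd p)))\<^sup>2 \<le> K * (\<Sum>p\<in>G. (cmod (c p))\<^sup>2)"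
  shows "\<exists>T. bounded_linear T \<and> (\<forall>c F. T (c *\<^sub>C F) = c *\<^sub>C T F) \<and>
    (\<forall>f\<in>B1. \<forall>g\<in>B2. T (tensor f g) = \<beta> f g)"
proof -
  let ?t = "\<lambda>(f, g). tensor f g"
  let ?i = "inv_into (B1 \<times> B2) ?t"
  have inj: "inj_on ?t (B1 \<times> B2)"
    using B by (intro tensor_inj_on) (auto simp: orthonormal_basis_def)
  define \<tau> where "\<tau> e = \<beta> (fst (?i e)) (snd (?i e))" for e
  have inv: "?i (tensor f g) = (f, g)" if "f \<in> B1" "g \<in> B2" for f g
    using inv_into_f_f[OF inj, of "(f, g)"] that by simp
  have "\<exists>T. bounded_linear T \<and> (\<forall>c f. T (c *\<^sub>C f) = c *\<^sub>C T f) \<and> (\<forall>e\<in>?t ` (B1 \<times> B2). T e = \<tau> e)"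
  proof (rule onb_extend[OF orthonormal_basis_tensor[OF B] K])
    fix F :: "('a \<times> 'b) L2 set" and c :: "('a \<times> 'b) L2 \<Rightarrow> complex"
    assume F: "finite F" "F \<subseteq> ?t ` (B1 \<times> B2)"
    then obtain G where G: "G \<subseteq> B1 \<times> B2" "finite G" "F = ?t ` G"
      by (metis finite_subset_image)
    have injG: "inj_on ?t G" using inj G(1) by (rule inj_on_subset)
    have "(\<Sum>e\<in>F. c e *\<^sub>C \<tau> e) = (\<Sum>p\<in>G. c (?t p) *\<^sub>C \<beta> (fst p) (snd p))"
      unfolding G(3) sum.reindex[OF injG] o_def
      using G(1) by (intro sum.cong) (auto simp: \<tau>_def inv)
    moreover have "(\<Sum>e\<in>F. (cmod (c e))\<^sup>2) = (\<Sum>p\<in>G. (cmod (c (?t p)))\<^sup>2)"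
      unfolding G(3) sum.reindex[OF injG] o_def ..
    ultimately show "(norm (\<Sum>e\<in>F. c e *\<^sub>C \<tau> e))\<^sup>2 \<le> K * (\<Sum>e\<in>F. (cmod (c e))\<^sup>2)"
      using bound[OF G(2,1), of "\<lambda>p. c (?t p)"] by simp
  qed
  then obtain T where T: "bounded_linear T" "\<forall>c f. T (c *\<^sub>C f) = c *\<^sub>C T f"
    "\<forall>e\<in>?t ` (B1 \<times> B2). T e = \<tau> e" by blast
  have "T (tensor f g) = \<beta> f g" if "f \<in> B1" "g \<in> B2" for f g
    using T(3) that by (force simp: \<tau>_def inv)
  with T show ?thesis by blast
qed

text \<open>Grouping a finite combination by its second factor writes the image as a sum of vectors
  \<open>tensor (A (v g)) g\<close>, orthogonal for different \<open>g\<close>. Pythagoras then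
  reduces the bound to that of \<open>A\<close> on each \<open>v g\<close>, so the bound
  \<open>K\<close> of \<open>A\<close> is inherited.\<close>

lemma ex_tensor_op_left:
  fixes B1 :: "'a::euclidean_space L2 set" and B2 :: "'b::euclidean_space L2 set"
  assumes B: "orthonormal_basis B1" "orthonormal_basis B2" "countable B2" and A: "bounded_op A"
  shows "\<exists>T :: ('a \<times> 'b) L2 \<Rightarrow> ('a \<times> 'b) L2. bounded_op T \<and> (\<forall>f g. T (tensor f g) = tensor (A f) g)"
proof -
  have on: "orthonormal B1" "orthonormal B2"
    using B by (auto simp: orthonormal_basis_def)
  have A': "bounded_linear A" using A by (simp add: bounded_op_def)
  obtain K where K: "K > 0" "\<And>f. norm (A f) \<le> norm f * K"
    using bounded_linear.pos_bounded[OF A'] by blast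
  have bound: "(norm (\<Sum>p\<in>G. c p *\<^sub>C tensor (A (fst p)) (snd p)))\<^sup>2 \<le> K\<^sup>2 * (\<Sum>p\<in>G. (cmod (c p))\<^sup>2)"
    if G: "finite G" "G \<subseteq> B1 \<times> B2" for G and c :: "'a L2 \<times> 'b L2 \<Rightarrow> complex"
  proof -
    define v :: "'b L2 \<Rightarrow> 'a L2" where "v g = (\<Sum>p | p \<in> G \<and> snd p = g. c p *\<^sub>C fst p)" for g
    have "(\<Sum>p\<in>G. c p *\<^sub>C tensor (A (fst p)) (snd p))
        = (\<Sum>g\<in>snd ` G. \<Sum>p | p \<in> G \<and> snd p = g. c p *\<^sub>C tensor (A (fst p)) (snd p))"
      using G by (intro sum.group[symmetric]) auto
    also have "\<dots> = (\<Sum>g\<in>snd ` G. tensor (A (v g)) g)"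
    proof (rule sum.cong[OF refl])
      fix g :: "'b L2"
      interpret tl: bounded_linear "\<lambda>f :: 'a L2. tensor f g" by (rule bounded_linear_tensor_left)
      show "(\<Sum>p | p \<in> G \<and> snd p = g. c p *\<^sub>C tensor (A (fst p)) (snd p)) = tensor (A (v g)) g"
        unfolding v_def bounded_op_simps[OF A] tl.sum tensor_bilinear by (intro sum.cong) auto
    qed
    finally have "(norm (\<Sum>p\<in>G. c p *\<^sub>C tensor (A (fst p)) (snd p)))\<^sup>2
        = (\<Sum>g\<in>snd ` G. (norm (tensor (A (v g)) g))\<^sup>2)"
      using G on(2)
      by (simp, intro norm_sum_pythagoras) (auto simp: cinner_tensor orthonormal_def subset_iff)
    also have "\<dots> \<le> (\<Sum>g\<in>snd ` G. K\<^sup>2 * (\<Sum>p | p \<in> G \<and> snd p = g. (cmod (c p))\<^sup>2))"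
    proof (rule sum_mono)
      fix g assume "g \<in> snd ` G"
      then have "norm g = 1" using G on(2) by (auto intro: orthonormal_norm)
      then have "(norm (tensor (A (v g)) g))\<^sup>2 \<le> (norm (v g) * K)\<^sup>2"
        using K(2)[of "v g"] by (simp add: norm_tensor power_mono)
      also have "(norm (v g))\<^sup>2 = (\<Sum>p | p \<in> G \<and> snd p = g. (norm (c p *\<^sub>C fst p))\<^sup>2)"
        unfolding v_def
      proof (intro norm_sum_pythagoras)
        fix p q assume "p \<in> {p \<in> G. snd p = g}" "q \<in> {p \<in> G. snd p = g}" "p \<noteq> q"
        then have "fst p \<in> B1" "fst q \<in> B1" "fst p \<noteq> fst q"
          using G by (auto simp: prod_eq_iff)
        then show "cinner (c p *\<^sub>C fst p) (c q *\<^sub>C fst q) = 0"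
          using on(1) by (auto simp: orthonormal_def)
      qed (use G in simp)
      then have "(norm (v g) * K)\<^sup>2 = K\<^sup>2 * (\<Sum>p | p \<in> G \<and> snd p = g. (norm (c p *\<^sub>C fst p))\<^sup>2)"
        by (simp add: power_mult_distrib)
      also have "(\<Sum>p | p \<in> G \<and> snd p = g. (norm (c p *\<^sub>C fst p))\<^sup>2) = (\<Sum>p | p \<in> G \<and> snd p = g. (cmod (c p))\<^sup>2)"
        using G on(1) by (intro sum.cong) (auto simp: orthonormal_norm subset_iff)
      finally show "(norm (tensor (A (v g)) g))\<^sup>2 \<le> K\<^sup>2 * (\<Sum>p | p \<in> G \<and> snd p = g. (cmod (c p))\<^sup>2)" .
    qed
    also have "\<dots> = K\<^sup>2 * (\<Sum>p\<in>G. (cmod (c p))\<^sup>2)"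
      unfolding sum_distrib_left[symmetric] using G by (subst sum.group) auto
    finally show ?thesis .
  qed
  have "\<exists>T :: ('a \<times> 'b) L2 \<Rightarrow> ('a \<times> 'b) L2. bounded_linear T \<and> (\<forall>c F. T (c *\<^sub>C F) = c *\<^sub>C T F) \<and>
    (\<forall>f\<in>B1. \<forall>g\<in>B2. T (tensor f g) = tensor (A f) g)"
    by (rule onb_tensor_extend[OF B _ bound]) (use K(1) in auto)
  then obtain T :: "('a \<times> 'b) L2 \<Rightarrow> ('a \<times> 'b) L2"
    where T: "bounded_linear T" "\<forall>c F. T (c *\<^sub>C F) = c *\<^sub>C T F"
    "\<forall>f\<in>B1. \<forall>g\<in>B2. T (tensor f g) = tensor (A f) g" by blast
  have "T (tensor f g) = tensor (A f) g" for f g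
    by (rule onb_tensor_eqI[OF B(1,2) T(1), of "\<lambda>f g. tensor (A f) g"])
       (use T in \<open>simp_all add: bounded_op_simps[OF A] tensor_bilinear bounded_linear_tensor_right
          bounded_linear_compose[OF bounded_linear_tensor_left A']\<close>)
  with T show ?thesis unfolding bounded_op_def by blast
qed

text \<open>The flip permutes orthonormal families of products, hence preserves norms; it turns
  operators on the first factor into operators on the second.\<close>

lemma ex_tensor_swap:
  fixes B1 :: "'a::euclidean_space L2 set" and B2 :: "'b::euclidean_space L2 set"
  assumes B: "orthonormal_basis B1" "orthonormal_basis B2" "countable B2"
  shows "\<exists>T :: ('a \<times> 'b) L2 \<Rightarrow> ('b \<times> 'a) L2. bounded_linear T \<and> (\<forall>c F. T (c *\<^sub>C F) = c *\<^sub>C T F) \<and>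
    (\<forall>f g. T (tensor f g) = tensor g f)"
proof -
  have on: "orthonormal B1" "orthonormal B2"
    using B by (auto simp: orthonormal_basis_def)
  have bound: "(norm (\<Sum>p\<in>G. c p *\<^sub>C tensor (snd p) (fst p)))\<^sup>2 \<le> 1 * (\<Sum>p\<in>G. (cmod (c p))\<^sup>2)"
    if G: "finite G" "G \<subseteq> B1 \<times> B2" for G and c :: "'a L2 \<times> 'b L2 \<Rightarrow> complex"
  proof -
    have orth: "cinner (tensor (snd p) (fst p)) (tensor (snd q) (fst q)) = 0"
      if "p \<in> G" "q \<in> G" "p \<noteq> q" for p q
    proof -
      have "fst p \<in> B1" "snd p \<in> B2" "fst q \<in> B1" "snd q \<in> B2" using that G by auto
      moreover have "fst p \<noteq> fst q \<or> snd p \<noteq> snd q" using that by (auto simp: prod_eq_iff)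
      ultimately show ?thesis using on by (auto simp: cinner_tensor orthonormal_def)
    qed
    have "(norm (\<Sum>p\<in>G. c p *\<^sub>C tensor (snd p) (fst p)))\<^sup>2
        = (\<Sum>p\<in>G. (norm (c p *\<^sub>C tensor (snd p) (fst p)))\<^sup>2)"
      using G(1) by (intro norm_sum_pythagoras) (simp_all add: orth)
    also have "\<dots> = (\<Sum>p\<in>G. (cmod (c p))\<^sup>2)"
      using G on by (intro sum.cong) (auto simp: norm_tensor orthonormal_norm subset_iff)
    finally show ?thesis by simp
  qed
  have "\<exists>T :: ('a \<times> 'b) L2 \<Rightarrow> ('b \<times> 'a) L2. bounded_linear T \<and> (\<forall>c F. T (c *\<^sub>C F) = c *\<^sub>C T F) \<and>
    (\<forall>f\<in>B1. \<forall>g\<in>B2. T (tensor f g) = tensor g f)"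
    by (rule onb_tensor_extend[OF B _ bound]) auto
  then obtain T :: "('a \<times> 'b) L2 \<Rightarrow> ('b \<times> 'a) L2"
    where T: "bounded_linear T" "\<forall>c F. T (c *\<^sub>C F) = c *\<^sub>C T F"
    "\<forall>f\<in>B1. \<forall>g\<in>B2. T (tensor f g) = tensor g f" by blast
  have "T (tensor f g) = tensor g f" for f g
    by (rule onb_tensor_eqI[OF B(1,2) T(1), of "\<lambda>f g. tensor g f"])
       (use T in \<open>simp_all add: tensor_bilinear bounded_linear_tensor_right bounded_linear_tensor_left\<close>)
  with T show ?thesis by blast
qed

text \<open>Conjugation of the operator on the left factor by the flip.\<close>

lemma ex_tensor_op_right:
  fixes B1 :: "'a::euclidean_space L2 set" and B2 :: "'b::euclidean_space L2 set"
  assumes B: "orthonormal_basis B1" "countable B1" "orthonormal_basis B2" "countable B2" and A: "bounded_op A"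
  shows "\<exists>T :: ('a \<times> 'b) L2 \<Rightarrow> ('a \<times> 'b) L2. bounded_op T \<and> (\<forall>f g. T (tensor f g) = tensor f (A g))"
proof -
  obtain S :: "('b \<times> 'a) L2 \<Rightarrow> ('b \<times> 'a) L2" where S: "bounded_op S" "\<forall>f g. S (tensor f g) = tensor (A f) g"
    using ex_tensor_op_left[OF B(3,1,2) A] by blast
  obtain U :: "('a \<times> 'b) L2 \<Rightarrow> ('b \<times> 'a) L2" where U: "bounded_linear U"
    "\<forall>c F. U (c *\<^sub>C F) = c *\<^sub>C U F" "\<forall>f g. U (tensor f g) = tensor g f"
    using ex_tensor_swap[OF B(1,3,4)] by blast
  obtain V :: "('b \<times> 'a) L2 \<Rightarrow> ('a \<times> 'b) L2" where V: "bounded_linear V"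
    "\<forall>c F. V (c *\<^sub>C F) = c *\<^sub>C V F" "\<forall>f g. V (tensor f g) = tensor g f"
    using ex_tensor_swap[OF B(3,1,2)] by blast
  have "bounded_linear (\<lambda>F. V (S (U F)))"
    using S(1) unfolding bounded_op_def
    by (intro bounded_linear_compose[OF V(1) bounded_linear_compose[OF _ U(1)]]) simp
  then have "bounded_op (\<lambda>F. V (S (U F)))"
    unfolding bounded_op_def using U(2) V(2) by (simp add: bounded_op_simps[OF S(1)])
  then show ?thesis
    using S(2) U(3) V(3) by (intro exI[of _ "\<lambda>F. V (S (U F))"]) simp
qed

lemma countable_hermite: "countable (range hermite_L2)"
  by simp

lemmas plane_determined =
  tensor_op_determined[OF orthonormal_basis_hermite orthonormal_basis_hermite countable_hermite]

lemma tensor_op_eqI: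
  fixes T :: "(real \<times> real) L2 \<Rightarrow> (real \<times> real) L2"
  assumes "bounded_op T" "\<And>f g. T (tensor f g) = tensor (A f) (B g)"
  shows "tensor_op A B = T"
  unfolding tensor_op_def
proof (rule the_equality)
  fix T' :: "(real \<times> real) L2 \<Rightarrow> (real \<times> real) L2"
  assume "bounded_op T' \<and> (\<forall>f g. T' (tensor f g) = tensor (A f) (B g))"
  then show "T' = T"
    using assms by (intro plane_determined) auto
qed (use assms in auto)

lemma tensor_op_left:
  fixes A :: "real L2 \<Rightarrow> real L2"
  assumes A: "bounded_op A"
  shows "bounded_op (tensor_op A (id :: real L2 \<Rightarrow> real L2))"
    "tensor_op A (id :: real L2 \<Rightarrow> real L2) (tensor f g) = tensor (A f) g"
proof -
  obtain T :: "(real \<times> real) L2 \<Rightarrow> (real \<times> real) L2"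
    where "bounded_op T" "\<And>f g. T (tensor f g) = tensor (A f) g"
    using ex_tensor_op_left[OF orthonormal_basis_hermite orthonormal_basis_hermite countable_hermite A] by blast
  then show "bounded_op (tensor_op A (id :: real L2 \<Rightarrow> real L2))"
    "tensor_op A (id :: real L2 \<Rightarrow> real L2) (tensor f g) = tensor (A f) g"
    using tensor_op_eqI[of T A id] by auto
qed

lemma tensor_op_right:
  fixes A :: "real L2 \<Rightarrow> real L2"
  assumes A: "bounded_op A"
  shows "bounded_op (tensor_op (id :: real L2 \<Rightarrow> real L2) A)"
    "tensor_op (id :: real L2 \<Rightarrow> real L2) A (tensor f g) = tensor f (A g)"
proof -
  obtain T :: "(real \<times> real) L2 \<Rightarrow> (real \<times> real) L2"
    where "bounded_op T" "\<And>f g. T (tensor f g) = tensor f (A g)"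
    using ex_tensor_op_right[OF orthonormal_basis_hermite countable_hermite
        orthonormal_basis_hermite countable_hermite A] by blast
  then show "bounded_op (tensor_op (id :: real L2 \<Rightarrow> real L2) A)"
    "tensor_op (id :: real L2 \<Rightarrow> real L2) A (tensor f g) = tensor f (A g)"
    using tensor_op_eqI[of T id A] by auto
qed

lemma tensor_op_ket_bra:
  fixes u v :: "real L2"
  shows "tensor_op (ket_bra u) (ket_bra v) = ket_bra (tensor u v)"
proof (rule tensor_op_eqI)
  show "bounded_op (ket_bra (tensor u v))"
    unfolding ket_bra_def[abs_def] by (rule bounded_op_rank_one)
qed (simp add: ket_bra_def cinner_tensor tensor_bilinear mult.commute)

text \<open>Both sides are continuous, so the identity extends from basis vectors in one argument
  and then in the other.\<close>

lemma onb_adjointI: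
  assumes B: "orthonormal_basis B" and T: "bounded_op T" and T': "bounded_op T'"
    and eq: "\<And>e e'. e \<in> B \<Longrightarrow> e' \<in> B \<Longrightarrow> cinner (T e) e' = cinner e (T' e')"
  shows "cinner (T f) g = cinner f (T' g)"
proof -
  have expand: "((\<lambda>e. cinner e f * cinner h (S e)) has_sum cinner h (S f)) B"
    if "bounded_op S" for h f S
    using has_sum_bounded_linear[OF bounded_linear_cinner_right[of h]
        has_sum_bounded_linear[OF _ onb_expansion[OF B, of f], of S]] that
    by (simp add: bounded_op_def)
  have 1: "cinner (T f) e' = cinner f (T' e')" if e': "e' \<in> B" for f e'
  proof -
    have "cinner e' (T f) = cinner (T' e') f"
    proof (rule has_sum_unique[OF expand[OF T, of f e']])
      have "cinner e f * cinner e' (T e) = cinner e f * cinner (T' e') e" if "e \<in> B" for e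
        using eq[OF that e'] by (metis cinner_commute)
      then show "((\<lambda>e. cinner e f * cinner e' (T e)) has_sum cinner (T' e') f) B"
        using onb_parseval[OF B, of f "T' e'"]
          has_sum_cong[of B "\<lambda>e. cinner e f * cinner e' (T e)" "\<lambda>e. cinner e f * cinner (T' e') e"] by blast
    qed
    then show ?thesis by (metis cinner_commute)
  qed
  show ?thesis
  proof (rule has_sum_unique[OF onb_parseval[OF B, of g "T f"]])
    show "((\<lambda>e. cinner e g * cinner (T f) e) has_sum cinner f (T' g)) B"
      using expand[OF T', of g f] 1
        has_sum_cong[of B "\<lambda>e. cinner e g * cinner (T f) e" "\<lambda>e. cinner e g * cinner f (T' e)"] by simp
  qed
qed

lemma tensor_adjointI:
  fixes T T' :: "(real \<times> real) L2 \<Rightarrow> (real \<times> real) L2"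
  assumes "bounded_op T" "bounded_op T'"
    and "\<And>f g f' g'. cinner (T (tensor f g)) (tensor f' g') = cinner (tensor f g) (T' (tensor f' g'))"
  shows "cinner (T F) G = cinner F (T' G)"
  by (rule onb_adjointI[OF orthonormal_basis_tensor[OF orthonormal_basis_hermite
        orthonormal_basis_hermite countable_hermite] assms(1,2)]) (use assms(3) in auto)

section \<open>Diagonal operators and their square roots\<close>

definition onb_family :: "('i \<Rightarrow> 'a::euclidean_space L2) \<Rightarrow> bool" where
  "onb_family E \<longleftrightarrow> inj E \<and> orthonormal_basis (range E)"

text \<open>The maximal multiplication operator in coordinates. The domain is implicit: a pair
  belongs to the graph as soon as the scaled coefficients are those of some element of L^2, that is,
  are square summable.\<close>

definition diag_op :: "('i \<Rightarrow> 'a::euclidean_space L2) \<Rightarrow> ('i \<Rightarrow> real) \<Rightarrow> 'a unbounded_op" where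
  "diag_op E \<mu> = {(f, g). \<forall>i. cinner (E i) g = of_real (\<mu> i) * cinner (E i) f}"

lemma onb_family_cinner:
  assumes "onb_family E"
  shows "cinner (E i) (E j) = (if i = j then 1 else 0)"
proof -
  have "cinner (E i) (E j) = (if E i = E j then 1 else 0)"
    using assms unfolding onb_family_def orthonormal_basis_def orthonormal_def by blast
  then show ?thesis using assms by (simp add: onb_family_def inj_eq)
qed

lemma onb_family_eqI:
  assumes "onb_family E" "\<And>i. cinner (E i) f = cinner (E i) g"
  shows "f = g"
proof -
  have "f - g = 0"
    using assms unfolding onb_family_def orthonormal_basis_def
    by (metis (no_types, lifting) cinner_diff_right diff_self rangeE)
  then show ?thesis by simp
qed

lemma onb_family_expansion:
  assumes "onb_family E"
  shows "((\<lambda>i. cinner (E i) f *\<^sub>C E i) has_sum f) UNIV"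
proof -
  have "inj_on E UNIV" "orthonormal_basis (range E)" using assms by (auto simp: onb_family_def)
  then show ?thesis
    using onb_expansion[of "range E" f] has_sum_reindex[of E UNIV "\<lambda>e. cinner e f *\<^sub>C e" f] by (simp add: o_def)
qed

lemma onb_family_parseval:
  assumes "onb_family E"
  shows "((\<lambda>i. cinner g (E i) * cinner (E i) f) has_sum cinner g f) UNIV"
  using has_sum_bounded_linear[OF bounded_linear_cinner_right[of g] onb_family_expansion[OF assms, of f]]
  unfolding cinner_scaleC_right by (simp only: mult.commute)

lemma onb_family_parseval_norm:
  assumes "onb_family E"
  shows "((\<lambda>i. (cmod (cinner (E i) f))\<^sup>2) has_sum (norm f)\<^sup>2) UNIV"
proof -
  have "cinner f (E i) * cinner (E i) f = of_real ((cmod (cinner (E i) f))\<^sup>2)" for i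
    using complex_norm_square[of "cinner (E i) f"] by (simp add: cinner_commute[of f] mult.commute)
  then have "((\<lambda>i. complex_of_real ((cmod (cinner (E i) f))\<^sup>2)) has_sum of_real ((norm f)\<^sup>2)) UNIV"
    using onb_family_parseval[OF assms, of f f] unfolding cinner_self by simp
  then show ?thesis by (simp only: has_sum_of_real_iff)
qed

lemma onb_family_riesz_fischer:
  fixes E :: "'i \<Rightarrow> 'a::euclidean_space L2"
  assumes E: "onb_family E" and c: "(\<lambda>i. (cmod (c i))\<^sup>2) summable_on UNIV"
  shows "\<exists>f. \<forall>i. cinner (E i) f = c i"
proof -
  have "(\<lambda>i. c i *\<^sub>C E i) summable_on UNIV"
  proof (rule summable_on_of_norm_bound[where K = 1 and w = "\<lambda>i. (cmod (c i))\<^sup>2"])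
    fix F :: "'i set" assume F: "finite F"
    have nE: "norm (E i) = 1" for i
      using E orthonormal_norm[of "range E" "E i"] by (simp add: onb_family_def orthonormal_basis_def)
    have "(norm (\<Sum>i\<in>F. c i *\<^sub>C E i))\<^sup>2 = (\<Sum>i\<in>F. (norm (c i *\<^sub>C E i))\<^sup>2)"
      using F by (intro norm_sum_pythagoras) (simp_all add: onb_family_cinner[OF E])
    then show "(norm (\<Sum>i\<in>F. c i *\<^sub>C E i))\<^sup>2 \<le> 1 * (\<Sum>i\<in>F. (cmod (c i))\<^sup>2)"
      by (simp add: nE)
  qed (use c in auto)
  then obtain f where f: "((\<lambda>i. c i *\<^sub>C E i) has_sum f) UNIV" by (auto simp: summable_on_def)
  have "cinner (E j) f = c j" for j
  proof (rule has_sum_unique)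
    show "((\<lambda>i. cinner (E j) (c i *\<^sub>C E i)) has_sum cinner (E j) f) UNIV"
      by (rule has_sum_bounded_linear[OF bounded_linear_cinner_right f])
    show "((\<lambda>i. cinner (E j) (c i *\<^sub>C E i)) has_sum c j) UNIV"
      by (rule has_sum_finite_neutralI[of "{j}"]) (simp_all add: onb_family_cinner[OF E])
  qed
  then show ?thesis by blast
qed

lemma diag_op_eigen: "onb_family E \<Longrightarrow> (E i, of_real (\<mu> i) *\<^sub>C E i) \<in> diag_op E \<mu>"
  by (simp add: diag_op_def onb_family_cinner)

lemma diag_op_sum:
  assumes E: "onb_family E" and F: "finite F"
  shows "((\<Sum>i\<in>F. c i *\<^sub>C E i), (\<Sum>i\<in>F. c i *\<^sub>C of_real (\<mu> i) *\<^sub>C E i)) \<in> diag_op E \<mu>"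
proof -
  have "cinner (E j) (\<Sum>i\<in>F. c i *\<^sub>C of_real (\<mu> i) *\<^sub>C E i)
      = of_real (\<mu> j) * cinner (E j) (\<Sum>i\<in>F. c i *\<^sub>C E i)" for j
    unfolding cinner_sum_right sum_distrib_left
    by (intro sum.cong) (auto simp: onb_family_cinner[OF E])
  then show ?thesis by (simp add: diag_op_def)
qed

text \<open>Finite combinations of eigenvectors are dense and lie in the domain. Testing the adjoint
  on eigenvectors returns the defining coordinate condition, so the adjoint is no larger; Parseval
  gives the other inclusion.\<close>

lemma diag_op_self_adjoint:
  fixes E :: "'i \<Rightarrow> 'a::euclidean_space L2"
  assumes E: "onb_family E"
  shows "self_adjoint (diag_op E \<mu>)"
  unfolding self_adjoint_def
proof
  show "closure (Domain (diag_op E \<mu>)) = UNIV"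
  proof (intro equalityI subset_UNIV subsetI)
    fix f :: "'a L2"
    show "f \<in> closure (Domain (diag_op E \<mu>))"
      unfolding closure_approachable
    proof safe
      fix e :: real assume "0 < e"
      then obtain F where "finite F" "dist (\<Sum>i\<in>F. cinner (E i) f *\<^sub>C E i) f \<le> e / 2"
        using has_sum_finite_approximation[OF onb_family_expansion[OF E, of f], of "e / 2"] by auto
      with \<open>0 < e\<close> show "\<exists>y\<in>Domain (diag_op E \<mu>). dist y f < e"
        using diag_op_sum[OF E, of F "\<lambda>i. cinner (E i) f"]
        by (intro bexI[of _ "\<Sum>i\<in>F. cinner (E i) f *\<^sub>C E i"]) auto
    qed
  qed
  show "op_adjoint (diag_op E \<mu>) = diag_op E \<mu>"
  proof (intro equalityI subsetI; clarify)
    fix f g assume fg: "(f, g) \<in> op_adjoint (diag_op E \<mu>)"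
    have "cinner (E i) g = of_real (\<mu> i) * cinner (E i) f" for i
    proof -
      have "cinner f (of_real (\<mu> i) *\<^sub>C E i) = cinner g (E i)"
        using fg diag_op_eigen[OF E, of i \<mu>] by (auto simp: op_adjoint_def)
      then have "cnj (of_real (\<mu> i) * cinner f (E i)) = cnj (cinner g (E i))" by simp
      then show ?thesis
        by (simp add: cinner_commute[of f "E i"] cinner_commute[of g "E i"])
    qed
    then show "(f, g) \<in> diag_op E \<mu>" by (simp add: diag_op_def)
  next
    fix f g assume fg: "(f, g) \<in> diag_op E \<mu>"
    have "cinner f k = cinner g h" if hk: "(h, k) \<in> diag_op E \<mu>" for h k
    proof (rule has_sum_unique[OF onb_family_parseval[OF E, of f k]])
      have "cinner f (E i) * cinner (E i) k = cinner g (E i) * cinner (E i) h" for i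
        using fg hk by (simp add: diag_op_def cinner_commute[of f] cinner_commute[of g])
      then show "((\<lambda>i. cinner f (E i) * cinner (E i) k) has_sum cinner g h) UNIV"
        using onb_family_parseval[OF E, of g h] by (simp only:)
    qed
    then show "(f, g) \<in> op_adjoint (diag_op E \<mu>)" by (auto simp: op_adjoint_def)
  qed
qed

lemma diag_op_nonneg:
  assumes E: "onb_family E" and \<mu>: "\<And>i. 0 \<le> \<mu> i"
  shows "nonneg_op (diag_op E \<mu>)"
  unfolding nonneg_op_def
proof clarify
  fix f g assume fg: "(f, g) \<in> diag_op E \<mu>"
  have "((\<lambda>i. Re (cinner f (E i) * cinner (E i) g)) has_sum Re (cinner f g)) UNIV"
    by (rule has_sum_Re[OF onb_family_parseval[OF E]])
  moreover have "Re (cinner f (E i) * cinner (E i) g) = \<mu> i * (cmod (cinner (E i) f))\<^sup>2" for i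
  proof -
    have "cinner f (E i) * cinner (E i) g = of_real (\<mu> i) * (cinner (E i) f * cnj (cinner (E i) f))"
      using fg by (simp add: diag_op_def cinner_commute[of f])
    then show ?thesis
      unfolding complex_norm_square[symmetric] by (simp del: of_real_power)
  qed
  ultimately have "((\<lambda>i. \<mu> i * (cmod (cinner (E i) f))\<^sup>2) has_sum Re (cinner f g)) UNIV"
    by (simp only:)
  then show "0 \<le> Re (cinner f g)"
    by (rule has_sum_nonneg) (use \<mu> in simp)
qed

text \<open>The nontrivial inclusion needs an intermediate vector. Its squared coefficients are
  products of a coefficient of \<open>f\<close> and one of \<open>h\<close>, hence dominated by the
  sum of their squares, and Riesz-Fischer supplies the vector.\<close>

lemma diag_op_square:
  assumes E: "onb_family E"
  shows "diag_op E \<nu> O diag_op E \<nu> = diag_op E (\<lambda>i. (\<nu> i)\<^sup>2)"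
proof (intro equalityI subsetI; clarify)
  fix f g h assume "(f, g) \<in> diag_op E \<nu>" "(g, h) \<in> diag_op E \<nu>"
  then show "(f, h) \<in> diag_op E (\<lambda>i. (\<nu> i)\<^sup>2)"
    by (simp add: diag_op_def power2_eq_square mult.assoc)
next
  fix f h assume fh: "(f, h) \<in> diag_op E (\<lambda>i. (\<nu> i)\<^sup>2)"
  let ?c = "\<lambda>i. of_real (\<nu> i) * cinner (E i) f"
  have "(\<lambda>i. (cmod (?c i))\<^sup>2) summable_on UNIV"
  proof (rule summable_on_comparison_test)
    show "(\<lambda>i. (cmod (cinner (E i) f))\<^sup>2 + (cmod (cinner (E i) h))\<^sup>2) summable_on UNIV"
      by (intro summable_on_add has_sum_imp_summable[OF onb_family_parseval_norm[OF E]])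
    fix i
    have "cmod (cinner (E i) h) = (\<nu> i)\<^sup>2 * cmod (cinner (E i) f)"
      using fh by (simp add: diag_op_def norm_mult norm_power)
    then have "(cmod (?c i))\<^sup>2 = cmod (cinner (E i) f) * cmod (cinner (E i) h)"
      by (simp add: norm_mult power2_eq_square mult_ac)
    also have "\<dots> \<le> (cmod (cinner (E i) f))\<^sup>2 + (cmod (cinner (E i) h))\<^sup>2"
      using sum_squares_bound[of "cmod (cinner (E i) f)" "cmod (cinner (E i) h)"]
        mult_nonneg_nonneg[OF norm_ge_zero norm_ge_zero, of "cinner (E i) f" "cinner (E i) h"] by linarith
    finally show "(cmod (?c i))\<^sup>2 \<le> (cmod (cinner (E i) f))\<^sup>2 + (cmod (cinner (E i) h))\<^sup>2" .
  qed simp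
  from onb_family_riesz_fischer[OF E this] obtain g where g: "\<forall>i. cinner (E i) g = ?c i" ..
  then have "(f, g) \<in> diag_op E \<nu>" "(g, h) \<in> diag_op E \<nu>"
    using fh by (simp_all add: diag_op_def power2_eq_square mult.assoc)
  then show "(f, h) \<in> diag_op E \<nu> O diag_op E \<nu>" by blast
qed

text \<open>
  A nonnegative self-adjoint square root \<open>D\<close> is forced on eigenvectors by
  \<open>(D + \<nu>) (D - \<nu>) e = 0\<close>, and a self-adjoint operator has no proper self-adjoint extension.
\<close>

lemma op_sqrt_diag_op:
  fixes E :: "'i \<Rightarrow> 'a::euclidean_space L2"
  assumes E: "onb_family E" and \<nu>: "\<And>i. 0 \<le> \<nu> i"
  shows "op_sqrt (diag_op E (\<lambda>i. (\<nu> i)\<^sup>2)) = diag_op E \<nu>"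
  unfolding op_sqrt_def
proof (rule the_equality)
  show "self_adjoint (diag_op E \<nu>) \<and> nonneg_op (diag_op E \<nu>) \<and>
      diag_op E \<nu> O diag_op E \<nu> = diag_op E (\<lambda>i. (\<nu> i)\<^sup>2)"
    using E \<nu> by (simp add: diag_op_self_adjoint diag_op_nonneg diag_op_square)
next
  fix D :: "'a unbounded_op"
  assume "self_adjoint D \<and> nonneg_op D \<and> D O D = diag_op E (\<lambda>i. (\<nu> i)\<^sup>2)"
  then have adj: "op_adjoint D = D" and pos: "\<And>f g. (f, g) \<in> D \<Longrightarrow> 0 \<le> Re (cinner f g)"
    and sq: "D O D = diag_op E (\<lambda>i. (\<nu> i)\<^sup>2)"
    by (auto simp: self_adjoint_def nonneg_op_def)
  have sym: "cinner f k = cinner g h" if "(f, g) \<in> D" "(h, k) \<in> D" for f g h k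
  proof -
    have "(f, g) \<in> op_adjoint D" using that adj by simp
    then show ?thesis using that(2) unfolding op_adjoint_def by blast
  qed
  \<comment> \<open>\<open>D\<close> is only a set of pairs; its linearity follows from
    \<open>op_adjoint D = D\<close>, because adjoints are always linear.\<close>
  have lin: "(f - c *\<^sub>C f', g - c *\<^sub>C g') \<in> D" if "(f, g) \<in> D" "(f', g') \<in> D" for f g f' g' c
  proof -
    have "(f - c *\<^sub>C f', g - c *\<^sub>C g') \<in> op_adjoint D"
      using sym[OF that(1)] sym[OF that(2)] by (auto simp: op_adjoint_def cinner_diff_left)
    then show ?thesis by (simp add: adj)
  qed
  have eig: "(E i, of_real (\<nu> i) *\<^sub>C E i) \<in> D" for i
  proof -
    have "(E i, of_real ((\<nu> i)\<^sup>2) *\<^sub>C E i) \<in> D O D"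
      unfolding sq by (rule diag_op_eigen[OF E])
    then obtain g where g: "(E i, g) \<in> D" "(g, of_real ((\<nu> i)\<^sup>2) *\<^sub>C E i) \<in> D" by blast
    show ?thesis
    proof (cases "\<nu> i = 0")
      case True
      \<comment> \<open>For the eigenvalue 0 the factorization gives no sign information; instead
        symmetry yields the norm of \<open>D e\<close> from \<open>D (D e) = 0\<close>.\<close>
      then have "cinner g g = 0" using sym[OF g(1) g(2)] by simp
      then have "g = 0" by (simp add: cinner_self)
      then show ?thesis using g(1) True by simp
    next
      case False
      define w where "w = g - of_real (\<nu> i) *\<^sub>C E i"
      have "(w, of_real ((\<nu> i)\<^sup>2) *\<^sub>C E i - of_real (\<nu> i) *\<^sub>C g) \<in> D"
        unfolding w_def by (rule lin[OF g(2,1)])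
      moreover have "of_real ((\<nu> i)\<^sup>2) *\<^sub>C E i - of_real (\<nu> i) *\<^sub>C g = (- of_real (\<nu> i)) *\<^sub>C w"
        by (simp add: w_def scaleC_diff_right scaleC_minus_left power2_eq_square)
      ultimately have "0 \<le> Re (cinner w ((- of_real (\<nu> i)) *\<^sub>C w))" using pos by metis
      then have "\<nu> i * (norm w)\<^sup>2 \<le> 0" by (simp add: cinner_self del: of_real_power)
      then have "w = 0" using False \<nu>[of i] by (simp add: mult_le_0_iff)
      then show ?thesis using g(1) by (simp add: w_def)
    qed
  qed
  have sub: "D \<subseteq> diag_op E \<nu>"
  proof clarify
    fix f g assume fg: "(f, g) \<in> D"
    have "cinner (E i) g = of_real (\<nu> i) * cinner (E i) f" for i
      using sym[OF eig fg, of i] by simp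
    then show "(f, g) \<in> diag_op E \<nu>" by (simp add: diag_op_def)
  qed
  have "diag_op E \<nu> = op_adjoint (diag_op E \<nu>)"
    using diag_op_self_adjoint[OF E, of \<nu>] by (simp add: self_adjoint_def)
  also have "\<dots> \<subseteq> op_adjoint D" using sub by (auto simp: op_adjoint_def)
  finally show "D = diag_op E \<nu>" using sub adj by auto
qed

lemma op_apply_diag_op:
  assumes E: "onb_family E" and fg: "(f, g) \<in> diag_op E \<mu>"
  shows "op_apply (diag_op E \<mu>) f = g"
  unfolding op_apply_def
proof (rule the_equality)
  show "(f, g) \<in> diag_op E \<mu>" by (rule fg)
next
  fix g' assume "(f, g') \<in> diag_op E \<mu>"
  then show "g' = g" using fg by (intro onb_family_eqI[OF E]) (simp add: diag_op_def)
qed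

section \<open>Two-sided control of \<open>trace_conj\<close> for diagonal operators\<close>

text \<open>Finitely many eigenvectors form one of the orthonormal systems in the supremum, and on
  them the operator merely scales by \<nu>.\<close>

lemma trace_conj_diag_op_ge:
  assumes E: "onb_family E" and Q: "bounded_op Q" and F: "finite F"
    and pos: "\<And>f. 0 \<le> Re (cinner f (Q f))"
  shows "ennreal (\<Sum>i\<in>F. (\<nu> i)\<^sup>2 * Re (cinner (E i) (Q (E i)))) \<le> trace_conj (diag_op E \<nu>) Q"
proof -
  have inj: "inj_on E F" using E by (auto simp: onb_family_def inj_on_def)
  have "ennreal (\<Sum>i\<in>F. (\<nu> i)\<^sup>2 * Re (cinner (E i) (Q (E i))))
      = (\<Sum>i\<in>F. ennreal ((\<nu> i)\<^sup>2 * Re (cinner (E i) (Q (E i)))))"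
    using pos by (intro sum_ennreal[symmetric]) simp
  also have "\<dots> = (\<Sum>e\<in>E ` F. ennreal (Re (cinner (op_apply (diag_op E \<nu>) e) (Q (op_apply (diag_op E \<nu>) e)))))"
    unfolding sum.reindex[OF inj] o_def op_apply_diag_op[OF E diag_op_eigen[OF E]]
    by (simp add: bounded_op_simps[OF Q] power2_eq_square mult.assoc)
  also have "\<dots> \<le> trace_conj (diag_op E \<nu>) Q"
    unfolding trace_conj_def
  proof (rule SUP_upper, safe)
    show "orthonormal (E ` F)"
      using E unfolding onb_family_def orthonormal_basis_def orthonormal_def by blast
    show "E i \<in> Domain (diag_op E \<nu>)" for i
      using diag_op_eigen[OF E] by blast
  qed (use F in simp)
  finally show ?thesis .
qed

text \<open>The supremum runs over all orthonormal systems in the domain. By symmetry the operator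
  is moved from the test vectors to \<open>\<psi> k\<close>, giving \<open>\<phi> k\<close>;
  Bessel's inequality then bounds each sum by the squared norm of \<open>\<phi> k\<close>, which is
  the expectation of the squared operator in \<open>\<psi> k\<close>.\<close>

lemma trace_conj_diag_op_le:
  fixes E :: "'i \<Rightarrow> 'a::euclidean_space L2" and \<psi> \<xi> :: "'k \<Rightarrow> 'a L2"
  assumes E: "onb_family E" and K: "finite K" and w: "\<And>k. k \<in> K \<Longrightarrow> 0 \<le> w k"
    and Q: "\<And>f. Q f = (\<Sum>k\<in>K. w k *\<^sub>R cinner (\<psi> k) f *\<^sub>C \<psi> k)"
    and dom: "\<And>k. k \<in> K \<Longrightarrow> (\<psi> k, \<xi> k) \<in> diag_op E (\<lambda>i. (\<nu> i)\<^sup>2)"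
  shows "trace_conj (diag_op E \<nu>) Q \<le> ennreal (\<Sum>k\<in>K. w k * Re (cinner (\<psi> k) (\<xi> k)))"
proof -
  have "\<forall>k\<in>K. \<exists>\<phi>. (\<psi> k, \<phi>) \<in> diag_op E \<nu> \<and> (\<phi>, \<xi> k) \<in> diag_op E \<nu>"
    using dom unfolding diag_op_square[OF E, symmetric] by blast
  then obtain \<phi> where \<phi>: "\<And>k. k \<in> K \<Longrightarrow> (\<psi> k, \<phi> k) \<in> diag_op E \<nu>"
    "\<And>k. k \<in> K \<Longrightarrow> (\<phi> k, \<xi> k) \<in> diag_op E \<nu>" by metis
  have sym: "cinner f k = cinner g h"
    if "(f, g) \<in> diag_op E \<nu>" "(h, k) \<in> diag_op E \<nu>" for f g h k
    using diag_op_self_adjoint[OF E, of \<nu>] that unfolding self_adjoint_def op_adjoint_def by blast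
  show ?thesis
    unfolding trace_conj_def
  proof (rule SUP_least, clarify)
    fix F assume F: "finite F" "orthonormal F" "F \<subseteq> Domain (diag_op E \<nu>)"
    let ?D = "op_apply (diag_op E \<nu>)"
    have summand: "Re (cinner (?D e) (Q (?D e))) = (\<Sum>k\<in>K. w k * (cmod (cinner e (\<phi> k)))\<^sup>2)" if e: "e \<in> F" for e
    proof -
      obtain d where d: "(e, d) \<in> diag_op E \<nu>" using F e by blast
      have De: "?D e = d" by (rule op_apply_diag_op[OF E d])
      have "cinner d (Q d) = (\<Sum>k\<in>K. of_real (w k) * (cinner (\<psi> k) d * cinner d (\<psi> k)))"
        by (simp add: Q cinner_sum_right)
      also have "\<dots> = (\<Sum>k\<in>K. of_real (w k) * (cinner (\<phi> k) e * cinner e (\<phi> k)))"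
      proof (rule sum.cong[OF refl])
        fix k assume k: "k \<in> K"
        show "of_real (w k) * (cinner (\<psi> k) d * cinner d (\<psi> k)) = of_real (w k) * (cinner (\<phi> k) e * cinner e (\<phi> k))"
          using sym[OF \<phi>(1)[OF k] d] sym[OF d \<phi>(1)[OF k]] by simp
      qed
      also have "\<dots> = of_real (\<Sum>k\<in>K. w k * (cmod (cinner e (\<phi> k)))\<^sup>2)"
        unfolding cinner_commute[of "\<phi> _" e] of_real_sum of_real_mult complex_norm_square
        by (simp only: mult.commute)
      finally show ?thesis by (simp add: De)
    qed
    have "(\<Sum>e\<in>F. ennreal (Re (cinner (?D e) (Q (?D e)))))
        = ennreal (\<Sum>e\<in>F. \<Sum>k\<in>K. w k * (cmod (cinner e (\<phi> k)))\<^sup>2)"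
      using w by (simp add: summand sum_ennreal sum_nonneg)
    also have "(\<Sum>e\<in>F. \<Sum>k\<in>K. w k * (cmod (cinner e (\<phi> k)))\<^sup>2)
        = (\<Sum>k\<in>K. w k * (\<Sum>e\<in>F. (cmod (cinner e (\<phi> k)))\<^sup>2))"
      by (subst sum.swap) (simp add: sum_distrib_left)
    also have "ennreal \<dots> \<le> ennreal (\<Sum>k\<in>K. w k * Re (cinner (\<psi> k) (\<xi> k)))"
    proof (intro ennreal_leI sum_mono mult_left_mono w)
      fix k assume k: "k \<in> K"
      have "(\<Sum>e\<in>F. (cmod (cinner e (\<phi> k)))\<^sup>2) \<le> (norm (\<phi> k))\<^sup>2"
        using F by (intro orthonormal_bessel[of F]) auto
      also have "\<dots> = Re (cinner (\<phi> k) (\<phi> k))" by (simp add: cinner_self del: of_real_power)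
      also have "cinner (\<phi> k) (\<phi> k) = cinner (\<psi> k) (\<xi> k)"
        using sym[OF \<phi>(1)[OF k] \<phi>(2)[OF k]] by simp
      finally show "(\<Sum>e\<in>F. (cmod (cinner e (\<phi> k)))\<^sup>2) \<le> Re (cinner (\<psi> k) (\<xi> k))" .
    qed
    finally show "(\<Sum>e\<in>F. ennreal (Re (cinner (?D e) (Q (?D e)))))
        \<le> ennreal (\<Sum>k\<in>K. w k * Re (cinner (\<psi> k) (\<xi> k)))" .
  qed
qed

section \<open>Schwartz functions on the plane\<close>

text \<open>Keeps the class of polynomials times Gaussians closed under both partial derivatives, as
  the coinductive definition of \<open>schwartz\<close> demands.\<close>

lemma real_polynomial_function_plane_derivative:
  fixes p :: "real \<times> real \<Rightarrow> real"
  assumes "real_polynomial_function p"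
  shows "\<exists>px py. real_polynomial_function px \<and> real_polynomial_function py \<and>
    (\<forall>z. (p has_derivative (\<lambda>(s, t). s * px z + t * py z)) (at z))"
  using assms
proof induction
  case (linear h)
  have "h = (\<lambda>(s, t). s * h (1, 0) + t * h (0, 1))"
  proof (clarsimp simp: fun_eq_iff)
    fix s t
    interpret bounded_linear h by fact
    have "h (s, t) = h (s *\<^sub>R (1, 0) + t *\<^sub>R (0, 1))" by simp
    then show "h (s, t) = s * h (1, 0) + t * h (0, 1)" by (simp only: add scaleR real_scaleR_def)
  qed
  then show ?case
    using bounded_linear_imp_has_derivative[OF linear]
    by (intro exI[of _ "\<lambda>z. h (1, 0)"] exI[of _ "\<lambda>z. h (0, 1)"]) auto
next
  case (const c)
  show ?case
    by (intro exI[of _ "\<lambda>z. 0"]) (auto simp: case_prod_beta')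
next
  case (add p q)
  then obtain px py qx qy where *: "real_polynomial_function px" "real_polynomial_function py"
    "real_polynomial_function qx" "real_polynomial_function qy"
    "\<And>z. (p has_derivative (\<lambda>(s, t). s * px z + t * py z)) (at z)"
    "\<And>z. (q has_derivative (\<lambda>(s, t). s * qx z + t * qy z)) (at z)" by blast
  show ?case
    by (intro exI[of _ "\<lambda>z. px z + qx z"] exI[of _ "\<lambda>z. py z + qy z"] conjI allI
        real_polynomial_function.intros(3) * has_derivative_eq_rhs[OF has_derivative_add[OF *(5,6)]])
       (auto simp: algebra_simps)
next
  case (mult p q)
  then obtain px py qx qy where *: "real_polynomial_function px" "real_polynomial_function py"
    "real_polynomial_function qx" "real_polynomial_function qy"
    "\<And>z. (p has_derivative (\<lambda>(s, t). s * px z + t * py z)) (at z)"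
    "\<And>z. (q has_derivative (\<lambda>(s, t). s * qx z + t * qy z)) (at z)" by blast
  show ?case
    by (intro exI[of _ "\<lambda>z. p z * qx z + px z * q z"] exI[of _ "\<lambda>z. p z * qy z + py z * q z"] conjI allI
        real_polynomial_function.intros(3,4) * mult.hyps has_derivative_eq_rhs[OF has_derivative_mult[OF *(5,6)]])
       (auto simp: algebra_simps)
qed

text \<open>Up to normalization the product of the coherent states centred at \<alpha> and \<beta>,
  with \<kappa> standing for Planck's constant.\<close>

definition plane_gaussian :: "real \<Rightarrow> real \<Rightarrow> real \<Rightarrow> real \<times> real \<Rightarrow> real" where
  "plane_gaussian \<kappa> \<alpha> \<beta> z = exp (- ((fst z - \<alpha>)\<^sup>2 + (snd z - \<beta>)\<^sup>2) / (2 * \<kappa>))"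

lemma plane_gaussian_decay:
  fixes p :: "real \<times> real \<Rightarrow> real"
  assumes \<kappa>: "\<kappa> > 0" and p: "real_polynomial_function p"
  shows "\<exists>K. \<forall>z. norm z ^ k * \<bar>p z * plane_gaussian \<kappa> \<alpha> \<beta> z\<bar> \<le> K"
proof -
  obtain K c where K: "0 \<le> K" "\<And>z. \<bar>p z\<bar> \<le> K * exp (c * norm z)"
    using real_polynomial_function_growth[OF p] by blast
  \<comment> \<open>The shift of the centre costs only a linear term in the exponent, and
    \<open>d\<close> is its rate by Cauchy-Schwarz.\<close>
  define d where "d = norm (\<alpha>, \<beta>) / \<kappa>"
  obtain L where L: "L \<ge> 0" "\<And>r. r \<ge> 0 \<Longrightarrow> exp ((c + d) * r - (1 / (2 * \<kappa>)) * r\<^sup>2) \<le> L / (1 + r\<^sup>2)^k"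
    using exp_linear_gaussian_bound[of "1 / (2 * \<kappa>)" "c + d" k] \<kappa> by auto
  have "norm z ^ k * \<bar>p z * plane_gaussian \<kappa> \<alpha> \<beta> z\<bar> \<le> K * L" for z
  proof -
    have "- ((fst z - \<alpha>)\<^sup>2 + (snd z - \<beta>)\<^sup>2) \<le> 2 * inner z (\<alpha>, \<beta>) - (norm z)\<^sup>2"
      by (simp add: norm_prod_def inner_prod_def power2_eq_square algebra_simps)
    also have "\<dots> \<le> 2 * (norm z * norm (\<alpha>, \<beta>)) - (norm z)\<^sup>2"
      using norm_cauchy_schwarz[of z "(\<alpha>, \<beta>)"] by simp
    finally have "plane_gaussian \<kappa> \<alpha> \<beta> z \<le> exp ((2 * (norm z * norm (\<alpha>, \<beta>)) - (norm z)\<^sup>2) / (2 * \<kappa>))"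
      unfolding plane_gaussian_def exp_le_cancel_iff by (rule divide_right_mono) (use \<kappa> in simp)
    also have "(2 * (norm z * norm (\<alpha>, \<beta>)) - (norm z)\<^sup>2) / (2 * \<kappa>) = d * norm z - (1 / (2 * \<kappa>)) * (norm z)\<^sup>2"
      using \<kappa> by (simp add: d_def field_simps)
    finally have "\<bar>p z * plane_gaussian \<kappa> \<alpha> \<beta> z\<bar>
        \<le> K * exp (c * norm z) * exp (d * norm z - (1 / (2 * \<kappa>)) * (norm z)\<^sup>2)"
      unfolding abs_mult using K by (intro mult_mono) (auto simp: plane_gaussian_def)
    also have "\<dots> = K * exp ((c + d) * norm z - (1 / (2 * \<kappa>)) * (norm z)\<^sup>2)"
      by (simp add: mult_exp_exp algebra_simps)
    also have "\<dots> \<le> K * (L / (1 + (norm z)\<^sup>2)^k)"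
      using K(1) by (intro mult_left_mono L) auto
    finally have "\<bar>p z * plane_gaussian \<kappa> \<alpha> \<beta> z\<bar> * (1 + (norm z)\<^sup>2)^k \<le> K * L"
      by (simp add: pos_le_divide_eq add_pos_nonneg)
    moreover have "norm z ^ k \<le> (1 + (norm z)\<^sup>2)^k"
    proof (rule power_mono)
      have "2 * norm z \<le> 1 + (norm z)\<^sup>2" using sum_squares_bound[of 1 "norm z"] by simp
      then show "norm z \<le> 1 + (norm z)\<^sup>2" using norm_ge_zero[of z] by linarith
    qed simp
    then have "norm z ^ k * \<bar>p z * plane_gaussian \<kappa> \<alpha> \<beta> z\<bar>
        \<le> (1 + (norm z)\<^sup>2)^k * \<bar>p z * plane_gaussian \<kappa> \<alpha> \<beta> z\<bar>"
      by (rule mult_right_mono) simp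
    ultimately show ?thesis by (simp add: mult.commute)
  qed
  then show ?thesis by blast
qed

lemma plane_gaussian_derivative:
  assumes "\<kappa> > 0"
  shows "(plane_gaussian \<kappa> \<alpha> \<beta> has_derivative (\<lambda>(s, t).
    s * (- (fst z - \<alpha>) / \<kappa> * plane_gaussian \<kappa> \<alpha> \<beta> z) + t * (- (snd z - \<beta>) / \<kappa> * plane_gaussian \<kappa> \<alpha> \<beta> z))) (at z)"
  unfolding plane_gaussian_def[abs_def] using assms
  by (auto intro!: derivative_eq_intros simp: fun_eq_iff field_simps)

text \<open>Coinduction with the invariant "polynomial times this fixed Gaussian": such functions
  decay faster than any power, and so do their partial derivatives, which are of the same
  form.\<close>

lemma schwartz_poly_gaussian:
  assumes \<kappa>: "\<kappa> > 0" and "real_polynomial_function p"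
  shows "schwartz (\<lambda>z. complex_of_real (p z * plane_gaussian \<kappa> \<alpha> \<beta> z))"
proof -
  let ?X = "\<lambda>f. \<exists>p. real_polynomial_function p \<and> f = (\<lambda>z. complex_of_real (p z * plane_gaussian \<kappa> \<alpha> \<beta> z))"
  have "?X (\<lambda>z. complex_of_real (p z * plane_gaussian \<kappa> \<alpha> \<beta> z))" using assms by blast
  then show ?thesis
  proof (rule schwartz.coinduct[of ?X])
    fix f assume "?X f"
    then obtain p where p: "real_polynomial_function p"
      and f: "f = (\<lambda>z. complex_of_real (p z * plane_gaussian \<kappa> \<alpha> \<beta> z))" by blast
    obtain px py where d: "real_polynomial_function px" "real_polynomial_function py"
      "\<And>z. (p has_derivative (\<lambda>(s, t). s * px z + t * py z)) (at z)"
      using real_polynomial_function_plane_derivative[OF p] by blast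
    define qx where "qx z = px z + (- 1 / \<kappa>) * (fst z - \<alpha>) * p z" for z :: "real \<times> real"
    define qy where "qy z = py z + (- 1 / \<kappa>) * (snd z - \<beta>) * p z" for z :: "real \<times> real"
    have q: "real_polynomial_function qx" "real_polynomial_function qy"
      unfolding qx_def[abs_def] qy_def[abs_def]
      by (intro real_polynomial_function.intros(2-4) real_polynomial_function_diff d p
          real_polynomial_function.intros(1) bounded_linear_fst bounded_linear_snd)+
    have "bounded (range (\<lambda>z. norm z ^ k *\<^sub>R f z))" for k
    proof -
      obtain K where "\<And>z. norm z ^ k * \<bar>p z * plane_gaussian \<kappa> \<alpha> \<beta> z\<bar> \<le> K"
        using plane_gaussian_decay[OF \<kappa> p] by blast
      then show ?thesis
        unfolding bounded_iff f by (intro exI[of _ K]) (auto simp: norm_power norm_mult abs_mult)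
    qed
    moreover have "(f has_derivative (\<lambda>(s, t).
        s *\<^sub>R complex_of_real (qx z * plane_gaussian \<kappa> \<alpha> \<beta> z)
          + t *\<^sub>R complex_of_real (qy z * plane_gaussian \<kappa> \<alpha> \<beta> z))) (at z)" for z
    proof -
      let ?G = "plane_gaussian \<kappa> \<alpha> \<beta> z"
      have eq: "p z * (s * (- (fst z - \<alpha>) / \<kappa> * ?G) + t * (- (snd z - \<beta>) / \<kappa> * ?G))
          + (s * px z + t * py z) * ?G = s * (qx z * ?G) + t * (qy z * ?G)" for s t
        using \<kappa> by (simp add: qx_def qy_def field_simps)
      show ?thesis
        unfolding f
        by (rule has_derivative_eq_rhs[OF has_derivative_of_real[OF has_derivative_mult[OF d(3) plane_gaussian_derivative[OF \<kappa>]]]])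
           (simp only: fun_eq_iff split_paired_All case_prod_conv eq scaleR_conv_of_real of_real_mult[symmetric] of_real_add[symmetric] simp_thms)
    qed
    ultimately show "\<exists>f' fx fy. f = f' \<and> (\<forall>k. bounded (range (\<lambda>p. norm p ^ k *\<^sub>R f' p))) \<and>
        (\<forall>p. (f' has_derivative (\<lambda>(s, t). s *\<^sub>R fx p + t *\<^sub>R fy p)) (at p)) \<and>
        (?X fx \<or> schwartz fx) \<and> (?X fy \<or> schwartz fy)"
      using q by (intro exI[of _ f] exI[of _ "\<lambda>z. complex_of_real (qx z * plane_gaussian \<kappa> \<alpha> \<beta> z)"]
          exI[of _ "\<lambda>z. complex_of_real (qy z * plane_gaussian \<kappa> \<alpha> \<beta> z)"]) blast
  qed
qed

lemma schwartz_partials: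
  assumes "schwartz f"
  obtains fx fy where "schwartz fx" "schwartz fy"
    "\<And>p. (f has_derivative (\<lambda>(s, t). s *\<^sub>R fx p + t *\<^sub>R fy p)) (at p)"
    "dx_minus_dy f = (\<lambda>p. fx p - fy p)"
proof -
  obtain fx fy where *: "schwartz fx" "schwartz fy"
    "\<And>p. (f has_derivative (\<lambda>(s, t). s *\<^sub>R fx p + t *\<^sub>R fy p)) (at p)"
    using assms by (cases rule: schwartz.cases) blast
  have "dx_minus_dy f p = fx p - fy p" for p
    unfolding dx_minus_dy_def frechet_derivative_at[OF *(3), symmetric] by simp
  then have "dx_minus_dy f = (\<lambda>p. fx p - fy p)" by (rule ext)
  with * show ?thesis by (rule that)
qed

lemma schwartz_bound:
  assumes "schwartz f"
  obtains K where "\<And>z. norm z ^ k * cmod (f z) \<le> K"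
proof -
  have "bounded (range (\<lambda>z. norm z ^ k *\<^sub>R f z))"
    using assms by (cases rule: schwartz.cases) blast
  then obtain K where "\<And>z. norm (norm z ^ k *\<^sub>R f z) \<le> K" unfolding bounded_iff by auto
  then show ?thesis by (intro that[of K]) (simp add: norm_power)
qed

text \<open>Coinduction again, the invariant being the set of combinations of Schwartz functions
  with the coefficients \<open>c\<close> and \<open>d\<close> held fixed.\<close>

lemma schwartz_lincomb:
  assumes "schwartz f" "schwartz g"
  shows "schwartz (\<lambda>p. c * f p + d * g p)"
proof -
  let ?X = "\<lambda>h. \<exists>f g. schwartz f \<and> schwartz g \<and> h = (\<lambda>p. c * f p + d * g p)"
  have "?X (\<lambda>p. c * f p + d * g p)" using assms by blast
  then show ?thesis
  proof (rule schwartz.coinduct[of ?X])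
    fix h assume "?X h"
    then obtain f g where f: "schwartz f" and g: "schwartz g" and h: "h = (\<lambda>p. c * f p + d * g p)" by blast
    obtain fx fy where f': "schwartz fx" "schwartz fy"
      "\<And>p. (f has_derivative (\<lambda>(s, t). s *\<^sub>R fx p + t *\<^sub>R fy p)) (at p)"
      and "dx_minus_dy f = (\<lambda>p. fx p - fy p)"
      by (rule schwartz_partials[OF f]) blast
    obtain gx gy where g': "schwartz gx" "schwartz gy"
      "\<And>p. (g has_derivative (\<lambda>(s, t). s *\<^sub>R gx p + t *\<^sub>R gy p)) (at p)"
      and "dx_minus_dy g = (\<lambda>p. gx p - gy p)"
      by (rule schwartz_partials[OF g]) blast
    have "bounded (range (\<lambda>z. norm z ^ k *\<^sub>R h z))" for k
    proof -
      obtain K where K: "\<And>z. norm z ^ k * cmod (f z) \<le> K" using schwartz_bound[OF f] by blast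
      obtain L where L: "\<And>z. norm z ^ k * cmod (g z) \<le> L" using schwartz_bound[OF g] by blast
      have "norm (norm z ^ k *\<^sub>R h z) \<le> cmod c * K + cmod d * L" for z
      proof -
        have "norm (norm z ^ k *\<^sub>R h z) \<le> norm z ^ k * (cmod c * cmod (f z) + cmod d * cmod (g z))"
          unfolding h norm_scaleR
          by (intro mult_mono order_trans[OF norm_triangle_ineq]) (auto simp: norm_mult norm_power)
        also have "\<dots> = cmod c * (norm z ^ k * cmod (f z)) + cmod d * (norm z ^ k * cmod (g z))"
          by (simp add: algebra_simps)
        also have "\<dots> \<le> cmod c * K + cmod d * L"
          by (intro add_mono mult_left_mono K L) auto
        finally show ?thesis .
      qed
      then show ?thesis unfolding bounded_iff by (intro exI[of _ "cmod c * K + cmod d * L"]) simp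
    qed
    moreover have "(h has_derivative (\<lambda>(s, t). s *\<^sub>R (c * fx p + d * gx p) + t *\<^sub>R (c * fy p + d * gy p))) (at p)" for p
      unfolding h
      by (rule has_derivative_eq_rhs[OF has_derivative_add[OF has_derivative_mult_right[OF f'(3)]
            has_derivative_mult_right[OF g'(3)]]])
         (auto simp: fun_eq_iff scaleR_conv_of_real algebra_simps)
    ultimately show "\<exists>f' fx fy. h = f' \<and> (\<forall>k. bounded (range (\<lambda>p. norm p ^ k *\<^sub>R f' p))) \<and>
        (\<forall>p. (f' has_derivative (\<lambda>(s, t). s *\<^sub>R fx p + t *\<^sub>R fy p)) (at p)) \<and>
        (?X fx \<or> schwartz fx) \<and> (?X fy \<or> schwartz fy)"
      using f'(1,2) g'(1,2)
      by (intro exI[of _ h] exI[of _ "\<lambda>p. c * fx p + d * gx p"] exI[of _ "\<lambda>p. c * fy p + d * gy p"]) blast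
  qed
qed

lemma schwartz_dx_minus_dy:
  assumes "schwartz f"
  shows "schwartz (dx_minus_dy f)"
proof -
  obtain fx fy where "schwartz fx" "schwartz fy" "dx_minus_dy f = (\<lambda>p. fx p - fy p)"
    by (rule schwartz_partials[OF assms]) blast
  then show ?thesis using schwartz_lincomb[of fx fy 1 "-1"] by simp
qed

lemma dx_minus_dy_lincomb:
  assumes "schwartz f" "schwartz g"
  shows "dx_minus_dy (\<lambda>p. c * f p + d * g p) = (\<lambda>p. c * dx_minus_dy f p + d * dx_minus_dy g p)"
proof
  fix p
  obtain fx fy where "schwartz fx" "schwartz fy"
    and f': "\<And>p. (f has_derivative (\<lambda>(s, t). s *\<^sub>R fx p + t *\<^sub>R fy p)) (at p)"
    "dx_minus_dy f = (\<lambda>p. fx p - fy p)"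
    by (rule schwartz_partials[OF assms(1)]) blast
  obtain gx gy where "schwartz gx" "schwartz gy"
    and g': "\<And>p. (g has_derivative (\<lambda>(s, t). s *\<^sub>R gx p + t *\<^sub>R gy p)) (at p)"
    "dx_minus_dy g = (\<lambda>p. gx p - gy p)"
    by (rule schwartz_partials[OF assms(2)]) blast
  have "((\<lambda>p. c * f p + d * g p) has_derivative
      (\<lambda>h. c * (case h of (s, t) \<Rightarrow> s *\<^sub>R fx p + t *\<^sub>R fy p) + d * (case h of (s, t) \<Rightarrow> s *\<^sub>R gx p + t *\<^sub>R gy p))) (at p)"
    by (intro has_derivative_add has_derivative_mult_right f' g')
  then show "dx_minus_dy (\<lambda>p. c * f p + d * g p) p = c * dx_minus_dy f p + d * dx_minus_dy g p"
    unfolding dx_minus_dy_def[of "\<lambda>p. c * f p + d * g p"] f'(2) g'(2)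
    by (simp add: frechet_derivative_at[symmetric] algebra_simps)
qed

lemma cost_expr_lincomb:
  assumes "schwartz f" "schwartz g"
  shows "cost_expr hbar (\<lambda>p. c * f p + d * g p) = (\<lambda>p. c * cost_expr hbar f p + d * cost_expr hbar g p)"
  unfolding cost_expr_def dx_minus_dy_lincomb[OF assms]
    dx_minus_dy_lincomb[OF schwartz_dx_minus_dy[OF assms(1)] schwartz_dx_minus_dy[OF assms(2)]]
  by (auto simp: fun_eq_iff scaleR_conv_of_real algebra_simps)

section \<open>Measurability, decay and square integrability of Schwartz functions\<close>

lemma schwartz_continuous:
  assumes "schwartz f"
  shows "continuous_on UNIV f"
proof -
  obtain fx fy where "\<And>p. (f has_derivative (\<lambda>(s, t). s *\<^sub>R fx p + t *\<^sub>R fy p)) (at p)"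
    by (rule schwartz_partials[OF assms]) blast
  then show ?thesis
    by (intro continuous_at_imp_continuous_on ballI) (rule has_derivative_continuous)
qed

lemma schwartz_decay:
  assumes "schwartz f"
  obtains K where "0 \<le> K" "\<And>x y. norm (x, y) ^ k * cmod (f (x, y)) \<le> K / ((1 + x\<^sup>2) * (1 + y\<^sup>2))"
proof -
  \<comment> \<open>The exponents k, k + 2 and k + 4 are what \<open>1 + r\<^sup>2 + r^4\<close>
    consumes, a radial majorant of the product weight
    \<open>(1 + x\<^sup>2) * (1 + y\<^sup>2)\<close>.\<close>
  obtain K0 where K0: "\<And>z. norm z ^ k * cmod (f z) \<le> K0" using schwartz_bound[OF assms] by blast
  obtain K2 where K2: "\<And>z. norm z ^ (k + 2) * cmod (f z) \<le> K2" using schwartz_bound[OF assms] by blast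
  obtain K4 where K4: "\<And>z. norm z ^ (k + 4) * cmod (f z) \<le> K4" using schwartz_bound[OF assms] by blast
  have le: "norm (x, y) ^ k * cmod (f (x, y)) \<le> (K0 + K2 + K4) / ((1 + x\<^sup>2) * (1 + y\<^sup>2))" for x y
  proof -
    define r where "r = norm (x, y)"
    have r2: "r\<^sup>2 = x\<^sup>2 + y\<^sup>2" by (simp add: r_def norm_Pair)
    have "x\<^sup>2 * y\<^sup>2 \<le> r\<^sup>2 * r\<^sup>2" by (intro mult_mono) (auto simp: r2)
    moreover have "r\<^sup>2 * r\<^sup>2 = r^4" by (simp flip: power_add)
    moreover have "(1 + x\<^sup>2) * (1 + y\<^sup>2) = 1 + r\<^sup>2 + x\<^sup>2 * y\<^sup>2" by (simp add: r2 algebra_simps)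
    ultimately have "(1 + x\<^sup>2) * (1 + y\<^sup>2) \<le> 1 + r\<^sup>2 + r^4" by linarith
    then have "(r ^ k * cmod (f (x, y))) * ((1 + x\<^sup>2) * (1 + y\<^sup>2)) \<le> (r ^ k * cmod (f (x, y))) * (1 + r\<^sup>2 + r^4)"
      by (intro mult_left_mono) (auto simp: r_def)
    also have "\<dots> = r ^ k * cmod (f (x, y)) + r ^ (k + 2) * cmod (f (x, y)) + r ^ (k + 4) * cmod (f (x, y))"
      by (simp only: power_add distrib_left mult_ac mult_1_right)
    also have "\<dots> \<le> K0 + K2 + K4" unfolding r_def by (intro add_mono K0 K2 K4)
    finally show ?thesis
      unfolding r_def by (subst pos_le_divide_eq) (auto intro!: mult_pos_pos add_pos_nonneg)
  qed
  moreover have "0 \<le> K0 + K2 + K4"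
    using order_trans[OF _ le[of 0 0]] by simp
  ultimately show ?thesis using that by blast
qed

lemma square_integrable_plane_decay:
  assumes f: "f \<in> borel_measurable borel"
    and K: "\<And>x y. cmod (f (x, y)) \<le> K / ((1 + x\<^sup>2) * (1 + y\<^sup>2))"
  shows "square_integrable f"
proof -
  let ?u = "\<lambda>t::real. complex_of_real (1 / (1 + t\<^sup>2))"
  have "square_integrable ?u"
  proof -
    have "norm ((cmod (?u t))\<^sup>2) \<le> 1 / (1 + t\<^sup>2)" for t
    proof -
      have "1 / (1 + t\<^sup>2) \<le> 1" by (simp add: add_pos_nonneg)
      then have "1 / (1 + t\<^sup>2) * (1 / (1 + t\<^sup>2)) \<le> 1 * (1 / (1 + t\<^sup>2))"
        by (rule mult_right_mono) simp
      moreover have "norm ((cmod (?u t))\<^sup>2) = 1 / (1 + t\<^sup>2) * (1 / (1 + t\<^sup>2))"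
        by (simp only: norm_of_real power2_abs real_norm_def abs_power2) (simp only: power2_eq_square)
      ultimately show ?thesis by simp
    qed
    then have "integrable lborel (\<lambda>t. (cmod (?u t))\<^sup>2)"
      by (intro integrable_of_decay[where K = 1]) measurable
    then show ?thesis unfolding square_integrable_def by simp
  qed
  then have s: "square_integrable (\<lambda>p. K * (case p of (x, y) \<Rightarrow> ?u x * ?u y))"
    by (intro square_integrable_cmult square_integrable_tensor)
  have "cmod (f p) \<le> cmod (K * (case p of (x, y) \<Rightarrow> ?u x * ?u y))" for p
  proof (cases p)
    case (Pair x y)
    have "K * (case p of (x, y) \<Rightarrow> ?u x * ?u y) = complex_of_real (K / ((1 + x\<^sup>2) * (1 + y\<^sup>2)))"
      by (simp add: Pair)
    then have "cmod (K * (case p of (x, y) \<Rightarrow> ?u x * ?u y)) = \<bar>K / ((1 + x\<^sup>2) * (1 + y\<^sup>2))\<bar>"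
      by (simp only: norm_of_real)
    then show ?thesis using K[of x y] abs_ge_self[of "K / ((1 + x\<^sup>2) * (1 + y\<^sup>2))"] by (simp only: Pair)
  qed
  then have le: "(cmod (f p))\<^sup>2 \<le> (cmod (K * (case p of (x, y) \<Rightarrow> ?u x * ?u y)))\<^sup>2" for p
    by (intro power_mono) auto
  show ?thesis
    unfolding square_integrable_def
  proof
    show "integrable lborel (\<lambda>x. (cmod (f x))\<^sup>2)"
    proof (rule Bochner_Integration.integrable_bound[OF s[unfolded square_integrable_def, THEN conjunct2]])
      show "(\<lambda>x. (cmod (f x))\<^sup>2) \<in> borel_measurable lborel" using f by simp
      have "norm ((cmod (f p))\<^sup>2) \<le> norm ((cmod (K * (case p of (x, y) \<Rightarrow> ?u x * ?u y)))\<^sup>2)" for p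
        unfolding real_norm_def abs_power2 by (rule le)
      then show "AE p in lborel. norm ((cmod (f p))\<^sup>2) \<le> norm ((cmod (K * (case p of (x, y) \<Rightarrow> ?u x * ?u y)))\<^sup>2)"
        by (rule AE_I2)
    qed
  qed (use f in simp)
qed

lemma schwartz_borel: "schwartz f \<Longrightarrow> f \<in> borel_measurable borel"
  by (intro borel_measurable_continuous_onI schwartz_continuous)

lemma schwartz_square_integrable:
  assumes "schwartz f"
  shows "square_integrable f"
proof -
  obtain K where "\<And>x y. norm (x, y) ^ 0 * cmod (f (x, y)) \<le> K / ((1 + x\<^sup>2) * (1 + y\<^sup>2))"
    using schwartz_decay[OF assms] by blast
  then show ?thesis
    by (intro square_integrable_plane_decay schwartz_borel assms) simp
qed

lemma schwartz_square_integrable_mult: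
  assumes "schwartz f"
  shows "square_integrable (\<lambda>(x, y). complex_of_real ((x - y)\<^sup>2) * f (x, y))"
proof -
  obtain K where K: "\<And>x y. norm (x, y) ^ 2 * cmod (f (x, y)) \<le> K / ((1 + x\<^sup>2) * (1 + y\<^sup>2))"
    using schwartz_decay[OF assms] by blast
  have [measurable]: "f \<in> borel_measurable (borel \<Otimes>\<^sub>M borel)"
    using schwartz_borel[OF assms] by (simp add: borel_prod)
  show ?thesis
  proof (rule square_integrable_plane_decay)
    show "(\<lambda>(x, y). complex_of_real ((x - y)\<^sup>2) * f (x, y)) \<in> borel_measurable borel"
      unfolding borel_prod[symmetric] by measurable
    fix x y :: real
    have "(x - y)\<^sup>2 \<le> 2 * (norm (x, y))\<^sup>2"
      using zero_le_power2[of "x + y"] by (simp add: norm_Pair power2_eq_square algebra_simps)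
    then have "(x - y)\<^sup>2 * cmod (f (x, y)) \<le> 2 * ((norm (x, y))\<^sup>2 * cmod (f (x, y)))"
      by (simp add: mult_right_mono flip: mult.assoc)
    also have "\<dots> \<le> 2 * (K / ((1 + x\<^sup>2) * (1 + y\<^sup>2)))" by (intro mult_left_mono K) simp
    finally show "cmod (case (x, y) of (x, y) \<Rightarrow> complex_of_real ((x - y)\<^sup>2) * f (x, y))
        \<le> (2 * K) / ((1 + x\<^sup>2) * (1 + y\<^sup>2))"
      by (simp add: norm_mult norm_power flip: of_real_diff)
  qed
qed

section \<open>The transport cost is diagonal in a rotated Hermite basis\<close>

lemma integration_by_parts_decay:
  fixes u v u' v' :: "real \<Rightarrow> complex"
  assumes d: "\<And>t. (u has_vector_derivative u' t) (at t)" "\<And>t. (v has_vector_derivative v' t) (at t)"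
    and c: "continuous_on UNIV u'" "continuous_on UNIV v'"
    and K: "\<And>t. cmod (u t) \<le> K / (1 + t\<^sup>2)" "\<And>t. cmod (v t) \<le> K / (1 + t\<^sup>2)"
      "\<And>t. cmod (u' t) \<le> K / (1 + t\<^sup>2)" "\<And>t. cmod (v' t) \<le> K / (1 + t\<^sup>2)"
  shows "(\<integral>t. cnj (u t) * v' t + cnj (u' t) * v t \<partial>lborel) = 0"
proof (rule integral_derivative_zero[where F = "\<lambda>t. cnj (u t) * v t" and K = "K * K" and L = "2 * (K * K)"])
  have K0: "0 \<le> K" using order_trans[OF norm_ge_zero K(1)[of 0]] by simp
  have prod: "cmod (cnj w * z) \<le> (K * K) / (1 + t\<^sup>2)"
    if "cmod w \<le> K / (1 + t\<^sup>2)" "cmod z \<le> K / (1 + t\<^sup>2)" for w z and t :: real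
  proof -
    have "K / (1 + t\<^sup>2) \<le> K / 1" using K0 by (intro divide_left_mono) (auto simp: add_pos_nonneg)
    then have "cmod w * cmod z \<le> K * (K / (1 + t\<^sup>2))"
      using that K0 by (intro mult_mono) auto
    then show ?thesis by (simp add: norm_mult)
  qed
  fix t
  show "((\<lambda>t. cnj (u t) * v t) has_vector_derivative cnj (u t) * v' t + cnj (u' t) * v t) (at t)"
    by (intro has_vector_derivative_mult has_vector_derivative_cnj d)
  show "cmod (cnj (u t) * v t) \<le> (K * K) / (1 + t\<^sup>2)" by (intro prod K)
  show "cmod (cnj (u t) * v' t + cnj (u' t) * v t) \<le> 2 * (K * K) / (1 + t\<^sup>2)"
    using norm_triangle_le[OF add_mono[OF prod[OF K(1)[of t] K(4)[of t]] prod[OF K(3)[of t] K(2)[of t]]]] by simp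
next
  have "continuous_on UNIV u" "continuous_on UNIV v"
    using d by (meson has_vector_derivative_continuous continuous_at_imp_continuous_on)+
  then show "continuous_on UNIV (\<lambda>t. cnj (u t) * v' t + cnj (u' t) * v t)"
    using c by (intro continuous_intros)
qed

lemma schwartz_slice_bound:
  assumes "schwartz f"
  obtains K where "0 \<le> K" "\<And>x y. cmod (f (x, y)) \<le> K / (1 + x\<^sup>2)" "\<And>x y. cmod (f (x, y)) \<le> K / (1 + y\<^sup>2)"
proof -
  obtain K where K: "0 \<le> K" "\<And>x y. norm (x, y) ^ 0 * cmod (f (x, y)) \<le> K / ((1 + x\<^sup>2) * (1 + y\<^sup>2))"
    using schwartz_decay[OF assms] by blast
  have "cmod (f (x, y)) \<le> K / (1 + x\<^sup>2)" "cmod (f (x, y)) \<le> K / (1 + y\<^sup>2)" for x y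
  proof -
    have le: "1 + x\<^sup>2 \<le> (1 + x\<^sup>2) * (1 + y\<^sup>2)" "1 + y\<^sup>2 \<le> (1 + x\<^sup>2) * (1 + y\<^sup>2)"
      by (simp_all add: algebra_simps)
    have "K / ((1 + x\<^sup>2) * (1 + y\<^sup>2)) \<le> K / (1 + x\<^sup>2)" "K / ((1 + x\<^sup>2) * (1 + y\<^sup>2)) \<le> K / (1 + y\<^sup>2)"
      by (rule divide_left_mono[OF le(1) K(1)] divide_left_mono[OF le(2) K(1)];
          intro mult_pos_pos add_pos_nonneg; simp)+
    then show "cmod (f (x, y)) \<le> K / (1 + x\<^sup>2)" "cmod (f (x, y)) \<le> K / (1 + y\<^sup>2)"
      using K(2)[of x y] by auto
  qed
  with K(1) show ?thesis by (rule that)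
qed

text \<open>Fubini and integration by parts in one variable at a time; Schwartz decay removes the
  boundary terms on every line.\<close>

lemma dx_minus_dy_adjoint:
  assumes f: "schwartz f" and g: "schwartz g"
  shows "cinner (to_L2 f) (to_L2 (dx_minus_dy g)) = - cinner (to_L2 (dx_minus_dy f)) (to_L2 g)"
proof -
  obtain fx fy where f': "schwartz fx" "schwartz fy"
    "\<And>p. (f has_derivative (\<lambda>(s, t). s *\<^sub>R fx p + t *\<^sub>R fy p)) (at p)" "dx_minus_dy f = (\<lambda>p. fx p - fy p)"
    by (rule schwartz_partials[OF f]) blast
  obtain gx gy where g': "schwartz gx" "schwartz gy"
    "\<And>p. (g has_derivative (\<lambda>(s, t). s *\<^sub>R gx p + t *\<^sub>R gy p)) (at p)" "dx_minus_dy g = (\<lambda>p. gx p - gy p)"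
    by (rule schwartz_partials[OF g]) blast
  note sq = schwartz_square_integrable
  obtain K1 where K1: "0 \<le> K1" "\<And>x y. cmod (f (x, y)) \<le> K1 / (1 + x\<^sup>2)" "\<And>x y. cmod (f (x, y)) \<le> K1 / (1 + y\<^sup>2)"
    by (rule schwartz_slice_bound[OF f]) (rule that)
  obtain K2 where K2: "0 \<le> K2" "\<And>x y. cmod (g (x, y)) \<le> K2 / (1 + x\<^sup>2)" "\<And>x y. cmod (g (x, y)) \<le> K2 / (1 + y\<^sup>2)"
    by (rule schwartz_slice_bound[OF g]) (rule that)
  obtain K3 where K3: "0 \<le> K3" "\<And>x y. cmod (fx (x, y)) \<le> K3 / (1 + x\<^sup>2)" "\<And>x y. cmod (fx (x, y)) \<le> K3 / (1 + y\<^sup>2)"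
    by (rule schwartz_slice_bound[OF f'(1)]) (rule that)
  obtain K4 where K4: "0 \<le> K4" "\<And>x y. cmod (gx (x, y)) \<le> K4 / (1 + x\<^sup>2)" "\<And>x y. cmod (gx (x, y)) \<le> K4 / (1 + y\<^sup>2)"
    by (rule schwartz_slice_bound[OF g'(1)]) (rule that)
  obtain K5 where K5: "0 \<le> K5" "\<And>x y. cmod (fy (x, y)) \<le> K5 / (1 + x\<^sup>2)" "\<And>x y. cmod (fy (x, y)) \<le> K5 / (1 + y\<^sup>2)"
    by (rule schwartz_slice_bound[OF f'(2)]) (rule that)
  obtain K6 where K6: "0 \<le> K6" "\<And>x y. cmod (gy (x, y)) \<le> K6 / (1 + x\<^sup>2)" "\<And>x y. cmod (gy (x, y)) \<le> K6 / (1 + y\<^sup>2)"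
    by (rule schwartz_slice_bound[OF g'(2)]) (rule that)
  \<comment> \<open>The one-dimensional integration by parts takes a single decay constant for both
    functions and both derivatives, uniformly over all slices.\<close>
  define K where "K = K1 + K2 + K3 + K4 + K5 + K6"
  have mono: "a \<le> K / (1 + t\<^sup>2)" if "a \<le> k / (1 + t\<^sup>2)" "k \<le> K" for a k t :: real
    using that(1) divide_right_mono[OF that(2), of "1 + t\<^sup>2"] by simp
  have le: "K1 \<le> K" "K2 \<le> K" "K3 \<le> K" "K4 \<le> K" "K5 \<le> K" "K6 \<le> K"
    using K1(1) K2(1) K3(1) K4(1) K5(1) K6(1) by (simp_all add: K_def)
  have slice: "continuous_on UNIV (\<lambda>t. h (t, y))" "continuous_on UNIV (\<lambda>t. h (y, t))" if "schwartz h" for h y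
    by (rule continuous_on_compose2[OF schwartz_continuous[OF that]],
        auto intro!: continuous_intros)+
  have vdx: "((\<lambda>t. h (t, y)) has_vector_derivative hx (t, y)) (at t)"
    and vdy: "((\<lambda>t. h (y, t)) has_vector_derivative hy (y, t)) (at t)"
    if h: "\<And>p. (h has_derivative (\<lambda>(s, t). s *\<^sub>R hx p + t *\<^sub>R hy p)) (at p)" for h hx hy :: "real \<times> real \<Rightarrow> complex" and y t
  proof -
    have "((\<lambda>t. h (t, y)) has_derivative (\<lambda>s. case (s, 0) of (s, r) \<Rightarrow> s *\<^sub>R hx (t, y) + r *\<^sub>R hy (t, y))) (at t)"
      by (rule has_derivative_compose[OF has_derivative_Pair[OF has_derivative_ident has_derivative_const] h])
    then show "((\<lambda>t. h (t, y)) has_vector_derivative hx (t, y)) (at t)"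
      by (simp add: has_vector_derivative_def)
    have "((\<lambda>t. h (y, t)) has_derivative (\<lambda>s. case (0, s) of (s, r) \<Rightarrow> s *\<^sub>R hx (y, t) + r *\<^sub>R hy (y, t))) (at t)"
      by (rule has_derivative_compose[OF has_derivative_Pair[OF has_derivative_const has_derivative_ident] h])
    then show "((\<lambda>t. h (y, t)) has_vector_derivative hy (y, t)) (at t)"
      by (simp add: has_vector_derivative_def)
  qed
  note int = integrable_cnj_mult[OF sq sq]
  have x0: "(\<integral>p. cnj (f p) * gx p + cnj (fx p) * g p \<partial>lborel) = 0"
  proof -
    have "(\<integral>p. cnj (f p) * gx p + cnj (fx p) * g p \<partial>lborel)
        = (\<integral>y. (\<integral>x. cnj (f (x, y)) * gx (x, y) + cnj (fx (x, y)) * g (x, y) \<partial>lborel) \<partial>lborel)"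
      using Bochner_Integration.integrable_add[OF int[OF f g'(1)] int[OF f'(1) g]]
      by (subst lborel_pair.integral_snd) (simp_all add: lborel_prod case_prod_beta')
    moreover have "(\<integral>x. cnj (f (x, y)) * gx (x, y) + cnj (fx (x, y)) * g (x, y) \<partial>lborel) = 0" for y
      by (rule integration_by_parts_decay[where K = K and u = "\<lambda>x. f (x, y)" and v = "\<lambda>x. g (x, y)"
            and u' = "\<lambda>x. fx (x, y)" and v' = "\<lambda>x. gx (x, y)"])
         (intro vdx[OF f'(3)] vdx[OF g'(3)] slice f' g' mono[OF K1(2) le(1)] mono[OF K2(2) le(2)]
           mono[OF K3(2) le(3)] mono[OF K4(2) le(4)])+
    ultimately show ?thesis by simp
  qed
  have y0: "(\<integral>p. cnj (f p) * gy p + cnj (fy p) * g p \<partial>lborel) = 0"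
  proof -
    have "(\<integral>p. cnj (f p) * gy p + cnj (fy p) * g p \<partial>lborel)
        = (\<integral>x. (\<integral>y. cnj (f (x, y)) * gy (x, y) + cnj (fy (x, y)) * g (x, y) \<partial>lborel) \<partial>lborel)"
      using Bochner_Integration.integrable_add[OF int[OF f g'(2)] int[OF f'(2) g]]
      by (subst lborel_pair.integral_fst) (simp_all add: lborel_prod case_prod_beta')
    moreover have "(\<integral>y. cnj (f (x, y)) * gy (x, y) + cnj (fy (x, y)) * g (x, y) \<partial>lborel) = 0" for x
      by (rule integration_by_parts_decay[where K = K and u = "\<lambda>y. f (x, y)" and v = "\<lambda>y. g (x, y)"
            and u' = "\<lambda>y. fy (x, y)" and v' = "\<lambda>y. gy (x, y)"])
         (intro vdy[OF f'(3)] vdy[OF g'(3)] slice f' g' mono[OF K1(3) le(1)] mono[OF K2(3) le(2)]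
           mono[OF K5(3) le(5)] mono[OF K6(3) le(6)])+
    ultimately show ?thesis by simp
  qed
  have "cinner (to_L2 f) (to_L2 gx) + cinner (to_L2 fx) (to_L2 g) = 0"
    using x0 by (simp add: cinner_to_L2 sq f g f' g' int)
  moreover have "cinner (to_L2 f) (to_L2 gy) + cinner (to_L2 fy) (to_L2 g) = 0"
    using y0 by (simp add: cinner_to_L2 sq f g f' g' int)
  moreover have "to_L2 (dx_minus_dy f) = to_L2 fx - to_L2 fy" "to_L2 (dx_minus_dy g) = to_L2 gx - to_L2 gy"
    unfolding f'(4) g'(4) by (simp_all add: minus_to_L2 sq f' g')
  ultimately show ?thesis
    by (simp add: cinner_diff_right cinner_diff_left add_eq_0_iff2)
qed

lemma cost_expr_L2:
  assumes f: "schwartz f"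
  shows "square_integrable (cost_expr \<kappa> f)"
    "to_L2 (cost_expr \<kappa> f) = to_L2 (\<lambda>(x, y). complex_of_real ((x - y)\<^sup>2) * f (x, y))
      + (complex_of_real (- \<kappa>\<^sup>2) *\<^sub>C to_L2 (dx_minus_dy (dx_minus_dy f)) + complex_of_real (- 2 * \<kappa>) *\<^sub>C to_L2 f)"
proof -
  have eq: "cost_expr \<kappa> f = (\<lambda>p. (case p of (x, y) \<Rightarrow> complex_of_real ((x - y)\<^sup>2) * f (x, y))
      + (complex_of_real (- \<kappa>\<^sup>2) * dx_minus_dy (dx_minus_dy f) p + complex_of_real (- 2 * \<kappa>) * f p))"
    by (auto simp: cost_expr_def fun_eq_iff scaleR_conv_of_real)
  note s = schwartz_square_integrable_mult[OF f] schwartz_square_integrable[OF f]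
    schwartz_square_integrable[OF schwartz_dx_minus_dy[OF schwartz_dx_minus_dy[OF f]]]
  show "square_integrable (cost_expr \<kappa> f)"
    unfolding eq by (intro square_integrable_add square_integrable_cmult s)
  show "to_L2 (cost_expr \<kappa> f) = to_L2 (\<lambda>(x, y). complex_of_real ((x - y)\<^sup>2) * f (x, y))
      + (complex_of_real (- \<kappa>\<^sup>2) *\<^sub>C to_L2 (dx_minus_dy (dx_minus_dy f)) + complex_of_real (- 2 * \<kappa>) *\<^sub>C to_L2 f)"
    unfolding eq scaleC_to_L2[OF s(3)] scaleC_to_L2[OF s(2)]
    by (simp only: plus_to_L2 square_integrable_add square_integrable_cmult s)
qed

text \<open>The multiplication part is real, and the second-order part is skew-adjoint twice.
  Symmetry on Schwartz functions is enough here, since the self-adjoint extension is identified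
  through an eigenbasis of Schwartz functions.\<close>

lemma cost_expr_symmetric:
  assumes f: "schwartz f" and g: "schwartz g"
  shows "cinner (to_L2 f) (to_L2 (cost_expr \<kappa> g)) = cinner (to_L2 (cost_expr \<kappa> f)) (to_L2 g)"
proof -
  have "cinner (to_L2 f) (to_L2 (\<lambda>(x, y). complex_of_real ((x - y)\<^sup>2) * g (x, y)))
      = cinner (to_L2 (\<lambda>(x, y). complex_of_real ((x - y)\<^sup>2) * f (x, y))) (to_L2 g)"
    unfolding cinner_to_L2[OF schwartz_square_integrable[OF f] schwartz_square_integrable_mult[OF g]]
      cinner_to_L2[OF schwartz_square_integrable_mult[OF f] schwartz_square_integrable[OF g]]
    by (simp add: case_prod_beta' mult_ac del: of_real_power)
  moreover have "cinner (to_L2 f) (to_L2 (dx_minus_dy (dx_minus_dy g)))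
      = cinner (to_L2 (dx_minus_dy (dx_minus_dy f))) (to_L2 g)"
    by (simp add: dx_minus_dy_adjoint f g schwartz_dx_minus_dy)
  ultimately show ?thesis
    by (simp add: cost_expr_L2(2) f g cinner_add_right cinner_add_left)
qed

section \<open>The scaled rotation of the plane\<close>

text \<open>Rotation by 45 degrees followed by scaling by \<open>1 / sqrt \<kappa>\<close>. Its
  determinant is \<open>1 / \<kappa>\<close>, and in the new first coordinate the cost becomes a
  harmonic oscillator in standard units.\<close>

definition rotate_plane :: "real \<Rightarrow> real \<times> real \<Rightarrow> real \<times> real" where
  "rotate_plane \<kappa> z = ((fst z - snd z) / sqrt (2 * \<kappa>), (fst z + snd z) / sqrt (2 * \<kappa>))"

lemma rotate_plane_borel [measurable]: "rotate_plane \<kappa> \<in> borel \<rightarrow>\<^sub>M borel"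
  unfolding rotate_plane_def[abs_def] borel_prod[symmetric] by measurable

text \<open>The change of variables is carried out by two affine substitutions, each in one variable
  with the other held fixed; their factors s and s / 2 multiply to \<kappa>.\<close>

lemma nn_integral_rotate_plane:
  assumes \<kappa>: "\<kappa> > 0" and F: "F \<in> borel_measurable borel"
  shows "(\<integral>\<^sup>+z. F (rotate_plane \<kappa> z) \<partial>lborel) = ennreal \<kappa> * (\<integral>\<^sup>+z. F z \<partial>lborel)"
proof -
  define s where "s = sqrt (2 * \<kappa>)"
  have s: "s > 0" "s * s = 2 * \<kappa>" using \<kappa> by (simp_all add: s_def)
  have [measurable]: "F \<in> borel_measurable (borel \<Otimes>\<^sub>M borel)" using F by (simp add: borel_prod)
  have "(\<integral>\<^sup>+z. F (rotate_plane \<kappa> z) \<partial>lborel) = (\<integral>\<^sup>+y. \<integral>\<^sup>+x. F ((x - y) / s, (x + y) / s) \<partial>lborel \<partial>lborel)"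
    unfolding rotate_plane_def s_def[symmetric] lborel_prod[symmetric]
    by (subst lborel_pair.nn_integral_snd[symmetric]) (simp_all, measurable)
  also have "\<dots> = (\<integral>\<^sup>+y. ennreal s * (\<integral>\<^sup>+x. F (x, x + 2 * y / s) \<partial>lborel) \<partial>lborel)"
  proof (rule nn_integral_cong)
    fix y
    have "(\<lambda>x. F ((x - y) / s, (x + y) / s)) \<in> borel_measurable borel" by measurable
    from nn_integral_real_affine[OF this, of s y]
    have "(\<integral>\<^sup>+x. F ((x - y) / s, (x + y) / s) \<partial>lborel)
        = ennreal \<bar>s\<bar> * (\<integral>\<^sup>+x. F ((y + s * x - y) / s, (y + s * x + y) / s) \<partial>lborel)"
      using s by simp
    moreover have "(y + s * x - y) / s = x" "(y + s * x + y) / s = x + 2 * y / s" for x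
      using s by (simp_all add: field_simps)
    ultimately show "(\<integral>\<^sup>+x. F ((x - y) / s, (x + y) / s) \<partial>lborel) = ennreal s * (\<integral>\<^sup>+x. F (x, x + 2 * y / s) \<partial>lborel)"
      using s by (simp only: abs_of_pos)
  qed
  also have "\<dots> = ennreal s * (\<integral>\<^sup>+y. \<integral>\<^sup>+x. F (x, x + 2 * y / s) \<partial>lborel \<partial>lborel)"
    by (rule nn_integral_cmult) measurable
  also have "(\<integral>\<^sup>+y. \<integral>\<^sup>+x. F (x, x + 2 * y / s) \<partial>lborel \<partial>lborel) = (\<integral>\<^sup>+x. \<integral>\<^sup>+y. F (x, x + 2 * y / s) \<partial>lborel \<partial>lborel)"
    by (rule lborel_pair.Fubini') measurable
  also have "\<dots> = (\<integral>\<^sup>+x. ennreal (s / 2) * (\<integral>\<^sup>+y. F (x, y) \<partial>lborel) \<partial>lborel)"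
  proof (rule nn_integral_cong)
    fix x
    have "(\<lambda>y. F (x, x + 2 * y / s)) \<in> borel_measurable borel" by measurable
    from nn_integral_real_affine[OF this, of "s / 2" "- (s / 2) * x"]
    have "(\<integral>\<^sup>+y. F (x, x + 2 * y / s) \<partial>lborel)
        = ennreal \<bar>s / 2\<bar> * (\<integral>\<^sup>+y. F (x, x + 2 * (- (s / 2) * x + (s / 2) * y) / s) \<partial>lborel)"
      using s by simp
    moreover have "x + 2 * (- (s / 2) * x + (s / 2) * y) / s = y" for y
      using s by (simp add: field_simps)
    ultimately show "(\<integral>\<^sup>+y. F (x, x + 2 * y / s) \<partial>lborel) = ennreal (s / 2) * (\<integral>\<^sup>+y. F (x, y) \<partial>lborel)"
      using s by (simp only: abs_of_pos half_gt_zero)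
  qed
  also have "\<dots> = ennreal (s / 2) * (\<integral>\<^sup>+z. F z \<partial>lborel)"
    unfolding lborel_prod[symmetric]
    by (subst nn_integral_cmult, measurable) (subst lborel.nn_integral_fst[symmetric], measurable)
  finally show ?thesis
    using s by (simp add: mult.assoc[symmetric] ennreal_mult[symmetric])
qed

lemma distr_rotate_plane:
  assumes "\<kappa> > 0"
  shows "distr lborel borel (rotate_plane \<kappa>) = density lborel (\<lambda>_. ennreal \<kappa>)"
proof (rule measure_eqI)
  fix A assume "A \<in> sets (distr lborel borel (rotate_plane \<kappa>))"
  then have A [measurable]: "A \<in> sets borel" by simp
  have "emeasure (distr lborel borel (rotate_plane \<kappa>)) A = (\<integral>\<^sup>+z. indicator A z \<partial>distr lborel borel (rotate_plane \<kappa>))"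
    by simp
  also have "\<dots> = (\<integral>\<^sup>+z. indicator A (rotate_plane \<kappa> z) \<partial>lborel)"
    by (rule nn_integral_distr) measurable
  also have "\<dots> = ennreal \<kappa> * (\<integral>\<^sup>+z. indicator A z \<partial>lborel)"
    by (rule nn_integral_rotate_plane[OF assms]) measurable
  also have "\<dots> = emeasure (density lborel (\<lambda>_. ennreal \<kappa>)) A"
    by (simp add: emeasure_density nn_integral_cmult)
  finally show "emeasure (distr lborel borel (rotate_plane \<kappa>)) A = emeasure (density lborel (\<lambda>_. ennreal \<kappa>)) A" .
qed simp

lemma integral_rotate_plane:
  fixes F :: "real \<times> real \<Rightarrow> complex"
  assumes \<kappa>: "\<kappa> > 0" and F: "F \<in> borel_measurable borel"
  shows "(\<integral>z. F (rotate_plane \<kappa> z) \<partial>lborel) = of_real \<kappa> * (\<integral>z. F z \<partial>lborel)"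
proof -
  have "(\<integral>z. F (rotate_plane \<kappa> z) \<partial>lborel) = (\<integral>z. F z \<partial>distr lborel borel (rotate_plane \<kappa>))"
    by (rule integral_distr[symmetric]) (use F in measurable)
  also have "\<dots> = (\<integral>z. \<kappa> *\<^sub>R F z \<partial>lborel)"
    unfolding distr_rotate_plane[OF \<kappa>] using F \<kappa> by (subst integral_density) auto
  finally show ?thesis by (simp add: scaleR_conv_of_real)
qed

lemma square_integrable_rotate_plane:
  assumes \<kappa>: "\<kappa> > 0" and f: "f \<in> borel_measurable borel"
  shows "square_integrable (\<lambda>z. f (rotate_plane \<kappa> z)) \<longleftrightarrow> square_integrable f"
proof -
  have fin: "square_integrable h \<longleftrightarrow> (\<integral>\<^sup>+z. ennreal ((cmod (h z))\<^sup>2) \<partial>lborel) < \<infinity>"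
    if "h \<in> borel_measurable borel" for h :: "real \<times> real \<Rightarrow> complex"
    using that square_integrableI_nn[of h] nn_integral_square_integrable[of h] by auto
  have "(\<integral>\<^sup>+z. ennreal ((cmod (f (rotate_plane \<kappa> z)))\<^sup>2) \<partial>lborel) = ennreal \<kappa> * (\<integral>\<^sup>+z. ennreal ((cmod (f z))\<^sup>2) \<partial>lborel)"
    using f by (intro nn_integral_rotate_plane[OF \<kappa>]) measurable
  moreover have "ennreal \<kappa> * x < \<infinity> \<longleftrightarrow> x < \<infinity>" for x
    using \<kappa> by (auto simp: ennreal_mult_less_top)
  ultimately show ?thesis
    using fin[of f] fin[of "\<lambda>z. f (rotate_plane \<kappa> z)"] f by simp
qed

lemma cinner_rotate_plane:
  assumes \<kappa>: "\<kappa> > 0" and f: "square_integrable f" and g: "square_integrable g"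
  shows "cinner (to_L2 (\<lambda>z. f (rotate_plane \<kappa> z))) (to_L2 (\<lambda>z. g (rotate_plane \<kappa> z)))
    = of_real \<kappa> * cinner (to_L2 f) (to_L2 g)"
proof -
  have m: "f \<in> borel_measurable borel" "g \<in> borel_measurable borel"
    using f g by (auto simp: square_integrable_def)
  have "(\<lambda>z. cnj (f z) * g z) \<in> borel_measurable borel"
    using borel_measurable_integrable[OF integrable_cnj_mult[OF f g]] by simp
  then show ?thesis
    using integral_rotate_plane[OF \<kappa>, of "\<lambda>z. cnj (f z) * g z"] f g
    by (simp add: cinner_to_L2 square_integrable_rotate_plane[OF \<kappa>] m)
qed

section \<open>Eigenfunctions of the cost expression\<close>

definition rotated_product :: "real \<Rightarrow> (real \<Rightarrow> real) \<Rightarrow> (real \<Rightarrow> real) \<Rightarrow> real \<times> real \<Rightarrow> complex" where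
  "rotated_product \<kappa> a b z = complex_of_real (a (fst (rotate_plane \<kappa> z)) * b (snd (rotate_plane \<kappa> z)))"

text \<open>The derivative is taken along a direction in which x + y is constant, so only the first
  factor is differentiated; the chain rule contributes
  \<open>2 / sqrt (2 * \<kappa>)\<close>.\<close>

lemma dx_minus_dy_rotated_product:
  assumes a: "\<And>t. (a has_real_derivative a' t) (at t)" and b: "\<And>t. (b has_real_derivative b' t) (at t)"
  shows "dx_minus_dy (rotated_product \<kappa> a b) = rotated_product \<kappa> (\<lambda>t. 2 / sqrt (2 * \<kappa>) * a' t) b"
proof
  fix z
  define r where "r = 1 / sqrt (2 * \<kappa>)"
  let ?u = "\<lambda>z :: real \<times> real. (fst z - snd z) * r" and ?v = "\<lambda>z :: real \<times> real. (fst z + snd z) * r"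
  have rp: "rotated_product \<kappa> a b = (\<lambda>z. complex_of_real (a (?u z) * b (?v z)))" for a b
    by (simp add: rotated_product_def[abs_def] rotate_plane_def r_def)
  have u: "(?u has_derivative (\<lambda>h. (fst h - snd h) * r)) (at z)"
    and v: "(?v has_derivative (\<lambda>h. (fst h + snd h) * r)) (at z)"
    by (auto intro!: derivative_eq_intros)
  have "((\<lambda>z. a (?u z)) has_derivative (\<lambda>h. ((fst h - snd h) * r) * a' (?u z))) (at z)"
    by (rule has_derivative_eq_rhs[OF has_derivative_compose[OF u a[unfolded has_field_derivative_def]]])
       (simp add: mult.commute)
  moreover have "((\<lambda>z. b (?v z)) has_derivative (\<lambda>h. ((fst h + snd h) * r) * b' (?v z))) (at z)"
    by (rule has_derivative_eq_rhs[OF has_derivative_compose[OF v b[unfolded has_field_derivative_def]]])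
       (simp add: mult.commute)
  ultimately have "(rotated_product \<kappa> a b has_derivative (\<lambda>h. complex_of_real
      (a (?u z) * (((fst h + snd h) * r) * b' (?v z)) + ((fst h - snd h) * r) * a' (?u z) * b (?v z)))) (at z)"
    unfolding rp by (intro has_derivative_of_real has_derivative_mult)
  then show "dx_minus_dy (rotated_product \<kappa> a b) z = rotated_product \<kappa> (\<lambda>t. 2 / sqrt (2 * \<kappa>) * a' t) b z"
    unfolding dx_minus_dy_def
    by (simp add: frechet_derivative_at[symmetric] rp) (simp add: r_def algebra_simps)
qed

text \<open>With u the first rotated coordinate and D its derivative, the expression is 2 \<kappa>
  (u^2 - D^2 - 1). The oscillator eigenvalue 2 m + 1 minus 1, times 2 \<kappa>, is 4 \<kappa>
  m.\<close>

lemma cost_expr_rotated_hermite: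
  assumes \<kappa>: "\<kappa> > 0"
  shows "cost_expr \<kappa> (rotated_product \<kappa> (hermite_fun m) (hermite_fun n))
    = (\<lambda>z. complex_of_real (4 * \<kappa> * real m) * rotated_product \<kappa> (hermite_fun m) (hermite_fun n) z)"
proof
  fix z :: "real \<times> real"
  obtain x y :: real where z: "z = (x, y)" by (cases z)
  define s where "s = sqrt (2 * \<kappa>)"
  have s: "s > 0" "s\<^sup>2 = 2 * \<kappa>" using \<kappa> by (simp_all add: s_def)
  define u where "u = (x - y) / s"
  define H where "H = hermite_fun m u * hermite_fun n ((x + y) / s)"
  have "dx_minus_dy (rotated_product \<kappa> (hermite_fun m) (hermite_fun n))
      = rotated_product \<kappa> (\<lambda>t. 2 / s * hermite_fun' m t) (hermite_fun n)"
    unfolding s_def by (rule dx_minus_dy_rotated_product DERIV_hermite_fun)+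
  moreover have "dx_minus_dy (rotated_product \<kappa> (\<lambda>t. 2 / s * hermite_fun' m t) (hermite_fun n))
      = rotated_product \<kappa> (\<lambda>t. 2 / s * (2 / s * ((t\<^sup>2 - 1 - 2 * real m) * hermite_fun m t))) (hermite_fun n)"
    unfolding s_def by (rule dx_minus_dy_rotated_product DERIV_hermite_fun DERIV_cmult DERIV_hermite_fun')+
  ultimately have dd: "dx_minus_dy (dx_minus_dy (rotated_product \<kappa> (hermite_fun m) (hermite_fun n)))
      = rotated_product \<kappa> (\<lambda>t. 2 / s * (2 / s * ((t\<^sup>2 - 1 - 2 * real m) * hermite_fun m t))) (hermite_fun n)"
    by (simp only:)
  have rp: "rotated_product \<kappa> a b z = complex_of_real (a u * b ((x + y) / s))" for a b
    by (simp add: rotated_product_def rotate_plane_def z u_def s_def)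
  let ?f = "rotated_product \<kappa> (hermite_fun m) (hermite_fun n)"
  have "cost_expr \<kappa> ?f z = (x - y)\<^sup>2 *\<^sub>R ?f z - \<kappa>\<^sup>2 *\<^sub>R dx_minus_dy (dx_minus_dy ?f) z - (2 * \<kappa>) *\<^sub>R ?f z"
    by (simp add: cost_expr_def z)
  then have "cost_expr \<kappa> ?f z
      = complex_of_real ((x - y)\<^sup>2 * H - \<kappa>\<^sup>2 * (2 / s * (2 / s * ((u\<^sup>2 - 1 - 2 * real m) * H))) - 2 * \<kappa> * H)"
    unfolding dd rp H_def scaleR_conv_of_real by (simp only: of_real_mult of_real_diff mult.assoc)
  also have "2 / s * (2 / s * ((u\<^sup>2 - 1 - 2 * real m) * H)) = 2 / \<kappa> * ((u\<^sup>2 - 1 - 2 * real m) * H)"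
  proof -
    have "2 / s * (2 / s * w) = 4 / s\<^sup>2 * w" for w by (simp add: power2_eq_square)
    then show ?thesis using s by simp
  qed
  also have "(x - y)\<^sup>2 = 2 * \<kappa> * u\<^sup>2"
    using s \<kappa> by (simp add: u_def power_divide)
  also have "2 * \<kappa> * u\<^sup>2 * H - \<kappa>\<^sup>2 * (2 / \<kappa> * ((u\<^sup>2 - 1 - 2 * real m) * H)) - 2 * \<kappa> * H = 4 * \<kappa> * real m * H"
    using \<kappa> by (simp add: power2_eq_square[of \<kappa>] algebra_simps)
  finally show "cost_expr \<kappa> (rotated_product \<kappa> (hermite_fun m) (hermite_fun n)) z
      = complex_of_real (4 * \<kappa> * real m) * rotated_product \<kappa> (hermite_fun m) (hermite_fun n) z"
    unfolding rp H_def by (simp only: of_real_mult)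
qed

text \<open>The rotation preserves the sum of squares up to the factor \<open>1 / \<kappa>\<close>,
  so the two one-dimensional Gaussians combine into one centred
  \<open>plane_gaussian\<close>.\<close>

lemma schwartz_rotated_hermite:
  assumes \<kappa>: "\<kappa> > 0"
  shows "schwartz (rotated_product \<kappa> (hermite_fun m) (hermite_fun n))"
proof -
  let ?u = "\<lambda>z. fst (rotate_plane \<kappa> z)" and ?v = "\<lambda>z. snd (rotate_plane \<kappa> z)"
  have lin: "polynomial_function ?u" "polynomial_function ?v"
    unfolding rotate_plane_def real_polynomial_function_eq[symmetric] fst_conv snd_conv divide_inverse
    by (intro real_polynomial_function.intros(2-4) real_polynomial_function_diff
        real_polynomial_function.intros(1) bounded_linear_fst bounded_linear_snd)+
  have "real_polynomial_function (\<lambda>z. hermite m (?u z) * hermite n (?v z))"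
    using real_polynomial_function_compose[OF lin(1) real_polynomial_function_hermite[of m]]
      real_polynomial_function_compose[OF lin(2) real_polynomial_function_hermite[of n]]
    unfolding o_def by (rule real_polynomial_function.intros(4))
  from schwartz_poly_gaussian[OF \<kappa> this, of 0 0]
  have "schwartz (\<lambda>z. complex_of_real (hermite m (?u z) * hermite n (?v z) * plane_gaussian \<kappa> 0 0 z))" .
  moreover have "rotated_product \<kappa> (hermite_fun m) (hermite_fun n) z
      = complex_of_real (hermite m (?u z) * hermite n (?v z) * plane_gaussian \<kappa> 0 0 z)" for z
  proof -
    have "(?u z)\<^sup>2 + (?v z)\<^sup>2 = ((fst z)\<^sup>2 + (snd z)\<^sup>2) / \<kappa>"
      using \<kappa> by (simp add: rotate_plane_def power_divide power2_sum power2_diff field_simps)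
    then have "- (?u z)\<^sup>2 / 2 + - (?v z)\<^sup>2 / 2 = - ((fst z)\<^sup>2 + (snd z)\<^sup>2) / (2 * \<kappa>)"
      using \<kappa> by (simp add: field_simps)
    then have G: "plane_gaussian \<kappa> 0 0 z = exp (- (?u z)\<^sup>2 / 2) * exp (- (?v z)\<^sup>2 / 2)"
      unfolding plane_gaussian_def exp_add[symmetric] by simp
    show ?thesis
      unfolding rotated_product_def hermite_fun_def G by (simp only: mult_ac)
  qed
  then have "rotated_product \<kappa> (hermite_fun m) (hermite_fun n)
      = (\<lambda>z. complex_of_real (hermite m (?u z) * hermite n (?v z) * plane_gaussian \<kappa> 0 0 z))" by (rule ext)
  ultimately show ?thesis by (simp only:)
qed

text \<open>The factor \<open>1 / sqrt \<kappa>\<close> compensates the Jacobian of the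
  rotation.\<close>

definition hermite_plane :: "real \<Rightarrow> nat \<times> nat \<Rightarrow> (real \<times> real) L2" where
  "hermite_plane \<kappa> i = complex_of_real (1 / (sqrt \<kappa> * norm (to_L2 (\<lambda>t. complex_of_real (hermite_fun (fst i) t)))
      * norm (to_L2 (\<lambda>t. complex_of_real (hermite_fun (snd i) t)))))
    *\<^sub>C to_L2 (rotated_product \<kappa> (hermite_fun (fst i)) (hermite_fun (snd i)))"

text \<open>Presents the eigenfunctions as rotated tensor products, so that orthonormality and
  completeness can be carried over from the unrotated plane.\<close>

lemma hermite_plane_rotate:
  assumes \<kappa>: "\<kappa> > 0"
  obtains h where "square_integrable h" "tensor (hermite_L2 m) (hermite_L2 n) = to_L2 h"
    "hermite_plane \<kappa> (m, n) = complex_of_real (1 / sqrt \<kappa>) *\<^sub>C to_L2 (\<lambda>z. h (rotate_plane \<kappa> z))"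
proof -
  define M where "M m = norm (to_L2 (\<lambda>t. complex_of_real (hermite_fun m t)))" for m
  define h where "h z = complex_of_real (1 / (M m * M n)) * (case z of (x, y) \<Rightarrow> complex_of_real (hermite_fun m x) * complex_of_real (hermite_fun n y))" for z
  note st = square_integrable_tensor[OF square_integrable_hermite_fun[of m] square_integrable_hermite_fun[of n]]
  have sq: "square_integrable h"
    unfolding h_def[abs_def] by (intro square_integrable_cmult st)
  have "tensor (hermite_L2 m) (hermite_L2 n) = to_L2 h"
    unfolding h_def[abs_def] scaleC_to_L2[OF st, symmetric]
      tensor_to_L2[OF square_integrable_hermite_fun square_integrable_hermite_fun, symmetric]
    by (simp add: hermite_L2_def M_def scaleR_scaleC tensor_bilinear mult.commute)
  moreover have "hermite_plane \<kappa> (m, n) = complex_of_real (1 / sqrt \<kappa>) *\<^sub>C to_L2 (\<lambda>z. h (rotate_plane \<kappa> z))"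
  proof -
    have "(\<lambda>z. h (rotate_plane \<kappa> z)) = (\<lambda>z. complex_of_real (1 / (M m * M n)) * rotated_product \<kappa> (hermite_fun m) (hermite_fun n) z)"
      by (simp add: h_def rotated_product_def fun_eq_iff case_prod_beta')
    then have "to_L2 (\<lambda>z. h (rotate_plane \<kappa> z))
        = complex_of_real (1 / (M m * M n)) *\<^sub>C to_L2 (rotated_product \<kappa> (hermite_fun m) (hermite_fun n))"
      by (simp only: scaleC_to_L2[OF schwartz_square_integrable[OF schwartz_rotated_hermite[OF \<kappa>]]])
    then show ?thesis
      by (simp add: hermite_plane_def M_def[symmetric] mult.assoc)
  qed
  ultimately show ?thesis using sq that by blast
qed

lemma onb_family_hermite_plane:
  assumes \<kappa>: "\<kappa> > 0"
  shows "onb_family (hermite_plane \<kappa>)"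
proof -
  have \<kappa>1: "complex_of_real (1 / sqrt \<kappa>) * (complex_of_real (1 / sqrt \<kappa>) * complex_of_real \<kappa>) = 1"
    using \<kappa> by (simp flip: of_real_mult of_real_divide)
  have inner: "cinner (hermite_plane \<kappa> i) (hermite_plane \<kappa> j) = (if i = j then 1 else 0)" for i j
  proof -
    obtain m n k l where ij: "i = (m, n)" "j = (k, l)" by (cases i, cases j) blast
    obtain h where h: "square_integrable h" "tensor (hermite_L2 m) (hermite_L2 n) = to_L2 h"
      "hermite_plane \<kappa> (m, n) = complex_of_real (1 / sqrt \<kappa>) *\<^sub>C to_L2 (\<lambda>z. h (rotate_plane \<kappa> z))"
      by (rule hermite_plane_rotate[OF \<kappa>])
    obtain h' where h': "square_integrable h'" "tensor (hermite_L2 k) (hermite_L2 l) = to_L2 h'"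
      "hermite_plane \<kappa> (k, l) = complex_of_real (1 / sqrt \<kappa>) *\<^sub>C to_L2 (\<lambda>z. h' (rotate_plane \<kappa> z))"
      by (rule hermite_plane_rotate[OF \<kappa>])
    have "cinner (hermite_plane \<kappa> i) (hermite_plane \<kappa> j)
        = complex_of_real (1 / sqrt \<kappa>) * (complex_of_real (1 / sqrt \<kappa>) * complex_of_real \<kappa>) * cinner (to_L2 h) (to_L2 h')"
      unfolding ij h(3) h'(3) cinner_scaleC_left cinner_scaleC_right cinner_rotate_plane[OF \<kappa> h(1) h'(1)] complex_cnj_complex_of_real
      by (simp only: mult.assoc)
    also have "\<dots> = cinner (hermite_L2 m) (hermite_L2 k) * cinner (hermite_L2 n) (hermite_L2 l)"
      unfolding \<kappa>1 h(2)[symmetric] h'(2)[symmetric] by (simp add: cinner_tensor)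
    finally show ?thesis by (auto simp: orthonormal_hermite ij)
  qed
  have inj: "hermite_plane \<kappa> i = hermite_plane \<kappa> j \<longleftrightarrow> i = j" for i j
  proof
    assume "hermite_plane \<kappa> i = hermite_plane \<kappa> j"
    then have "cinner (hermite_plane \<kappa> i) (hermite_plane \<kappa> j) = 1" using inner[of j j] by simp
    then show "i = j" using inner[of i j] by (simp split: if_splits)
  qed simp
  have "orthonormal (range (hermite_plane \<kappa>))"
    unfolding orthonormal_def
  proof (intro ballI, elim imageE)
    fix e f i j assume "e = hermite_plane \<kappa> i" "f = hermite_plane \<kappa> j"
    then show "cinner e f = (if e = f then 1 else 0)" by (simp only: inner inj)
  qed
  moreover have "F = 0" if F: "\<forall>e\<in>range (hermite_plane \<kappa>). cinner e F = 0" for F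
  proof -
    obtain f where f: "square_integrable f" and Ff: "F = to_L2 f" by (rule L2_cases)
    \<comment> \<open>Composition with the inverse rotation; orthogonality of \<open>F\<close> to
      the rotated family becomes orthogonality of \<open>g\<close> to all products of Hermite
      functions.\<close>
    define g where "g w = f (sqrt (2 * \<kappa>) / 2 * (fst w + snd w), sqrt (2 * \<kappa>) / 2 * (snd w - fst w))" for w
    have fm: "f \<in> borel_measurable borel" using f by (simp add: square_integrable_def)
    have gm: "g \<in> borel_measurable borel"
      unfolding g_def[abs_def]
    proof (rule measurable_compose[OF _ fm])
      show "(\<lambda>w. (sqrt (2 * \<kappa>) / 2 * (fst w + snd w), sqrt (2 * \<kappa>) / 2 * (snd w - fst w))) \<in> borel \<rightarrow>\<^sub>M (borel :: (real \<times> real) measure)"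
        unfolding borel_prod[symmetric] by measurable
    qed
    have fg: "f z = g (rotate_plane \<kappa> z)" for z
    proof -
      have "sqrt (2 * \<kappa>) / 2 * ((fst z - snd z) / sqrt (2 * \<kappa>) + (fst z + snd z) / sqrt (2 * \<kappa>)) = fst z"
        "sqrt (2 * \<kappa>) / 2 * ((fst z + snd z) / sqrt (2 * \<kappa>) - (fst z - snd z) / sqrt (2 * \<kappa>)) = snd z"
        using \<kappa> by (simp_all add: field_simps)
      then show ?thesis by (simp add: g_def rotate_plane_def)
    qed
    have g: "square_integrable g"
      using square_integrable_rotate_plane[OF \<kappa> gm] f by (simp flip: fg)
    have Fg: "F = to_L2 (\<lambda>z. g (rotate_plane \<kappa> z))" by (simp add: Ff flip: fg)
    have "cinner (tensor (hermite_L2 m) (hermite_L2 n)) (to_L2 g) = 0" for m n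
    proof -
      obtain h where h: "square_integrable h" "tensor (hermite_L2 m) (hermite_L2 n) = to_L2 h"
        "hermite_plane \<kappa> (m, n) = complex_of_real (1 / sqrt \<kappa>) *\<^sub>C to_L2 (\<lambda>z. h (rotate_plane \<kappa> z))"
        by (rule hermite_plane_rotate[OF \<kappa>])
      have "0 = cinner (hermite_plane \<kappa> (m, n)) F" using F by simp
      also have "\<dots> = complex_of_real (1 / sqrt \<kappa>) * (complex_of_real \<kappa> * cinner (to_L2 h) (to_L2 g))"
        unfolding h(3) Fg cinner_scaleC_left cinner_rotate_plane[OF \<kappa> h(1) g] by simp
      finally show ?thesis using \<kappa> by (simp add: h(2))
    qed
    then have "to_L2 g = 0"
      using orthonormal_basis_tensor[OF orthonormal_basis_hermite orthonormal_basis_hermite countable_hermite]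
      unfolding orthonormal_basis_def by auto
    then have "cinner F F = 0"
      unfolding Fg cinner_rotate_plane[OF \<kappa> g g] by simp
    then show ?thesis by (simp add: cinner_self)
  qed
  ultimately show ?thesis
    unfolding onb_family_def orthonormal_basis_def inj_def inj by (simp only: simp_thms) blast
qed

text \<open>Constant in the second index: the cost does not act on the variable x + y, so every
  eigenvalue has infinite multiplicity.\<close>

definition cost_eigenvalue :: "real \<Rightarrow> nat \<times> nat \<Rightarrow> real" where
  "cost_eigenvalue \<kappa> i = 4 * \<kappa> * real (fst i)"

lemma hermite_plane_schwartz:
  assumes \<kappa>: "\<kappa> > 0"
  obtains e where "schwartz e" "hermite_plane \<kappa> i = to_L2 e"
    "to_L2 (cost_expr \<kappa> e) = of_real (cost_eigenvalue \<kappa> i) *\<^sub>C hermite_plane \<kappa> i"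
proof -
  let ?r = "rotated_product \<kappa> (hermite_fun (fst i)) (hermite_fun (snd i))"
  define c where "c = complex_of_real (1 / (sqrt \<kappa> * norm (to_L2 (\<lambda>t. complex_of_real (hermite_fun (fst i) t)))
      * norm (to_L2 (\<lambda>t. complex_of_real (hermite_fun (snd i) t)))))"
  \<comment> \<open>The zero summand brings the scalar multiple into the two-term form of
    \<open>schwartz_lincomb\<close> and \<open>cost_expr_lincomb\<close>.\<close>
  define e where "e = (\<lambda>z. c * ?r z + 0 * ?r z)"
  note r = schwartz_rotated_hermite[OF \<kappa>, of "fst i" "snd i"]
  have e: "schwartz e" unfolding e_def by (rule schwartz_lincomb[OF r r])
  have He: "hermite_plane \<kappa> i = to_L2 e"
    using scaleC_to_L2[OF schwartz_square_integrable[OF r], of c]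
    unfolding hermite_plane_def c_def[symmetric] e_def by simp
  have "cost_expr \<kappa> e = (\<lambda>z. of_real (cost_eigenvalue \<kappa> i) * e z)"
    unfolding e_def cost_expr_lincomb[OF r r] cost_expr_rotated_hermite[OF \<kappa>]
    by (simp add: fun_eq_iff cost_eigenvalue_def)
  then have "to_L2 (cost_expr \<kappa> e) = of_real (cost_eigenvalue \<kappa> i) *\<^sub>C hermite_plane \<kappa> i"
    by (simp add: He scaleC_to_L2 schwartz_square_integrable[OF e])
  with e He show ?thesis by (rule that)
qed

section \<open>The closure of the cost expression and its square root\<close>

text \<open>Symmetry moves the differential expression onto the Schwartz eigenfunction, where it
  acts as a scalar. Besides identifying the closure, this gives the coordinates of the cost applied
  to coherent states.\<close>

lemma cost_graph_subset:
  assumes \<kappa>: "\<kappa> > 0" and f: "schwartz f"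
  shows "(to_L2 f, to_L2 (cost_expr \<kappa> f)) \<in> diag_op (hermite_plane \<kappa>) (cost_eigenvalue \<kappa>)"
proof -
  have "cinner (hermite_plane \<kappa> i) (to_L2 (cost_expr \<kappa> f)) = of_real (cost_eigenvalue \<kappa> i) * cinner (hermite_plane \<kappa> i) (to_L2 f)" for i
  proof -
    obtain e where e: "schwartz e" "hermite_plane \<kappa> i = to_L2 e"
      "to_L2 (cost_expr \<kappa> e) = of_real (cost_eigenvalue \<kappa> i) *\<^sub>C hermite_plane \<kappa> i"
      by (rule hermite_plane_schwartz[OF \<kappa>])
    have "cinner (hermite_plane \<kappa> i) (to_L2 (cost_expr \<kappa> f)) = cinner (to_L2 (cost_expr \<kappa> e)) (to_L2 f)"
      unfolding e(2) by (rule cost_expr_symmetric[OF e(1) f])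
    then show ?thesis by (simp add: e(3))
  qed
  then show ?thesis by (simp add: diag_op_def)
qed

text \<open>The diagonal graph is an intersection of closed conditions, hence contains the closure.
  Conversely partial sums of the eigenexpansion are Schwartz functions whose images are the partial
  sums of the expansion of \<open>g\<close>, so each pair is a limit of pairs from the Schwartz
  graph. Essential self-adjointness thereby comes as a by-product.\<close>

lemma cost_op_eq_diag_op:
  assumes \<kappa>: "\<kappa> > 0"
  shows "cost_op \<kappa> = diag_op (hermite_plane \<kappa>) (cost_eigenvalue \<kappa>)"
proof -
  let ?E = "hermite_plane \<kappa>" and ?\<mu> = "cost_eigenvalue \<kappa>"
  let ?S = "{(to_L2 f, to_L2 (cost_expr \<kappa> f)) | f. schwartz f}"
  note E = onb_family_hermite_plane[OF \<kappa>]
  have "closed (diag_op ?E ?\<mu>)"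
  proof -
    have "diag_op ?E ?\<mu> = (\<Inter>i. {p. cinner (?E i) (snd p) = of_real (?\<mu> i) * cinner (?E i) (fst p)})"
      by (auto simp: diag_op_def)
    also have "closed \<dots>"
      by (intro closed_INT ballI closed_Collect_eq continuous_intros
          bounded_linear.continuous_on[OF bounded_linear_cinner_right])
    finally show ?thesis .
  qed
  then have "closure ?S \<subseteq> diag_op ?E ?\<mu>"
    using cost_graph_subset[OF \<kappa>] by (intro closure_minimal) auto
  moreover have "diag_op ?E ?\<mu> \<subseteq> closure ?S"
  proof clarify
    fix f g assume fg: "(f, g) \<in> diag_op ?E ?\<mu>"
    have zero: "schwartz (\<lambda>p. 0)"
      using schwartz_lincomb[OF schwartz_rotated_hermite[OF \<kappa>] schwartz_rotated_hermite[OF \<kappa>], of 0 0 0 0 0 0] by simp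
    have fin: "\<exists>h. schwartz h \<and> (\<Sum>i\<in>F. c i *\<^sub>C ?E i) = to_L2 h \<and> (\<Sum>i\<in>F. c i *\<^sub>C of_real (?\<mu> i) *\<^sub>C ?E i) = to_L2 (cost_expr \<kappa> h)"
      if "finite F" for F c
      using that
    proof (induction F rule: finite_induct)
      case empty
      have "cost_expr \<kappa> (\<lambda>p. 0) = (\<lambda>p. 0)"
        using cost_expr_lincomb[OF zero zero, of \<kappa> 0 0] by simp
      then show ?case using zero by (intro exI[of _ "\<lambda>p. 0"]) (simp add: zero_to_L2)
    next
      case (insert i F)
      then obtain h where h: "schwartz h" "(\<Sum>i\<in>F. c i *\<^sub>C ?E i) = to_L2 h"
        "(\<Sum>i\<in>F. c i *\<^sub>C of_real (?\<mu> i) *\<^sub>C ?E i) = to_L2 (cost_expr \<kappa> h)" by blast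
      obtain e where e: "schwartz e" "?E i = to_L2 e" "to_L2 (cost_expr \<kappa> e) = of_real (?\<mu> i) *\<^sub>C ?E i"
        by (rule hermite_plane_schwartz[OF \<kappa>])
      have lin: "to_L2 (\<lambda>p. c i * a p + 1 * b p) = c i *\<^sub>C to_L2 a + to_L2 b"
        if "square_integrable a" "square_integrable b" for a b :: "real \<times> real \<Rightarrow> complex"
        using that by (simp add: scaleC_to_L2 plus_to_L2 square_integrable_cmult)
      note sq = schwartz_square_integrable[OF e(1)] schwartz_square_integrable[OF h(1)]
        cost_expr_L2(1)[OF e(1), of \<kappa>] cost_expr_L2(1)[OF h(1), of \<kappa>]
      show ?case
      proof (intro exI[of _ "\<lambda>p. c i * e p + 1 * h p"] conjI)
        show "schwartz (\<lambda>p. c i * e p + 1 * h p)" by (rule schwartz_lincomb[OF e(1) h(1)])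
        show "(\<Sum>i\<in>insert i F. c i *\<^sub>C ?E i) = to_L2 (\<lambda>p. c i * e p + 1 * h p)"
          unfolding lin[OF sq(1,2)] using insert.hyps h(2) e(2) by simp
        show "(\<Sum>i\<in>insert i F. c i *\<^sub>C of_real (?\<mu> i) *\<^sub>C ?E i) = to_L2 (cost_expr \<kappa> (\<lambda>p. c i * e p + 1 * h p))"
          unfolding cost_expr_lincomb[OF e(1) h(1)] lin[OF sq(3,4)] e(3) using insert.hyps h(3) by simp
      qed
    qed
    have "((\<lambda>F. (\<Sum>i\<in>F. cinner (?E i) f *\<^sub>C ?E i, \<Sum>i\<in>F. cinner (?E i) f *\<^sub>C of_real (?\<mu> i) *\<^sub>C ?E i)) \<longlongrightarrow> (f, g)) (finite_subsets_at_top UNIV)"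
    proof (rule tendsto_Pair)
      show "((\<lambda>F. \<Sum>i\<in>F. cinner (?E i) f *\<^sub>C ?E i) \<longlongrightarrow> f) (finite_subsets_at_top UNIV)"
        using onb_family_expansion[OF E, of f] by (simp add: has_sum_def)
      have "cinner (?E i) f *\<^sub>C of_real (?\<mu> i) *\<^sub>C ?E i = cinner (?E i) g *\<^sub>C ?E i" for i
      proof -
        have "cinner (?E i) g = of_real (?\<mu> i) * cinner (?E i) f"
          using fg unfolding diag_op_def by blast
        then show ?thesis by (simp add: mult.commute)
      qed
      then show "((\<lambda>F. \<Sum>i\<in>F. cinner (?E i) f *\<^sub>C of_real (?\<mu> i) *\<^sub>C ?E i) \<longlongrightarrow> g) (finite_subsets_at_top UNIV)"
        using onb_family_expansion[OF E, of g] by (simp add: has_sum_def)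
    qed
    moreover have "\<forall>\<^sub>F F in finite_subsets_at_top UNIV.
        (\<Sum>i\<in>F. cinner (?E i) f *\<^sub>C ?E i, \<Sum>i\<in>F. cinner (?E i) f *\<^sub>C of_real (?\<mu> i) *\<^sub>C ?E i) \<in> closure ?S"
    proof (rule eventually_finite_subsets_at_top_weakI)
      fix F :: "(nat \<times> nat) set" assume "finite F"
      from fin[OF this, of "\<lambda>i. cinner (?E i) f"]
      show "(\<Sum>i\<in>F. cinner (?E i) f *\<^sub>C ?E i, \<Sum>i\<in>F. cinner (?E i) f *\<^sub>C of_real (?\<mu> i) *\<^sub>C ?E i) \<in> closure ?S"
        by (intro closure_subset[THEN subsetD]) blast
    qed
    ultimately show "(f, g) \<in> closure ?S"
      by (intro Lim_in_closed_set[OF closed_closure]) auto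
  qed
  ultimately show ?thesis by (auto simp: cost_op_def)
qed

lemma op_sqrt_cost_op:
  assumes \<kappa>: "\<kappa> > 0"
  shows "op_sqrt (cost_op \<kappa>) = diag_op (hermite_plane \<kappa>) (\<lambda>i. sqrt (cost_eigenvalue \<kappa> i))"
proof -
  have pos: "0 \<le> cost_eigenvalue \<kappa> i" for i using \<kappa> by (simp add: cost_eigenvalue_def)
  show ?thesis
    using op_sqrt_diag_op[OF onb_family_hermite_plane[OF \<kappa>], of "\<lambda>i. sqrt (cost_eigenvalue \<kappa> i)"]
    by (simp add: cost_op_eq_diag_op[OF \<kappa>] pos)
qed

section \<open>Coherent states\<close>

definition coherent_fun :: "real \<Rightarrow> real \<Rightarrow> real \<Rightarrow> real" where
  "coherent_fun \<kappa> c x = (pi * \<kappa>) powr (- 1 / 4) * exp (- (x - c)\<^sup>2 / (2 * \<kappa>))"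

text \<open>A product of two equally wide Gaussians is a Gaussian at the midpoint with variance
  \<open>\<kappa> / 2\<close>, so overlaps follow from the normalization of the normal
  density.\<close>

lemma coherent_fun_mult:
  assumes \<kappa>: "\<kappa> > 0"
  shows "coherent_fun \<kappa> c x * coherent_fun \<kappa> c' x
    = exp (- (c - c')\<^sup>2 / (4 * \<kappa>)) * normal_density ((c + c') / 2) (sqrt (\<kappa> / 2)) x"
proof -
  have "(pi * \<kappa>) powr (- 1 / 4) * (pi * \<kappa>) powr (- 1 / 4) = 1 / sqrt (pi * \<kappa>)"
    using \<kappa> by (simp add: powr_add[symmetric] powr_minus_divide powr_half_sqrt)
  moreover have "- (x - c)\<^sup>2 / (2 * \<kappa>) + - (x - c')\<^sup>2 / (2 * \<kappa>)
      = - (c - c')\<^sup>2 / (4 * \<kappa>) + - (x - (c + c') / 2)\<^sup>2 / \<kappa>"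
    using \<kappa> by (simp add: field_simps power2_eq_square)
  then have "exp (- (x - c)\<^sup>2 / (2 * \<kappa>)) * exp (- (x - c')\<^sup>2 / (2 * \<kappa>))
      = exp (- (c - c')\<^sup>2 / (4 * \<kappa>)) * exp (- (x - (c + c') / 2)\<^sup>2 / \<kappa>)"
    unfolding exp_add[symmetric] by simp
  moreover have "normal_density ((c + c') / 2) (sqrt (\<kappa> / 2)) x = 1 / sqrt (pi * \<kappa>) * exp (- (x - (c + c') / 2)\<^sup>2 / \<kappa>)"
    using \<kappa> by (simp add: normal_density_def)
  moreover have "coherent_fun \<kappa> c x * coherent_fun \<kappa> c' x = ((pi * \<kappa>) powr (- 1 / 4) * (pi * \<kappa>) powr (- 1 / 4))
      * (exp (- (x - c)\<^sup>2 / (2 * \<kappa>)) * exp (- (x - c')\<^sup>2 / (2 * \<kappa>)))"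
    unfolding coherent_fun_def by (simp only: mult_ac)
  ultimately show ?thesis by (simp only: mult_ac)
qed

lemma coherent_fun_integral:
  assumes \<kappa>: "\<kappa> > 0"
  shows "integrable lborel (\<lambda>x. coherent_fun \<kappa> c x * coherent_fun \<kappa> c' x)"
    "(\<integral>x. coherent_fun \<kappa> c x * coherent_fun \<kappa> c' x \<partial>lborel) = exp (- (c - c')\<^sup>2 / (4 * \<kappa>))"
  using \<kappa> by (simp_all add: coherent_fun_mult integrable_normal_density integral_normal_density)

lemma square_integrable_coherent_fun:
  assumes "\<kappa> > 0"
  shows "square_integrable (\<lambda>x. complex_of_real (coherent_fun \<kappa> c x))"
proof -
  have "(\<lambda>x. coherent_fun \<kappa> c x) \<in> borel_measurable borel"
    unfolding coherent_fun_def by measurable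
  then show ?thesis
    using coherent_fun_integral(1)[OF assms, of c c] by (simp add: square_integrable_def power2_eq_square flip: abs_mult)
qed

lemma coherent_eq: "coherent \<kappa> c = to_L2 (\<lambda>x. complex_of_real (coherent_fun \<kappa> c x))"
  by (simp add: coherent_def coherent_fun_def)

lemma cinner_coherent:
  assumes "\<kappa> > 0"
  shows "cinner (coherent \<kappa> c) (coherent \<kappa> c') = of_real (exp (- (c - c')\<^sup>2 / (4 * \<kappa>)))"
proof -
  have "cinner (coherent \<kappa> c) (coherent \<kappa> c') = (\<integral>x. complex_of_real (coherent_fun \<kappa> c x * coherent_fun \<kappa> c' x) \<partial>lborel)"
    by (simp add: coherent_eq cinner_to_L2 square_integrable_coherent_fun assms)
  also have "\<dots> = of_real (exp (- (c - c')\<^sup>2 / (4 * \<kappa>)))"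
    unfolding integral_complex_of_real coherent_fun_integral(2)[OF assms] ..
  finally show ?thesis .
qed

lemma norm_coherent: "\<kappa> > 0 \<Longrightarrow> norm (coherent \<kappa> c) = 1"
proof -
  assume "\<kappa> > 0"
  then have "complex_of_real ((norm (coherent \<kappa> c))\<^sup>2) = of_real 1"
    unfolding cinner_self[symmetric] by (simp add: cinner_coherent)
  then have "(norm (coherent \<kappa> c))\<^sup>2 = 1" by (simp only: of_real_eq_iff)
  then show ?thesis using norm_ge_zero[of "coherent \<kappa> c"] by (auto simp: power2_eq_1_iff)
qed

definition coherent_pair :: "real \<Rightarrow> real \<times> real \<Rightarrow> (real \<times> real) L2" where
  "coherent_pair \<kappa> p = tensor (coherent \<kappa> (fst p)) (coherent \<kappa> (snd p))"

definition coherent_pair_fun :: "real \<Rightarrow> real \<times> real \<Rightarrow> real \<times> real \<Rightarrow> complex" where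
  "coherent_pair_fun \<kappa> p z = complex_of_real ((pi * \<kappa>) powr (- 1 / 4) * (pi * \<kappa>) powr (- 1 / 4) * plane_gaussian \<kappa> (fst p) (snd p) z)"

lemma coherent_pair_eq:
  assumes \<kappa>: "\<kappa> > 0"
  shows "coherent_pair \<kappa> p = to_L2 (coherent_pair_fun \<kappa> p)"
proof -
  have "complex_of_real (coherent_fun \<kappa> (fst p) x) * complex_of_real (coherent_fun \<kappa> (snd p) y) = coherent_pair_fun \<kappa> p (x, y)" for x y
  proof -
    have "- (x - fst p)\<^sup>2 / (2 * \<kappa>) + - (y - snd p)\<^sup>2 / (2 * \<kappa>) = - ((x - fst p)\<^sup>2 + (y - snd p)\<^sup>2) / (2 * \<kappa>)"
      by (simp add: add_divide_distrib diff_divide_distrib)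
    then have "plane_gaussian \<kappa> (fst p) (snd p) (x, y) = exp (- (x - fst p)\<^sup>2 / (2 * \<kappa>)) * exp (- (y - snd p)\<^sup>2 / (2 * \<kappa>))"
      unfolding plane_gaussian_def exp_add[symmetric] by simp
    then show ?thesis
      unfolding coherent_fun_def coherent_pair_fun_def of_real_mult[symmetric] of_real_eq_iff by (simp only: mult_ac)
  qed
  then have "(\<lambda>(x, y). complex_of_real (coherent_fun \<kappa> (fst p) x) * complex_of_real (coherent_fun \<kappa> (snd p) y)) = coherent_pair_fun \<kappa> p"
    by (simp only: fun_eq_iff split_paired_All case_prod_conv simp_thms)
  then show ?thesis
    unfolding coherent_pair_def coherent_eq
      tensor_to_L2[OF square_integrable_coherent_fun[OF \<kappa>] square_integrable_coherent_fun[OF \<kappa>]] by (simp only:)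
qed

lemma schwartz_coherent_pair:
  assumes \<kappa>: "\<kappa> > 0"
  shows "schwartz (coherent_pair_fun \<kappa> p)"
  unfolding coherent_pair_fun_def[abs_def]
  by (rule schwartz_poly_gaussian[OF \<kappa> real_polynomial_function.intros(2)])

section \<open>The cost on products of coherent states\<close>

lemma dx_minus_dy_poly_gaussian:
  assumes \<kappa>: "\<kappa> > 0" and p: "\<And>z. (p has_derivative (\<lambda>(s, t). s * px z + t * py z)) (at z)"
  shows "dx_minus_dy (\<lambda>z. complex_of_real (p z * plane_gaussian \<kappa> \<alpha> \<beta> z)) z
    = complex_of_real ((px z - py z + (\<alpha> - \<beta> - (fst z - snd z)) / \<kappa> * p z) * plane_gaussian \<kappa> \<alpha> \<beta> z)"
  unfolding dx_minus_dy_def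
    frechet_derivative_at[OF has_derivative_of_real[OF has_derivative_mult[OF p plane_gaussian_derivative[OF \<kappa>]]], symmetric]
    of_real_diff[symmetric] of_real_eq_iff
  using \<kappa> by (simp add: field_simps)

lemma dx_minus_dy_coherent_pair:
  assumes \<kappa>: "\<kappa> > 0"
  shows "dx_minus_dy (coherent_pair_fun \<kappa> p) z
    = complex_of_real ((fst p - snd p - (fst z - snd z)) / \<kappa>) * coherent_pair_fun \<kappa> p z"
proof -
  define N where "N = (pi * \<kappa>) powr (- 1 / 4) * (pi * \<kappa>) powr (- 1 / 4)"
  have "((\<lambda>z. N) has_derivative (\<lambda>(s, t). s * 0 + t * 0)) (at z)" for z :: "real \<times> real"
    by (simp add: case_prod_beta')
  from dx_minus_dy_poly_gaussian[OF \<kappa> this, of "fst p" "snd p" z] show ?thesis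
    unfolding coherent_pair_fun_def[abs_def] N_def[symmetric]
    by (simp only: of_real_mult[symmetric] mult.assoc diff_self add_0)
qed

text \<open>With w = x - y and D the derivative \<open>dx_minus_dy\<close>, the cost factors as (w -
  \<kappa> D)(w + \<kappa> D). The right factor has the pair as eigenvector with eigenvalue
  \<open>d p\<close>, and on it the left factor is \<open>d p\<close> minus 2 \<kappa> D. The
  remaining derivative is kept in order to exploit skew-adjointness.\<close>

lemma cost_expr_coherent_pair:
  assumes \<kappa>: "\<kappa> > 0"
  defines "d \<equiv> \<lambda>p. fst p - snd p"
  shows "cost_expr \<kappa> (coherent_pair_fun \<kappa> p)
    = (\<lambda>z. complex_of_real ((d p)\<^sup>2) * coherent_pair_fun \<kappa> p z
        + complex_of_real (- 2 * \<kappa> * d p) * dx_minus_dy (coherent_pair_fun \<kappa> p) z)"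
proof
  fix z
  define N where "N = (pi * \<kappa>) powr (- 1 / 4) * (pi * \<kappa>) powr (- 1 / 4)"
  let ?G = "plane_gaussian \<kappa> (fst p) (snd p)"
  define q where "q z = (d p - (fst z - snd z)) / \<kappa> * N" for z :: "real \<times> real"
  have \<psi>: "coherent_pair_fun \<kappa> p = (\<lambda>z. complex_of_real (N * ?G z))"
    by (simp only: coherent_pair_fun_def[abs_def] N_def)
  have d1: "dx_minus_dy (coherent_pair_fun \<kappa> p) = (\<lambda>z. complex_of_real (q z * ?G z))"
  proof
    show "dx_minus_dy (coherent_pair_fun \<kappa> p) z = complex_of_real (q z * ?G z)" for z
      using dx_minus_dy_coherent_pair[OF \<kappa>, of p z]
      unfolding \<psi> q_def d_def by (simp only: of_real_mult mult.assoc)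
  qed
  have "(q has_derivative (\<lambda>(s, t). s * (- 1 / \<kappa> * N) + t * (1 / \<kappa> * N))) (at z)" for z
  proof -
    define M where "M = N / \<kappa>"
    have q': "q = (\<lambda>z. (d p - (fst z - snd z)) * M)" by (simp add: q_def M_def fun_eq_iff)
    have "(q has_derivative (\<lambda>(s, t). s * (- M) + t * M)) (at z)"
      unfolding q' by (auto intro!: derivative_eq_intros simp: fun_eq_iff left_diff_distrib)
    then show ?thesis by (simp add: M_def)
  qed
  \<comment> \<open>The two terms \<open>- 1 / \<kappa> * N\<close> come from differentiating
    \<open>q\<close>; multiplied by \<open>- \<kappa>\<^sup>2\<close> they cancel the constant
    \<open>- 2 * \<kappa>\<close> of the cost.\<close>
  then have d2: "dx_minus_dy (\<lambda>z. complex_of_real (q z * ?G z)) z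
      = complex_of_real ((- 1 / \<kappa> * N - 1 / \<kappa> * N + (d p - (fst z - snd z)) / \<kappa> * q z) * ?G z)"
    unfolding d_def by (rule dx_minus_dy_poly_gaussian[OF \<kappa>])
  define w where "w = fst z - snd z"
  have "cost_expr \<kappa> (coherent_pair_fun \<kappa> p) z = w\<^sup>2 *\<^sub>R coherent_pair_fun \<kappa> p z
      - \<kappa>\<^sup>2 *\<^sub>R dx_minus_dy (dx_minus_dy (coherent_pair_fun \<kappa> p)) z - (2 * \<kappa>) *\<^sub>R coherent_pair_fun \<kappa> p z"
    by (simp add: cost_expr_def w_def case_prod_beta')
  also have "\<dots> = complex_of_real (w\<^sup>2 * (N * ?G z)
      - \<kappa>\<^sup>2 * ((- 1 / \<kappa> * N - 1 / \<kappa> * N + (d p - w) / \<kappa> * q z) * ?G z) - 2 * \<kappa> * (N * ?G z))"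
    unfolding d1 unfolding d2 w_def unfolding \<psi> scaleR_conv_of_real by (simp only: of_real_mult of_real_diff)
  also have "w\<^sup>2 * (N * ?G z)
      - \<kappa>\<^sup>2 * ((- 1 / \<kappa> * N - 1 / \<kappa> * N + (d p - w) / \<kappa> * q z) * ?G z) - 2 * \<kappa> * (N * ?G z)
      = (d p)\<^sup>2 * (N * ?G z) + (- 2 * \<kappa> * d p) * (q z * ?G z)"
    unfolding q_def w_def[symmetric] using \<kappa> by (simp add: field_simps power2_eq_square)
  finally show "cost_expr \<kappa> (coherent_pair_fun \<kappa> p) z
      = complex_of_real ((d p)\<^sup>2) * coherent_pair_fun \<kappa> p z
        + complex_of_real (- 2 * \<kappa> * d p) * dx_minus_dy (coherent_pair_fun \<kappa> p) z"
    unfolding d1 unfolding \<psi> of_real_mult of_real_add .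
qed

text \<open>
  Skew-adjointness of \<open>\<partial>\<^sub>x - \<partial>\<^sub>y\<close> gives its matrix elements between coherent states, so that no Gaussian
  moments have to be computed.
\<close>

lemma cinner_cost_coherent_pair:
  assumes \<kappa>: "\<kappa> > 0"
  defines "d \<equiv> \<lambda>p. fst p - snd p"
  shows "cinner (coherent_pair \<kappa> p') (to_L2 (cost_expr \<kappa> (coherent_pair_fun \<kappa> p)))
    = complex_of_real (d p * d p') * cinner (coherent_pair \<kappa> p') (coherent_pair \<kappa> p)"
proof -
  let ?\<psi> = "coherent_pair_fun \<kappa>"
  note s = schwartz_coherent_pair[OF \<kappa>]
  note sq = schwartz_square_integrable[OF s] schwartz_square_integrable[OF schwartz_dx_minus_dy[OF s]]
  define G where "G = cinner (to_L2 (?\<psi> p')) (to_L2 (?\<psi> p))"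
  define D where "D = cinner (to_L2 (?\<psi> p')) (to_L2 (dx_minus_dy (?\<psi> p)))"
  have "D - cinner (to_L2 (dx_minus_dy (?\<psi> p'))) (to_L2 (?\<psi> p))
      = (\<integral>z. cnj (?\<psi> p' z) * dx_minus_dy (?\<psi> p) z - cnj (dx_minus_dy (?\<psi> p') z) * ?\<psi> p z \<partial>lborel)"
    by (simp add: D_def cinner_to_L2 sq integrable_cnj_mult)
  \<comment> \<open>Multiplication by x - y occurs in both derivatives and cancels in the
    difference, which leaves a multiple of the overlap.\<close>
  also have "\<dots> = (\<integral>z. complex_of_real ((d p - d p') / \<kappa>) * (cnj (?\<psi> p' z) * ?\<psi> p z) \<partial>lborel)"
  proof (rule Bochner_Integration.integral_cong[OF refl])
    fix z
    have "cnj (?\<psi> p' z) * dx_minus_dy (?\<psi> p) z - cnj (dx_minus_dy (?\<psi> p') z) * ?\<psi> p z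
        = complex_of_real ((fst p - snd p - (fst z - snd z)) / \<kappa> - (fst p' - snd p' - (fst z - snd z)) / \<kappa>)
            * (cnj (?\<psi> p' z) * ?\<psi> p z)"
      unfolding dx_minus_dy_coherent_pair[OF \<kappa>] of_real_diff complex_cnj_mult complex_cnj_complex_of_real
      by (simp only: left_diff_distrib right_diff_distrib mult_ac)
    also have "(fst p - snd p - (fst z - snd z)) / \<kappa> - (fst p' - snd p' - (fst z - snd z)) / \<kappa> = (d p - d p') / \<kappa>"
      by (simp add: d_def diff_divide_distrib)
    finally show "cnj (?\<psi> p' z) * dx_minus_dy (?\<psi> p) z - cnj (dx_minus_dy (?\<psi> p') z) * ?\<psi> p z
        = complex_of_real ((d p - d p') / \<kappa>) * (cnj (?\<psi> p' z) * ?\<psi> p z)" .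
  qed
  also have "\<dots> = complex_of_real ((d p - d p') / \<kappa>) * G"
    by (simp add: G_def cinner_to_L2 sq)
  finally have DG: "2 * D = complex_of_real ((d p - d p') / \<kappa>) * G"
    using dx_minus_dy_adjoint[OF s[of p'] s[of p]] by (simp add: D_def)
  have "complex_of_real (- 2 * \<kappa> * d p) * D = complex_of_real (- \<kappa> * d p) * (2 * D)" by simp
  then have D: "complex_of_real (- 2 * \<kappa> * d p) * D = complex_of_real (- \<kappa> * d p) * (complex_of_real ((d p - d p') / \<kappa>) * G)"
    by (simp only: DG)
  have "to_L2 (cost_expr \<kappa> (?\<psi> p)) = complex_of_real ((d p)\<^sup>2) *\<^sub>C to_L2 (?\<psi> p)
      + complex_of_real (- 2 * \<kappa> * d p) *\<^sub>C to_L2 (dx_minus_dy (?\<psi> p))"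
    unfolding cost_expr_coherent_pair[OF \<kappa>] d_def
    by (simp only: scaleC_to_L2 plus_to_L2 square_integrable_cmult sq)
  then have "cinner (to_L2 (?\<psi> p')) (to_L2 (cost_expr \<kappa> (?\<psi> p)))
      = complex_of_real ((d p)\<^sup>2) * G + complex_of_real (- 2 * \<kappa> * d p) * D"
    by (simp only: cinner_add_right cinner_scaleC_right G_def D_def)
  also have "\<dots> = complex_of_real ((d p)\<^sup>2 + (- \<kappa> * d p) * ((d p - d p') / \<kappa>)) * G"
    unfolding D by (simp only: of_real_add of_real_mult distrib_right mult.assoc)
  also have "(d p)\<^sup>2 + (- \<kappa> * d p) * ((d p - d p') / \<kappa>) = d p * d p'"
    using \<kappa> by (simp add: field_simps power2_eq_square)
  finally show ?thesis by (simp add: coherent_pair_eq[OF \<kappa>] G_def)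
qed

section \<open>Mixtures of pure states and their couplings\<close>

definition mixture :: "'k set \<Rightarrow> ('k \<Rightarrow> real) \<Rightarrow> ('k \<Rightarrow> 'a::euclidean_space L2) \<Rightarrow> 'a L2 \<Rightarrow> 'a L2" where
  "mixture K w \<phi> f = (\<Sum>k\<in>K. w k *\<^sub>R cinner (\<phi> k) f *\<^sub>C \<phi> k)"

lemma bounded_op_mixture: "bounded_op (mixture K w \<phi>)"
  unfolding mixture_def[abs_def] scaleR_scaleC_commute by (intro bounded_op_sum bounded_op_rank_one)

lemma op_trace_mixture:
  fixes \<phi> :: "'k \<Rightarrow> 'a::euclidean_space L2"
  assumes B: "\<exists>B::'a L2 set. orthonormal_basis B" and K: "finite K" and T: "bounded_op T"
  shows "op_trace (T \<circ> mixture K w \<phi>) = (\<Sum>k\<in>K. of_real (w k) * cinner (\<phi> k) (T (\<phi> k)))"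
proof -
  have "(T \<circ> mixture K w \<phi>) f = (\<Sum>k\<in>K. cinner (\<phi> k) f *\<^sub>C w k *\<^sub>R T (\<phi> k))" for f
    by (simp add: mixture_def bounded_op_simps[OF T] scaleR_scaleC_commute)
  from op_trace_finite_rank[OF B K this] show ?thesis by (simp add: o_def)
qed

lemma density_matrix_mixture:
  fixes \<phi> :: "'k \<Rightarrow> 'a::euclidean_space L2"
  assumes B: "\<exists>B::'a L2 set. orthonormal_basis B" and K: "finite K"
    and w: "\<And>k. 0 \<le> w k" "sum w K = 1" and \<phi>: "\<And>k. norm (\<phi> k) = 1"
  shows "density_matrix (mixture K w \<phi>)"
proof -
  have form: "cinner f (mixture K w \<phi> g) = (\<Sum>k\<in>K. of_real (w k) * (cinner (\<phi> k) g * cinner f (\<phi> k)))" for f g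
    by (simp add: mixture_def cinner_sum_right)
  have "cinner (mixture K w \<phi> f) g = cinner f (mixture K w \<phi> g)" for f g
  proof -
    have "cinner (mixture K w \<phi> f) g = cnj (cinner g (mixture K w \<phi> f))" by (rule cinner_commute)
    also have "\<dots> = (\<Sum>k\<in>K. of_real (w k) * (cinner f (\<phi> k) * cinner (\<phi> k) g))"
      by (simp add: form cinner_commute[of f] cinner_commute[of g])
    finally show ?thesis by (simp add: form mult.commute)
  qed
  moreover have "0 \<le> Re (cinner f (mixture K w \<phi> f))" for f
  proof -
    have "cinner (\<phi> k) f * cinner f (\<phi> k) = of_real ((cmod (cinner (\<phi> k) f))\<^sup>2)" for k
      unfolding cinner_commute[of f] complex_norm_square ..
    then show ?thesis unfolding form by (auto intro!: sum_nonneg simp: w simp del: of_real_power)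
  qed
  moreover have "op_trace (mixture K w \<phi>) = 1"
  proof -
    have "bounded_op (id :: 'a L2 \<Rightarrow> 'a L2)"
      by (rule bounded_op_intros(5)[OF bounded_op_mixture bounded_op_mixture])
    from op_trace_mixture[OF B K this, of w \<phi>] show ?thesis
      by (simp add: cinner_self \<phi> w(2) flip: of_real_sum)
  qed
  ultimately show ?thesis unfolding density_matrix_def using bounded_op_mixture by blast
qed

section \<open>The span of two opposite coherent states\<close>

text \<open>The basis dual to the two nonorthogonal vectors \<open>coherent \<kappa> c\<close> and
  \<open>coherent \<kappa> (- c)\<close> within their span. The exponential is their overlap, and
  the formula inverts their Gram matrix.\<close>

definition coherent_dual :: "real \<Rightarrow> real \<Rightarrow> real L2" where
  "coherent_dual \<kappa> c = of_real (1 / (1 - (exp (- c\<^sup>2 / \<kappa>))\<^sup>2)) *\<^sub>C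
     (coherent \<kappa> c - of_real (exp (- c\<^sup>2 / \<kappa>)) *\<^sub>C coherent \<kappa> (- c))"

lemma cinner_coherent_dual:
  assumes \<kappa>: "\<kappa> > 0" and c: "c > 0" and \<gamma>: "\<gamma> \<in> {c, - c}" "\<alpha> \<in> {c, - c}"
  shows "cinner (coherent_dual \<kappa> \<gamma>) (coherent \<kappa> \<alpha>) = (if \<gamma> = \<alpha> then 1 else 0)"
    "cinner (coherent \<kappa> \<alpha>) (coherent_dual \<kappa> \<gamma>) = (if \<gamma> = \<alpha> then 1 else 0)"
proof -
  define r where "r = exp (- c\<^sup>2 / \<kappa>)"
  have "r < 1" "r > 0" using \<kappa> c by (simp_all add: r_def)
  then have "r\<^sup>2 < 1" by (simp add: power_less_one_iff abs_square_less_1)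
  then have k: "1 - r\<^sup>2 \<noteq> 0" by simp
  have "- (c - - c)\<^sup>2 / (4 * \<kappa>) = - c\<^sup>2 / \<kappa>" "- (- c - c)\<^sup>2 / (4 * \<kappa>) = - c\<^sup>2 / \<kappa>"
    using \<kappa> by (simp_all add: field_simps power2_eq_square)
  then have coh: "cinner (coherent \<kappa> c) (coherent \<kappa> c) = 1" "cinner (coherent \<kappa> (- c)) (coherent \<kappa> (- c)) = 1"
    "cinner (coherent \<kappa> c) (coherent \<kappa> (- c)) = of_real r" "cinner (coherent \<kappa> (- c)) (coherent \<kappa> c) = of_real r"
    unfolding cinner_coherent[OF \<kappa>] r_def by simp_all
  have d: "coherent_dual \<kappa> c = of_real (1 / (1 - r\<^sup>2)) *\<^sub>C (coherent \<kappa> c - of_real r *\<^sub>C coherent \<kappa> (- c))"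
    "coherent_dual \<kappa> (- c) = of_real (1 / (1 - r\<^sup>2)) *\<^sub>C (coherent \<kappa> (- c) - of_real r *\<^sub>C coherent \<kappa> c)"
    by (simp_all add: coherent_dual_def r_def)
  have one: "complex_of_real (1 / (1 - r\<^sup>2)) * (1 - of_real r * of_real r) = 1"
  proof -
    have "complex_of_real (1 / (1 - r\<^sup>2)) * (1 - of_real r * of_real r) = of_real (1 / (1 - r\<^sup>2) * (1 - r * r))"
      by (simp only: of_real_mult of_real_diff of_real_1)
    then show ?thesis using k by (simp add: power2_eq_square)
  qed
  show 1: "cinner (coherent_dual \<kappa> \<gamma>) (coherent \<kappa> \<alpha>) = (if \<gamma> = \<alpha> then 1 else 0)"
    using \<gamma> c one unfolding insert_iff empty_iff
    by (elim disjE) (simp_all only: d cinner_scaleC_left cinner_diff_left coh complex_cnj_complex_of_real, simp_all)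
  show "cinner (coherent \<kappa> \<alpha>) (coherent_dual \<kappa> \<gamma>) = (if \<gamma> = \<alpha> then 1 else 0)"
    by (subst cinner_commute) (simp add: 1)
qed

text \<open>The orthogonal projection onto the span, written with the dual basis because the
  coherent states are not orthogonal.\<close>

definition coherent_proj :: "real \<Rightarrow> real \<Rightarrow> real L2 \<Rightarrow> real L2" where
  "coherent_proj \<kappa> c f = (\<Sum>\<alpha>\<in>{c, - c}. cinner (coherent \<kappa> \<alpha>) f *\<^sub>C coherent_dual \<kappa> \<alpha>)"

text \<open>The inverse Gram matrix is real and symmetric, so the roles of the basis and its dual
  may be exchanged. One form shows which vectors are fixed, and the two together give
  self-adjointness.\<close>

lemma coherent_proj_eq:
  assumes "c > 0"
  shows "coherent_proj \<kappa> c f = (\<Sum>\<alpha>\<in>{c, - c}. cinner (coherent_dual \<kappa> \<alpha>) f *\<^sub>C coherent \<kappa> \<alpha>)"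
  by (rule cinner_cong_all)
     (use assms in \<open>simp add: coherent_proj_def coherent_dual_def cinner_add_right cinner_diff_right
        cinner_diff_left algebra_simps del: of_real_divide of_real_diff of_real_1 of_real_power\<close>)

lemma coherent_proj_coherent:
  assumes "\<kappa> > 0" "c > 0" "\<alpha> \<in> {c, - c}"
  shows "coherent_proj \<kappa> c (coherent \<kappa> \<alpha>) = coherent \<kappa> \<alpha>"
proof -
  have "coherent_proj \<kappa> c (coherent \<kappa> \<alpha>) = (\<Sum>\<gamma>\<in>{c, - c}. if \<gamma> = \<alpha> then coherent \<kappa> \<gamma> else 0)"
    unfolding coherent_proj_eq[OF assms(2)]
    by (rule sum.cong[OF refl]) (simp add: cinner_coherent_dual(1)[OF assms(1,2) _ assms(3)])
  then show ?thesis using assms(3) by simp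
qed

lemma bounded_op_coherent_proj: "bounded_op (coherent_proj \<kappa> c)"
  unfolding coherent_proj_def[abs_def] by (intro bounded_op_sum bounded_op_rank_one)

lemma coherent_proj_symmetric:
  assumes "c > 0"
  shows "cinner (coherent_proj \<kappa> c f) g = cinner f (coherent_proj \<kappa> c g)"
proof -
  have "cinner (coherent_proj \<kappa> c f) g = (\<Sum>\<alpha>\<in>{c, - c}. cinner f (coherent \<kappa> \<alpha>) * cinner (coherent_dual \<kappa> \<alpha>) g)"
    unfolding coherent_proj_def cinner_sum_left cinner_scaleC_left cinner_commute[of f] ..
  also have "\<dots> = cinner f (coherent_proj \<kappa> c g)"
    unfolding coherent_proj_eq[OF assms] cinner_sum_right cinner_scaleC_right by (simp only: mult.commute)
  finally show ?thesis .
qed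

lemma coherent_proj_idem:
  assumes "\<kappa> > 0" "c > 0"
  shows "coherent_proj \<kappa> c (coherent_proj \<kappa> c f) = coherent_proj \<kappa> c f"
proof -
  have "coherent_proj \<kappa> c (\<Sum>\<alpha>\<in>{c, - c}. cinner (coherent_dual \<kappa> \<alpha>) f *\<^sub>C coherent \<kappa> \<alpha>)
      = (\<Sum>\<alpha>\<in>{c, - c}. cinner (coherent_dual \<kappa> \<alpha>) f *\<^sub>C coherent \<kappa> \<alpha>)"
    unfolding bounded_op_simps[OF bounded_op_coherent_proj]
    by (rule sum.cong[OF refl]) (simp only: coherent_proj_coherent[OF assms])
  then show ?thesis by (simp only: coherent_proj_eq[OF assms(2)])
qed

text \<open>An operator on the span of \<open>coherent \<kappa> (\<plusminus> c)\<close> playing the role of \<open>X\<^sup>* X\<close> for the annihilation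
  operator \<open>X\<close>, of which coherent states are eigenvectors.\<close>

lemma ex_number_operator:
  assumes \<kappa>: "\<kappa> > 0" and c: "c > 0"
  shows "\<exists>A. bounded_op A \<and> (\<forall>\<alpha>\<in>{c, - c}. \<forall>\<alpha>'\<in>{c, - c}.
    cinner (coherent \<kappa> \<alpha>') (A (coherent \<kappa> \<alpha>)) = of_real (\<alpha> * \<alpha>') * cinner (coherent \<kappa> \<alpha>') (coherent \<kappa> \<alpha>))"
proof -
  \<comment> \<open>\<open>X\<close> has the two coherent states as eigenvectors, by duality, and
    \<open>Y\<close> is its adjoint; the required operator is their composition.\<close>
  define X where "X f = (\<Sum>\<gamma>\<in>{c, - c}. cinner (coherent_dual \<kappa> \<gamma>) f *\<^sub>C of_real \<gamma> *\<^sub>C coherent \<kappa> \<gamma>)" for f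
  define Y where "Y f = (\<Sum>\<gamma>\<in>{c, - c}. cinner (coherent \<kappa> \<gamma>) f *\<^sub>C of_real \<gamma> *\<^sub>C coherent_dual \<kappa> \<gamma>)" for f
  have "bounded_op X" "bounded_op Y"
    unfolding X_def[abs_def] Y_def[abs_def] by (intro bounded_op_sum bounded_op_rank_one)+
  then have "bounded_op (Y \<circ> X)" by (intro bounded_op_intros(1))
  moreover have "cinner (coherent \<kappa> \<alpha>') ((Y \<circ> X) (coherent \<kappa> \<alpha>)) = of_real (\<alpha> * \<alpha>') * cinner (coherent \<kappa> \<alpha>') (coherent \<kappa> \<alpha>)"
    if \<alpha>: "\<alpha> \<in> {c, - c}" "\<alpha>' \<in> {c, - c}" for \<alpha> \<alpha>'
  proof -
    have "X (coherent \<kappa> \<alpha>) = (\<Sum>\<gamma>\<in>{c, - c}. if \<gamma> = \<alpha> then of_real \<gamma> *\<^sub>C coherent \<kappa> \<gamma> else 0)"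
      unfolding X_def by (rule sum.cong[OF refl]) (simp add: cinner_coherent_dual(1)[OF \<kappa> c _ \<alpha>(1)])
    then have X: "X (coherent \<kappa> \<alpha>) = of_real \<alpha> *\<^sub>C coherent \<kappa> \<alpha>" using \<alpha>(1) by simp
    have "cinner (coherent \<kappa> \<alpha>') (Y g) = (\<Sum>\<gamma>\<in>{c, - c}. if \<gamma> = \<alpha>' then of_real \<gamma> * cinner (coherent \<kappa> \<gamma>) g else 0)" for g
      unfolding Y_def cinner_sum_right
      by (rule sum.cong[OF refl]) (simp add: cinner_coherent_dual(2)[OF \<kappa> c _ \<alpha>(2)])
    then have "cinner (coherent \<kappa> \<alpha>') (Y g) = of_real \<alpha>' * cinner (coherent \<kappa> \<alpha>') g" for g
      using \<alpha>(2) by simp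
    then show ?thesis by (simp add: X)
  qed
  ultimately show ?thesis by blast
qed

section \<open>The support of a coupling\<close>

text \<open>Applies \<open>projection_trace_zero\<close> to the complementary projection; a density
  matrix with no mass there annihilates its range.\<close>

lemma density_support:
  fixes Q P :: "(real \<times> real) L2 \<Rightarrow> (real \<times> real) L2"
  assumes Q: "density_matrix Q" and P: "bounded_op P" and sym: "\<And>F G. cinner (P F) G = cinner F (P G)"
    and idem: "\<And>F. P (P F) = P F" and tr: "op_trace ((\<lambda>F. F - P F) \<circ> Q) = 0"
  shows "Q (P F) = Q F"
proof -
  let ?B = "SOME B::(real \<times> real) L2 set. orthonormal_basis B"
  have Q': "bounded_op Q" "\<And>f g. cinner (Q f) g = cinner f (Q g)" "\<And>f. 0 \<le> Re (cinner f (Q f))" "op_trace Q = 1"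
    using Q by (auto simp: density_matrix_def)
  have "bounded_op (\<lambda>F. id F - P F)"
    by (rule bounded_op_intros(3)[OF bounded_op_intros(5)[OF P P] P])
  then have M: "bounded_op (\<lambda>F. F - P F)" by simp
  \<comment> \<open>The trace of \<open>Q\<close> is 1 and thus differs from the default value 0 of
    a divergent \<open>infsum\<close>, which forces convergence.\<close>
  have "(\<lambda>e. cinner e (Q e)) summable_on ?B"
    using Q'(4) infsum_not_exists[of "\<lambda>e. cinner e (Q e)" ?B] unfolding op_trace_def by (metis zero_neq_one)
  then have "Q (F - P F) = 0"
    using projection_trace_zero[OF Q'(1-3) M _ _ someI_ex[OF ex_orthonormal_basis_plane], of F] tr
    by (simp add: op_trace_def cinner_diff_left cinner_diff_right sym idem bounded_op_simps[OF P])
  then show ?thesis by (simp add: bounded_op_simps[OF Q'(1)])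
qed

definition coherent_pair_dual :: "real \<Rightarrow> real \<times> real \<Rightarrow> (real \<times> real) L2" where
  "coherent_pair_dual \<kappa> p = tensor (coherent_dual \<kappa> (fst p)) (coherent_dual \<kappa> (snd p))"

abbreviation half_mixture :: "(real \<Rightarrow> 'a::euclidean_space L2) \<Rightarrow> 'a L2 \<Rightarrow> 'a L2" where
  "half_mixture \<phi> \<equiv> mixture {1, - 1 :: real} (\<lambda>_. 1 / 2) \<phi>"

lemma op_trace_complement:
  fixes P T :: "'a::euclidean_space L2 \<Rightarrow> 'a L2"
  assumes P: "bounded_op P" and fixed: "\<And>k. k \<in> K \<Longrightarrow> P (\<phi> k) = \<phi> k"
  shows "op_trace ((\<lambda>f. f - P f) \<circ> mixture K w \<phi>) = 0"
proof -
  have "P (mixture K w \<phi> f) = mixture K w \<phi> f" for f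
    unfolding mixture_def bounded_op_simps[OF P] by (intro sum.cong) (simp_all add: fixed)
  then show ?thesis by (simp add: op_trace_def)
qed

text \<open>The marginal condition tested with the complement of \<open>coherent_proj\<close> has
  trace 0, since the mixture is fixed by the projection; hence \<open>Q\<close> absorbs the
  projection in either factor. Their product \<open>W\<close> sends \<open>F\<close> to its overlaps
  with coherent pairs, expanded in dual vectors, and self-adjointness of \<open>Q\<close> lets
  \<open>W\<close> act on both sides. The coefficients are therefore matrix elements of
  \<open>Q\<close> between dual vectors.\<close>

lemma coupling_structure:
  assumes \<kappa>: "\<kappa> > 0" and a: "a > 0" and b: "b > 0"
    and cp: "coupling (half_mixture (\<lambda>\<sigma>. coherent \<kappa> (\<sigma> * a))) (half_mixture (\<lambda>\<sigma>. coherent \<kappa> (\<sigma> * b))) Q"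
  defines "J \<equiv> ({a, - a} \<times> {b, - b}) \<times> ({a, - a} \<times> {b, - b})"
    and "q \<equiv> \<lambda>x. cinner (coherent_pair_dual \<kappa> (fst x)) (Q (coherent_pair_dual \<kappa> (snd x)))"
  shows "Q F = (\<Sum>x\<in>J. cinner (coherent_pair \<kappa> (snd x)) F *\<^sub>C q x *\<^sub>C coherent_pair \<kappa> (fst x))"
proof -
  let ?I = "{a, - a} \<times> {b, - b}"
  let ?id = "id :: real L2 \<Rightarrow> real L2"
  have Q: "density_matrix Q"
    and trA: "\<And>A. bounded_op A \<Longrightarrow> op_trace (tensor_op A id \<circ> Q) = op_trace (A \<circ> half_mixture (\<lambda>\<sigma>. coherent \<kappa> (\<sigma> * a)))"
    and trB: "\<And>B. bounded_op B \<Longrightarrow> op_trace (tensor_op id B \<circ> Q) = op_trace (B \<circ> half_mixture (\<lambda>\<sigma>. coherent \<kappa> (\<sigma> * b)))"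
    using cp by (auto simp: coupling_def)
  have Q': "bounded_op Q" "\<And>f g. cinner (Q f) g = cinner f (Q g)"
    using Q by (auto simp: density_matrix_def)
  define PA where "PA = tensor_op (coherent_proj \<kappa> a) ?id"
  define PB where "PB = tensor_op ?id (coherent_proj \<kappa> b)"
  have PA: "bounded_op PA" "\<And>f g. PA (tensor f g) = tensor (coherent_proj \<kappa> a f) g"
    unfolding PA_def by (intro tensor_op_left bounded_op_coherent_proj)+
  have PB: "bounded_op PB" "\<And>f g. PB (tensor f g) = tensor f (coherent_proj \<kappa> b g)"
    unfolding PB_def by (intro tensor_op_right bounded_op_coherent_proj)+
  have N: "bounded_op (\<lambda>f. f - P f)" if "bounded_op P" for P :: "'z::euclidean_space L2 \<Rightarrow> 'z L2"
    using bounded_op_intros(3)[OF bounded_op_intros(5)[OF that that] that] by simp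
  have coh: "coherent_proj \<kappa> c (coherent \<kappa> (\<sigma> * c)) = coherent \<kappa> (\<sigma> * c)" if "\<sigma> \<in> {1, - 1}" "c > 0" for \<sigma> c
    using that by (intro coherent_proj_coherent[OF \<kappa>]) auto
  have QA: "Q (PA F) = Q F" for F
  proof (rule density_support[OF Q PA(1)])
    show "cinner (PA F) G = cinner F (PA G)" for F G
      by (rule tensor_adjointI[OF PA(1) PA(1)]) (simp add: PA cinner_tensor coherent_proj_symmetric[OF a])
    have "PA \<circ> PA = PA"
      by (rule plane_determined[OF bounded_op_intros(1)[OF PA(1) PA(1)] PA(1)]) (simp add: PA(2) coherent_proj_idem[OF \<kappa> a])
    then show "PA (PA F) = PA F" for F by (metis comp_apply)
    have "tensor_op (\<lambda>f. f - coherent_proj \<kappa> a f) ?id = (\<lambda>F. F - PA F)"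
      by (rule tensor_op_eqI[OF N[OF PA(1)]])
         (simp add: PA(2) linear_diff[OF bounded_linear.linear[OF bounded_linear_tensor_left]])
    moreover have "op_trace ((\<lambda>f. f - coherent_proj \<kappa> a f) \<circ> half_mixture (\<lambda>\<sigma>. coherent \<kappa> (\<sigma> * a))) = 0"
      by (rule op_trace_complement[OF bounded_op_coherent_proj]) (rule coh[OF _ a])
    ultimately show "op_trace ((\<lambda>F. F - PA F) \<circ> Q) = 0"
      using trA[OF N[OF bounded_op_coherent_proj], of \<kappa> a] by simp
  qed
  have QB: "Q (PB F) = Q F" for F
  proof (rule density_support[OF Q PB(1)])
    show "cinner (PB F) G = cinner F (PB G)" for F G
      by (rule tensor_adjointI[OF PB(1) PB(1)]) (simp add: PB cinner_tensor coherent_proj_symmetric[OF b])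
    have "PB \<circ> PB = PB"
      by (rule plane_determined[OF bounded_op_intros(1)[OF PB(1) PB(1)] PB(1)]) (simp add: PB(2) coherent_proj_idem[OF \<kappa> b])
    then show "PB (PB F) = PB F" for F by (metis comp_apply)
    have "tensor_op ?id (\<lambda>f. f - coherent_proj \<kappa> b f) = (\<lambda>F. F - PB F)"
      by (rule tensor_op_eqI[OF N[OF PB(1)]])
         (simp add: PB(2) linear_diff[OF bounded_linear.linear[OF bounded_linear_tensor_right]])
    moreover have "op_trace ((\<lambda>f. f - coherent_proj \<kappa> b f) \<circ> half_mixture (\<lambda>\<sigma>. coherent \<kappa> (\<sigma> * b))) = 0"
      by (rule op_trace_complement[OF bounded_op_coherent_proj]) (rule coh[OF _ b])
    ultimately show "op_trace ((\<lambda>F. F - PB F) \<circ> Q) = 0"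
      using trB[OF N[OF bounded_op_coherent_proj], of \<kappa> b] by simp
  qed
  define W where "W F = (\<Sum>p\<in>?I. cinner (coherent_pair \<kappa> p) F *\<^sub>C coherent_pair_dual \<kappa> p)" for F
  have W: "bounded_op W"
    unfolding W_def[abs_def] by (intro bounded_op_sum bounded_op_rank_one)
  have "PB \<circ> PA = W"
  proof (rule plane_determined[OF bounded_op_intros(1)[OF PB(1) PA(1)] W])
    fix f g :: "real L2"
    have "tensor (coherent_proj \<kappa> a f) (coherent_proj \<kappa> b g)
        = (\<Sum>\<alpha>\<in>{a, - a}. \<Sum>\<beta>\<in>{b, - b}. (cinner (coherent \<kappa> \<alpha>) f * cinner (coherent \<kappa> \<beta>) g) *\<^sub>C tensor (coherent_dual \<kappa> \<alpha>) (coherent_dual \<kappa> \<beta>))"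
      unfolding coherent_proj_def linear_sum[OF bounded_linear.linear[OF bounded_linear_tensor_left]]
      unfolding linear_sum[OF bounded_linear.linear[OF bounded_linear_tensor_right]]
      unfolding tensor_bilinear scaleC_scaleC by (simp only: mult.commute)
    also have "\<dots> = W (tensor f g)"
      unfolding W_def sum.cartesian_product
      by (simp only: coherent_pair_def coherent_pair_dual_def cinner_tensor case_prod_beta')
    finally show "(PB \<circ> PA) (tensor f g) = W (tensor f g)" by (simp add: PA(2) PB(2))
  qed
  then have QW: "Q (W F) = Q F" for F by (metis QA QB comp_apply)
  show ?thesis
  proof (rule cinner_cong_all)
    fix G
    \<comment> \<open>Self-adjointness of \<open>Q\<close> transfers the absorption of
      \<open>W\<close> to the left argument.\<close>
    have "cinner G (Q F) = cinner (W G) (Q F)"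
      using Q'(2)[of G F] Q'(2)[of "W G" F] QW[of G] by simp
    also have "\<dots> = cinner (W G) (Q (W F))" by (simp only: QW)
    also have "\<dots> = (\<Sum>p\<in>?I. \<Sum>p'\<in>?I. cinner G (coherent_pair \<kappa> p) *
        (cinner (coherent_pair \<kappa> p') F * cinner (coherent_pair_dual \<kappa> p) (Q (coherent_pair_dual \<kappa> p'))))"
      unfolding W_def bounded_op_simps[OF Q'(1)] cinner_sum_left
      unfolding cinner_sum_right cinner_scaleC_left cinner_scaleC_right sum_distrib_left cinner_commute[of G]
      by (simp only: mult_ac)
    also have "\<dots> = (\<Sum>x\<in>J. cinner (coherent_pair \<kappa> (snd x)) F * (q x * cinner G (coherent_pair \<kappa> (fst x))))"
      unfolding J_def q_def sum.cartesian_product by (simp only: case_prod_beta' mult_ac)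
    finally show "cinner G (Q F) = cinner G (\<Sum>x\<in>J. cinner (coherent_pair \<kappa> (snd x)) F *\<^sub>C q x *\<^sub>C coherent_pair \<kappa> (fst x))"
      unfolding cinner_sum_right cinner_scaleC_right .
  qed
qed

section \<open>The lower bound\<close>

text \<open>Passes from finite eigenvector sums to the full trace when the upper bound is the
  supremum \<open>transport_cost\<close>, possibly infinite.\<close>

lemma has_sum_ennreal_bound:
  fixes h :: "'i \<Rightarrow> real"
  assumes h: "(h has_sum l) UNIV" and le: "\<And>F. finite F \<Longrightarrow> ennreal (sum h F) \<le> t"
  shows "ennreal l \<le> t"
proof (cases t)
  case (real r)
  have "l \<le> r"
  proof (rule has_sum_le_finite_sums[OF h])
    fix F :: "'i set" assume "finite F"
    from le[OF this] have "ennreal (sum h F) \<le> ennreal r" by (simp add: real)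
    then show "sum h F \<le> r" using real by (simp add: ennreal_le_iff)
  qed
  then show ?thesis by (simp add: real ennreal_leI)
qed simp

text \<open>In the finite matrix \<open>q\<close> every quadratic expression in X and Y becomes a
  numerical kernel times the Gram matrix \<open>G\<close>, because coherent pairs are joint
  eigenvectors. The operator inequality turns into an identity between kernels together with the
  positivity of \<open>Z\<close>.\<close>

lemma transport_cost_ge:
  assumes \<kappa>: "\<kappa> > 0" and a: "a > 0" and b: "b > 0"
    and cp: "coupling (half_mixture (\<lambda>\<sigma>. coherent \<kappa> (\<sigma> * a))) (half_mixture (\<lambda>\<sigma>. coherent \<kappa> (\<sigma> * b))) Q"
  shows "ennreal ((a - b)\<^sup>2) \<le> transport_cost \<kappa> Q"
proof -
  let ?I = "{a, - a} \<times> {b, - b}"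
  let ?R = "half_mixture (\<lambda>\<sigma>. coherent \<kappa> (\<sigma> * a))" and ?S = "half_mixture (\<lambda>\<sigma>. coherent \<kappa> (\<sigma> * b))"
  let ?id = "id :: real L2 \<Rightarrow> real L2"
  define J where "J = ?I \<times> ?I"
  have J: "finite J" by (simp add: J_def)
  define q where "q x = cinner (coherent_pair_dual \<kappa> (fst x)) (Q (coherent_pair_dual \<kappa> (snd x)))" for x
  define G where "G x = cinner (coherent_pair \<kappa> (snd x)) (coherent_pair \<kappa> (fst x))" for x
  define E where "E = hermite_plane \<kappa>"
  define \<mu> where "\<mu> = cost_eigenvalue \<kappa>"
  note Eonb = onb_family_hermite_plane[OF \<kappa>, folded E_def]
  have Q: "density_matrix Q"
    and trA: "\<And>A. bounded_op A \<Longrightarrow> op_trace (tensor_op A id \<circ> Q) = op_trace (A \<circ> ?R)"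
    and trB: "\<And>B. bounded_op B \<Longrightarrow> op_trace (tensor_op id B \<circ> Q) = op_trace (B \<circ> ?S)"
    using cp by (auto simp: coupling_def)
  have Q': "bounded_op Q" "\<And>f. 0 \<le> Re (cinner f (Q f))"
    using Q by (auto simp: density_matrix_def)
  have QF: "Q F = (\<Sum>x\<in>J. cinner (coherent_pair \<kappa> (snd x)) F *\<^sub>C q x *\<^sub>C coherent_pair \<kappa> (fst x))" for F
    unfolding J_def q_def by (rule coupling_structure[OF \<kappa> a b cp])
  have tr: "op_trace (T \<circ> Q) = (\<Sum>x\<in>J. q x * cinner (coherent_pair \<kappa> (snd x)) (T (coherent_pair \<kappa> (fst x))))"
    if T: "bounded_op T" for T
  proof -
    have "(T \<circ> Q) F = (\<Sum>x\<in>J. cinner (coherent_pair \<kappa> (snd x)) F *\<^sub>C q x *\<^sub>C T (coherent_pair \<kappa> (fst x)))" for F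
      by (simp add: QF bounded_op_simps[OF T])
    from op_trace_finite_rank[OF ex_orthonormal_basis_plane J this] show ?thesis by (simp add: o_def)
  qed
  \<comment> \<open>The marginal conditions tested with bounded number operators; in the mixture
    both pure states have the same expectation, the square of the displacement.\<close>
  have number: "(\<Sum>x\<in>J. q x * (of_real (fst (fst x) * fst (snd x)) * G x)) = of_real (a\<^sup>2)"
    "(\<Sum>x\<in>J. q x * (of_real (snd (fst x) * snd (snd x)) * G x)) = of_real (b\<^sup>2)"
  proof -
    have half: "(\<Sum>\<sigma>\<in>{1, - 1 :: real}. of_real (1 / 2) * cinner (coherent \<kappa> (\<sigma> * c)) (A (coherent \<kappa> (\<sigma> * c)))) = of_real (c\<^sup>2)"
      if H: "\<forall>\<alpha>\<in>{c, - c}. \<forall>\<alpha>'\<in>{c, - c}. cinner (coherent \<kappa> \<alpha>') (A (coherent \<kappa> \<alpha>)) = of_real (\<alpha> * \<alpha>') * cinner (coherent \<kappa> \<alpha>') (coherent \<kappa> \<alpha>)"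
      for A c
    proof -
      have "cinner (coherent \<kappa> \<alpha>) (A (coherent \<kappa> \<alpha>)) = of_real (\<alpha> * \<alpha>)" if "\<alpha> \<in> {c, - c}" for \<alpha>
        using H[rule_format, OF that that] by (simp add: cinner_self norm_coherent[OF \<kappa>])
      then show ?thesis by (simp add: power2_eq_square)
    qed
    obtain A where A: "bounded_op A"
      "\<forall>\<alpha>\<in>{a, - a}. \<forall>\<alpha>'\<in>{a, - a}. cinner (coherent \<kappa> \<alpha>') (A (coherent \<kappa> \<alpha>)) = of_real (\<alpha> * \<alpha>') * cinner (coherent \<kappa> \<alpha>') (coherent \<kappa> \<alpha>)"
      using ex_number_operator[OF \<kappa> a] by blast
    have "(\<Sum>x\<in>J. q x * (of_real (fst (fst x) * fst (snd x)) * G x))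
        = (\<Sum>x\<in>J. q x * cinner (coherent_pair \<kappa> (snd x)) (tensor_op A ?id (coherent_pair \<kappa> (fst x))))"
    proof (rule sum.cong[OF refl])
      fix x assume "x \<in> J"
      then have "fst (fst x) \<in> {a, - a}" "fst (snd x) \<in> {a, - a}" by (auto simp: J_def)
      with A(2) show "q x * (of_real (fst (fst x) * fst (snd x)) * G x)
          = q x * cinner (coherent_pair \<kappa> (snd x)) (tensor_op A ?id (coherent_pair \<kappa> (fst x)))"
        unfolding coherent_pair_def G_def tensor_op_left(2)[OF A(1)] cinner_tensor by (simp only: mult.assoc)
    qed
    also have "\<dots> = op_trace (A \<circ> ?R)"
      using tr[OF tensor_op_left(1)[OF A(1)]] trA[OF A(1)] by simp
    also have "\<dots> = of_real (a\<^sup>2)"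
      using op_trace_mixture[OF ex_orthonormal_basis_real _ A(1), of "{1, - 1}" "\<lambda>_. 1 / 2" "\<lambda>\<sigma>. coherent \<kappa> (\<sigma> * a)"] half[OF A(2)] by simp
    finally show "(\<Sum>x\<in>J. q x * (of_real (fst (fst x) * fst (snd x)) * G x)) = of_real (a\<^sup>2)" .
    obtain B where B: "bounded_op B"
      "\<forall>\<alpha>\<in>{b, - b}. \<forall>\<alpha>'\<in>{b, - b}. cinner (coherent \<kappa> \<alpha>') (B (coherent \<kappa> \<alpha>)) = of_real (\<alpha> * \<alpha>') * cinner (coherent \<kappa> \<alpha>') (coherent \<kappa> \<alpha>)"
      using ex_number_operator[OF \<kappa> b] by blast
    have "(\<Sum>x\<in>J. q x * (of_real (snd (fst x) * snd (snd x)) * G x))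
        = (\<Sum>x\<in>J. q x * cinner (coherent_pair \<kappa> (snd x)) (tensor_op ?id B (coherent_pair \<kappa> (fst x))))"
    proof (rule sum.cong[OF refl])
      fix x assume "x \<in> J"
      then have "snd (fst x) \<in> {b, - b}" "snd (snd x) \<in> {b, - b}" by (auto simp: J_def)
      with B(2) show "q x * (of_real (snd (fst x) * snd (snd x)) * G x)
          = q x * cinner (coherent_pair \<kappa> (snd x)) (tensor_op ?id B (coherent_pair \<kappa> (fst x)))"
        unfolding coherent_pair_def G_def tensor_op_right(2)[OF B(1)] cinner_tensor by (simp only: mult_ac)
    qed
    also have "\<dots> = op_trace (B \<circ> ?S)"
      using tr[OF tensor_op_right(1)[OF B(1)]] trB[OF B(1)] by simp
    also have "\<dots> = of_real (b\<^sup>2)"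
      using op_trace_mixture[OF ex_orthonormal_basis_real _ B(1), of "{1, - 1}" "\<lambda>_. 1 / 2" "\<lambda>\<sigma>. coherent \<kappa> (\<sigma> * b)"] half[OF B(2)] by simp
    finally show "(\<Sum>x\<in>J. q x * (of_real (snd (fst x) * snd (snd x)) * G x)) = of_real (b\<^sup>2)" .
  qed
  have EQ: "cinner (E i) (Q (E i)) = (\<Sum>x\<in>J. q x * (cinner (coherent_pair \<kappa> (snd x)) (E i) * cinner (E i) (coherent_pair \<kappa> (fst x))))" for i
    unfolding QF cinner_sum_right cinner_scaleC_right by (simp only: mult_ac)
  define d where "d p = fst p - snd p" for p :: "real \<times> real"
  define L where "L = (\<Sum>x\<in>J. q x * (of_real (d (fst x) * d (snd x)) * G x))"
  \<comment> \<open>The eigenvalues are moved onto the coherent pairs, which lie in the domain of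
    the cost; what remains is a finite combination of Parseval series, so convergence and value come
    together.\<close>
  have L: "((\<lambda>i. of_real (\<mu> i) * cinner (E i) (Q (E i))) has_sum L) UNIV"
  proof -
    have "of_real (\<mu> i) * cinner (E i) (coherent_pair \<kappa> p) = cinner (E i) (to_L2 (cost_expr \<kappa> (coherent_pair_fun \<kappa> p)))" for i p
      using cost_graph_subset[OF \<kappa> schwartz_coherent_pair[OF \<kappa>], of p]
      by (simp add: diag_op_def E_def \<mu>_def coherent_pair_eq[OF \<kappa>] del: split_paired_All)
    then have "of_real (\<mu> i) * cinner (E i) (Q (E i)) = (\<Sum>x\<in>J. q x * (cinner (coherent_pair \<kappa> (snd x)) (E i) *
        cinner (E i) (to_L2 (cost_expr \<kappa> (coherent_pair_fun \<kappa> (fst x))))))" for i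
      unfolding EQ sum_distrib_left by (intro sum.cong[OF refl]) (metis (no_types) mult.left_commute)
    moreover have "((\<lambda>i. \<Sum>x\<in>J. q x * (cinner (coherent_pair \<kappa> (snd x)) (E i) *
        cinner (E i) (to_L2 (cost_expr \<kappa> (coherent_pair_fun \<kappa> (fst x)))))) has_sum
        (\<Sum>x\<in>J. q x * cinner (coherent_pair \<kappa> (snd x)) (to_L2 (cost_expr \<kappa> (coherent_pair_fun \<kappa> (fst x)))))) UNIV"
      by (intro has_sum_sum_finite J has_sum_cmult_right onb_family_parseval[OF Eonb])
    ultimately show ?thesis
      by (simp only: cinner_cost_coherent_pair[OF \<kappa>] L_def d_def G_def)
  qed
  \<comment> \<open>The two square roots multiply to 1, which reproduces the cross terms of the
    cost, and \<open>z\<close> vanishes at (a, b) and (- a, - b), the support of the optimal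
    coupling.\<close>
  define z where "z p = sqrt (b / a) * fst p - sqrt (a / b) * snd p" for p
  define Z where "Z = (\<Sum>x\<in>J. q x * (of_real (z (fst x) * z (snd x)) * G x))"
  have "0 \<le> Re Z"
  proof -
    \<comment> \<open>\<open>y i\<close> is the adjoint of the operator with eigenvalues
      \<open>z p\<close> on the coherent pairs, applied to \<open>E i\<close>. Thus \<open>Z\<close>
      is the trace of \<open>Q\<close> conjugated by that operator, a series of nonnegative
      terms.\<close>
    define y where "y i = (\<Sum>p\<in>?I. (of_real (z p) * cinner (coherent_pair \<kappa> p) (E i)) *\<^sub>C coherent_pair_dual \<kappa> p)" for i
    have "cinner (y i) (Q (y i)) = (\<Sum>x\<in>J. q x * (of_real (z (fst x) * z (snd x)) *
        (cinner (coherent_pair \<kappa> (snd x)) (E i) * cinner (E i) (coherent_pair \<kappa> (fst x)))))" for i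
    proof -
      have "cinner (y i) (Q (y i)) = (\<Sum>p\<in>?I. \<Sum>p'\<in>?I. (of_real (z p) * cinner (E i) (coherent_pair \<kappa> p)) *
          ((of_real (z p') * cinner (coherent_pair \<kappa> p') (E i)) * cinner (coherent_pair_dual \<kappa> p) (Q (coherent_pair_dual \<kappa> p'))))"
        unfolding y_def bounded_op_simps[OF Q'(1)] cinner_sum_left
        unfolding cinner_sum_right cinner_scaleC_left cinner_scaleC_right complex_cnj_mult complex_cnj_complex_of_real
          sum_distrib_left cinner_commute[of "E i"] by (simp only: mult_ac)
      then show ?thesis
        unfolding J_def q_def sum.cartesian_product by (simp only: case_prod_beta' of_real_mult mult_ac)
    qed
    moreover have "((\<lambda>i. \<Sum>x\<in>J. q x * (of_real (z (fst x) * z (snd x)) *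
        (cinner (coherent_pair \<kappa> (snd x)) (E i) * cinner (E i) (coherent_pair \<kappa> (fst x))))) has_sum Z) UNIV"
      unfolding Z_def G_def by (intro has_sum_sum_finite J has_sum_cmult_right onb_family_parseval[OF Eonb])
    ultimately have "((\<lambda>i. cinner (y i) (Q (y i))) has_sum Z) UNIV" by (simp only:)
    from has_sum_Re[OF this] show ?thesis by (rule has_sum_nonneg) (rule Q'(2))
  qed
  moreover have "L = of_real (1 - b / a) * of_real (a\<^sup>2) + of_real (1 - a / b) * of_real (b\<^sup>2) + Z"
  proof -
    \<comment> \<open>The completed square at the level of eigenvalues, polarized to two indices
      because the off-diagonal entries of \<open>q\<close> enter as well.\<close>
    have split: "d p * d p' = (1 - b / a) * (fst p * fst p') + (1 - a / b) * (snd p * snd p') + z p * z p'" for p p'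
    proof -
      have "sqrt (b / a) * sqrt (b / a) = b / a" "sqrt (a / b) * sqrt (a / b) = a / b"
        "sqrt (b / a) * sqrt (a / b) = 1"
        using a b by (simp_all flip: real_sqrt_mult)
      then have "z p * z p' = b / a * (fst p * fst p') + a / b * (snd p * snd p') - fst p * snd p' - snd p * fst p'"
        unfolding z_def by algebra
      then show ?thesis by (simp add: d_def algebra_simps)
    qed
    show ?thesis
      unfolding L_def split Z_def number[symmetric] sum_distrib_left sum.distrib[symmetric]
      by (intro sum.cong[OF refl]) (simp only: of_real_add of_real_mult distrib_left distrib_right mult_ac)
  qed
  moreover have "(1 - b / a) * a\<^sup>2 + (1 - a / b) * b\<^sup>2 = (a - b)\<^sup>2"
    using a b by (simp add: field_simps power2_eq_square)
  ultimately have "(a - b)\<^sup>2 \<le> Re L"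
    by (simp del: of_real_power of_real_diff of_real_divide of_real_mult flip: of_real_mult)
  then have "ennreal ((a - b)\<^sup>2) \<le> ennreal (Re L)" by (rule ennreal_leI)
  \<comment> \<open>\<open>Re L\<close> is the cost evaluated along the eigenbasis, and every finite
    part of that sum is a competitor in the supremum.\<close>
  also have "\<dots> \<le> transport_cost \<kappa> Q"
  proof (rule has_sum_ennreal_bound)
    show "((\<lambda>i. Re (of_real (\<mu> i) * cinner (E i) (Q (E i)))) has_sum Re L) UNIV"
      by (rule has_sum_Re[OF L])
    fix F :: "(nat \<times> nat) set" assume "finite F"
    from trace_conj_diag_op_ge[OF Eonb Q'(1) this Q'(2), of "\<lambda>i. sqrt (\<mu> i)"]
    show "ennreal (\<Sum>i\<in>F. Re (of_real (\<mu> i) * cinner (E i) (Q (E i)))) \<le> transport_cost \<kappa> Q"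
      using \<kappa> unfolding transport_cost_def op_sqrt_cost_op[OF \<kappa>] E_def \<mu>_def
      by (simp add: cost_eigenvalue_def)
  qed
  finally show ?thesis .
qed

section \<open>The product coupling\<close>

lemma coupling_product:
  assumes \<kappa>: "\<kappa> > 0"
  shows "coupling (half_mixture (\<lambda>\<sigma>. coherent \<kappa> (\<sigma> * a))) (half_mixture (\<lambda>\<sigma>. coherent \<kappa> (\<sigma> * b)))
    (half_mixture (\<lambda>\<sigma>. coherent_pair \<kappa> (\<sigma> * a, \<sigma> * b)))"
  unfolding coupling_def
proof (intro conjI allI impI)
  have one: "cinner (coherent \<kappa> c) (coherent \<kappa> c) = 1" for c
    by (simp add: cinner_self norm_coherent[OF \<kappa>])
  show "density_matrix (half_mixture (\<lambda>\<sigma>. coherent_pair \<kappa> (\<sigma> * a, \<sigma> * b)))"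
    by (rule density_matrix_mixture[OF ex_orthonormal_basis_plane])
       (simp_all add: coherent_pair_def norm_tensor norm_coherent[OF \<kappa>])
  fix A :: "real L2 \<Rightarrow> real L2" assume A: "bounded_op A"
  show "op_trace (tensor_op A id \<circ> half_mixture (\<lambda>\<sigma>. coherent_pair \<kappa> (\<sigma> * a, \<sigma> * b)))
      = op_trace (A \<circ> half_mixture (\<lambda>\<sigma>. coherent \<kappa> (\<sigma> * a)))"
    by (subst op_trace_mixture[OF ex_orthonormal_basis_plane _ tensor_op_left(1)[OF A]], simp,
        subst op_trace_mixture[OF ex_orthonormal_basis_real _ A], simp,
        simp add: coherent_pair_def tensor_op_left(2)[OF A] cinner_tensor one)
  show "op_trace (tensor_op id A \<circ> half_mixture (\<lambda>\<sigma>. coherent_pair \<kappa> (\<sigma> * a, \<sigma> * b)))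
      = op_trace (A \<circ> half_mixture (\<lambda>\<sigma>. coherent \<kappa> (\<sigma> * b)))"
    by (subst op_trace_mixture[OF ex_orthonormal_basis_plane _ tensor_op_right(1)[OF A]], simp,
        subst op_trace_mixture[OF ex_orthonormal_basis_real _ A], simp,
        simp add: coherent_pair_def tensor_op_right(2)[OF A] cinner_tensor one)
qed

text \<open>The bound for mixtures reduces the cost to the expectations of the cost in the two
  product vectors; both equal the square of a - b, as the sign \<sigma> drops out.\<close>

lemma transport_cost_product:
  assumes \<kappa>: "\<kappa> > 0"
  shows "transport_cost \<kappa> (half_mixture (\<lambda>\<sigma>. coherent_pair \<kappa> (\<sigma> * a, \<sigma> * b))) \<le> ennreal ((a - b)\<^sup>2)"
proof -
  let ?\<psi> = "\<lambda>\<sigma> :: real. coherent_pair \<kappa> (\<sigma> * a, \<sigma> * b)"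
  let ?\<xi> = "\<lambda>\<sigma>. to_L2 (cost_expr \<kappa> (coherent_pair_fun \<kappa> (\<sigma> * a, \<sigma> * b)))"
  have sq: "(\<lambda>i. (sqrt (cost_eigenvalue \<kappa> i))\<^sup>2) = cost_eigenvalue \<kappa>"
    using \<kappa> by (simp add: fun_eq_iff cost_eigenvalue_def)
  have "transport_cost \<kappa> (half_mixture ?\<psi>) \<le> ennreal (\<Sum>\<sigma>\<in>{1, - 1}. 1 / 2 * Re (cinner (?\<psi> \<sigma>) (?\<xi> \<sigma>)))"
    unfolding transport_cost_def op_sqrt_cost_op[OF \<kappa>]
  proof (rule trace_conj_diag_op_le[OF onb_family_hermite_plane[OF \<kappa>]])
    show "half_mixture ?\<psi> f = (\<Sum>k\<in>{1, - 1}. (1 / 2) *\<^sub>R cinner (?\<psi> k) f *\<^sub>C ?\<psi> k)" for f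
      by (rule mixture_def)
    show "(?\<psi> \<sigma>, ?\<xi> \<sigma>) \<in> diag_op (hermite_plane \<kappa>) (\<lambda>i. (sqrt (cost_eigenvalue \<kappa> i))\<^sup>2)" for \<sigma>
      unfolding sq coherent_pair_eq[OF \<kappa>] by (rule cost_graph_subset[OF \<kappa> schwartz_coherent_pair[OF \<kappa>]])
  qed auto
  also have "(\<Sum>\<sigma>\<in>{1, - 1}. 1 / 2 * Re (cinner (?\<psi> \<sigma>) (?\<xi> \<sigma>))) = (a - b)\<^sup>2"
  proof -
    have "cinner (?\<psi> \<sigma>) (?\<psi> \<sigma>) = 1" for \<sigma>
      by (simp add: cinner_self coherent_pair_def norm_tensor norm_coherent[OF \<kappa>])
    then show ?thesis
      by (simp add: cinner_cost_coherent_pair[OF \<kappa>] power2_eq_square algebra_simps)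
  qed
  finally show ?thesis .
qed

text \<open>Valid at infinity too, so squaring \<open>MK2\<close> or \<open>W2\<close> returns
  exactly the infimum of the costs.\<close>

lemma ennsqrt_power2 [simp]: "(ennsqrt t)\<^sup>2 = t"
  by (cases t) (auto simp: ennsqrt_def ennreal_power power2_eq_square top_power_ennreal simp flip: ennreal_mult)

section \<open>The classical distance\<close>

lemma sets_half_sum [simp, measurable_cong]: "sets (half_sum M N) = sets M"
  and space_half_sum [simp]: "space (half_sum M N) = space M"
  by (simp_all add: half_sum_def sets.space_closed space_measure_of)

text \<open>A measure given by \<open>measure_of\<close> has the prescribed values only after
  countable additivity has been verified.\<close>

lemma emeasure_half_sum:
  assumes N: "sets N = sets M" and A: "A \<in> sets M"
  shows "emeasure (half_sum M N) A = (emeasure M A + emeasure N A) / 2"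
proof (rule emeasure_measure_of[OF half_sum_def])
  show "countably_additive (sets (half_sum M N)) (\<lambda>A. (emeasure M A + emeasure N A) / 2)"
  proof (rule countably_additiveI)
    fix F :: "nat \<Rightarrow> 'a set"
    assume F: "range F \<subseteq> sets (half_sum M N)" "disjoint_family F" "\<Union> (range F) \<in> sets (half_sum M N)"
    have "(\<Sum>i. (emeasure M (F i) + emeasure N (F i)) / 2) = ((\<Sum>i. emeasure M (F i)) + (\<Sum>i. emeasure N (F i))) / 2"
      by (simp add: divide_ennreal_def suminf_add)
    then show "(\<Sum>i. (emeasure M (F i) + emeasure N (F i)) / 2) = (emeasure M (\<Union> (range F)) + emeasure N (\<Union> (range F))) / 2"
      using F N by (simp add: suminf_emeasure)
  qed
qed (use A in \<open>auto simp: positive_def sets.space_closed dest: sets.sets_into_space\<close>)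

lemma half_one_plus_one: "(1 + 1) / 2 = (1 :: ennreal)"
  by (simp add: one_add_one ennreal_divide_self)

lemma prob_space_half_sum_return: "prob_space (half_sum (return borel c) (return borel d))"
  by (rule prob_spaceI) (simp add: emeasure_half_sum half_one_plus_one del: one_add_one)

lemma AE_half_sum_return:
  assumes "{x. \<not> P x} \<in> sets borel" "P c" "P d"
  shows "AE x in half_sum (return borel c) (return borel d). P x"
  by (rule AE_I[of _ _ "{x. \<not> P x}"]) (use assms in \<open>auto simp: emeasure_half_sum\<close>)

text \<open>The marginals concentrate every coupling on points with coordinates of modulus a and b,
  where the reverse triangle inequality bounds the cost below pointwise; the coupling that pairs
  equal signs attains this bound.\<close>

lemma W2_half_sum_squared:
  assumes "a > 0" "b > 0"
  shows "(W2 (half_sum (delta (- a)) (delta a)) (half_sum (delta (- b)) (delta b)))\<^sup>2 = ennreal ((a - b)\<^sup>2)"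
proof -
  let ?\<mu> = "half_sum (delta (- a)) (delta a)" and ?\<nu> = "half_sum (delta (- b)) (delta b)"
  let ?cost = "\<lambda>P. \<integral>\<^sup>+(x, y). ennreal (\<bar>x - y\<bar>\<^sup>2) \<partial>(P :: (real \<times> real) measure)"
  have fs: "fst \<in> borel_measurable (borel :: (real \<times> real) measure)" "snd \<in> borel_measurable (borel :: (real \<times> real) measure)"
    unfolding borel_prod[symmetric] by measurable
  have gap: "(a - b)\<^sup>2 \<le> \<bar>x - y\<bar>\<^sup>2" if "\<bar>x\<bar> = a" "\<bar>y\<bar> = b" for x y :: real
    unfolding abs_le_square_iff[symmetric] using that by linarith
  have lower: "ennreal ((a - b)\<^sup>2) \<le> ?cost P" if P: "classical_coupling ?\<mu> ?\<nu> P" for P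
  proof -
    interpret prob_space P using P by (simp add: classical_coupling_def)
    have [measurable_cong]: "sets P = sets borel" using P by (simp add: classical_coupling_def)
    have m: "fst \<in> borel_measurable P" "snd \<in> borel_measurable P"
      using fs measurable_cong_sets[OF \<open>sets P = sets borel\<close> refl] by auto
    have marg: "distr P borel fst = ?\<mu>" "distr P borel snd = ?\<nu>"
      using P by (auto simp only: classical_coupling_def)
    have "AE x in distr P borel fst. \<bar>x\<bar> = a" "AE y in distr P borel snd. \<bar>y\<bar> = b"
      unfolding marg by (rule AE_half_sum_return; use assms in simp)+
    from AE_distrD[OF m(1) this(1)] AE_distrD[OF m(2) this(2)] have "AE p in P. ennreal ((a - b)\<^sup>2) \<le> (case p of (x, y) \<Rightarrow> ennreal (\<bar>x - y\<bar>\<^sup>2))"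
      by eventually_elim (simp only: case_prod_beta' ennreal_leI gap)
    from nn_integral_mono_AE[OF this] show ?thesis by (simp add: emeasure_space_1)
  qed
  define P where "P = half_sum (return borel (- a, - b)) (return borel (a, b))"
  have P: "classical_coupling ?\<mu> ?\<nu> P"
    unfolding classical_coupling_def
  proof (intro conjI)
    show "prob_space P" unfolding P_def by (rule prob_space_half_sum_return)
    show "sets P = sets borel" by (simp add: P_def)
    then have m: "fst \<in> borel_measurable P" "snd \<in> borel_measurable P"
      using fs measurable_cong_sets[OF \<open>sets P = sets borel\<close> refl] by auto
    have vim: "fst -` A \<in> sets (borel :: (real \<times> real) measure)" "snd -` A \<in> sets (borel :: (real \<times> real) measure)"
      if "A \<in> sets borel" for A
      using measurable_sets[OF fs(1) that] measurable_sets[OF fs(2) that] by simp_all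
    show "distr P borel fst = ?\<mu>"
      by (rule measure_eqI) (use m vim in \<open>auto simp: emeasure_distr P_def emeasure_half_sum indicator_def\<close>)
    show "distr P borel snd = ?\<nu>"
      by (rule measure_eqI) (use m vim in \<open>auto simp: emeasure_distr P_def emeasure_half_sum indicator_def\<close>)
  qed
  have upper: "?cost P \<le> ennreal ((a - b)\<^sup>2)"
  proof -
    interpret prob_space P using P by (simp add: classical_coupling_def)
    have "(\<lambda>p :: real \<times> real. \<bar>fst p - snd p\<bar>\<^sup>2) \<in> borel_measurable borel"
      using fs by measurable
    then have "AE p in P. \<bar>fst p - snd p\<bar>\<^sup>2 = (a - b)\<^sup>2"
      unfolding P_def by (intro AE_half_sum_return) (auto simp: power2_commute)
    then have "AE p in P. (case p of (x, y) \<Rightarrow> ennreal (\<bar>x - y\<bar>\<^sup>2)) = ennreal ((a - b)\<^sup>2)"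
      by eventually_elim (simp only: case_prod_beta')
    then have "?cost P = (\<integral>\<^sup>+p. ennreal ((a - b)\<^sup>2) \<partial>P)"
      by (rule nn_integral_cong_AE)
    then show ?thesis by (simp add: emeasure_space_1)
  qed
  show ?thesis
    unfolding W2_def ennsqrt_power2
    by (intro antisym INF_lower2[of P] INF_greatest) (use P upper lower in auto)
qed

theorem mainTheorem1:
  fixes hbar a b :: real
    and R S :: "real L2 \<Rightarrow> real L2"
    and Q :: "(real \<times> real) L2 \<Rightarrow> (real \<times> real) L2"
  assumes "hbar > 0" and "a > 0" and "b > 0"
    and R: "R = (\<lambda>f. (1/2) *\<^sub>R (ket_bra (coherent hbar a) f + ket_bra (coherent hbar (-a)) f))"
    and S: "S = (\<lambda>f. (1/2) *\<^sub>R (ket_bra (coherent hbar b) f + ket_bra (coherent hbar (-b)) f))"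
    and Q: "Q = (\<lambda>f. (1/2) *\<^sub>R
      (tensor_op (ket_bra (coherent hbar a)) (ket_bra (coherent hbar b)) f +
       tensor_op (ket_bra (coherent hbar (-a))) (ket_bra (coherent hbar (-b))) f))"
  shows "density_matrix R \<and> density_matrix S \<and>
    (MK2 hbar R S)\<^sup>2 = ennreal ((a - b)\<^sup>2) \<and>
    (W2 (half_sum (delta (-a)) (delta a)) (half_sum (delta (-b)) (delta b)))\<^sup>2 = ennreal ((a - b)\<^sup>2) \<and>
    optimal_coupling hbar R S Q"
proof -
  \<comment> \<open>A common sign \<sigma> indexes all three mixtures, so the correlation of the two
    factors in \<open>Q\<close> is expressed by a shared index.\<close>
  have R': "R = half_mixture (\<lambda>\<sigma>. coherent hbar (\<sigma> * a))"
    and S': "S = half_mixture (\<lambda>\<sigma>. coherent hbar (\<sigma> * b))"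
    unfolding R S by (simp_all add: fun_eq_iff mixture_def ket_bra_def scaleR_add_right)
  have Q': "Q = half_mixture (\<lambda>\<sigma>. coherent_pair hbar (\<sigma> * a, \<sigma> * b))"
    unfolding Q tensor_op_ket_bra
    by (simp add: fun_eq_iff mixture_def ket_bra_def coherent_pair_def scaleR_add_right)
  have cp: "coupling R S Q"
    unfolding R' S' Q' by (rule coupling_product[OF \<open>hbar > 0\<close>])
  have lower: "ennreal ((a - b)\<^sup>2) \<le> transport_cost hbar Q'" if "coupling R S Q'" for Q'
    using that unfolding R' S' by (rule transport_cost_ge[OF \<open>hbar > 0\<close> \<open>a > 0\<close> \<open>b > 0\<close>])
  \<comment> \<open>The general lower bound is applied to \<open>Q\<close> itself, which fixes its
    cost exactly and makes it a minimizer.\<close>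
  have cost: "transport_cost hbar Q = ennreal ((a - b)\<^sup>2)"
    using transport_cost_product[OF \<open>hbar > 0\<close>, of a b] lower[OF cp] unfolding Q' by (rule antisym)
  have MK: "(MK2 hbar R S)\<^sup>2 = ennreal ((a - b)\<^sup>2)"
    unfolding MK2_def ennsqrt_power2
    by (intro antisym INF_lower2[of Q] INF_greatest) (use cp cost lower in auto)
  moreover have "optimal_coupling hbar R S Q"
    unfolding optimal_coupling_def using cp cost MK by simp
  moreover have "density_matrix R" "density_matrix S"
    unfolding R' S' by (rule density_matrix_mixture[OF ex_orthonormal_basis_real];
        simp add: norm_coherent[OF \<open>hbar > 0\<close>])+
  ultimately show ?thesis
    using W2_half_sum_squared[OF \<open>a > 0\<close> \<open>b > 0\<close>] by blast
qed

end
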